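(* The inclusion $\mathbf{DMC}\hookrightarrow\mathbf{sDMC}$ of display map categories into structured display map categories, or equivalently the inclusion $\mathbf{CompCat}^{\mathrm{str2}}_{\mathrm{repl}}\hookrightarrow\mathbf{CompCat}^{\mathrm{str2}}_{\mathrm{sub}}$ of replete into subcategorical comprehension categories with strict maps, has a left adjoint.
   Context: **Structured display map categories.** A display structure on a category $\mathcal C$ is a class $\mathcal D$ of morphisms (display maps) such that for any display map $d$ and any map $f$ into its target there is a display map $f^*d$ that is a pullback of $d$ along $f$. A structured display map category is a category with a display structure; it is a display map category if moreover $\mathcal D$ is replete (isomorphism-invariant: closed under isomorphism in the arrow category). $\mathbf{sDMC}$ (resp. $\mathbf{DMC}$) is the 2-category of structured display map categories (resp. display map categories), functors preserving display maps and pullbacks of display maps, and natural transformations. **Comprehension categories.** A comprehension category $(\mathcal C,\mathcal T,p,\chi)$ is a category $\mathcal C$, a fibration $p:\mathcal T\to\mathcal C$, and a functor $\chi:\mathcal T\to\mathcal C^{\to}$ with $\mathrm{cod}\circ\chi=p$ strictly, sending $p$-cartesian maps to pullback squares. A strict map is a pair of functors $F:\mathcal C\to\mathcal C'$, $\bar F:\mathcal T\to\mathcal T'$ with $\bar F$ strictly over $F$, preserving cartesian maps, and $\chi'\bar F=F^{\to}\chi$. A transformation is a natural transformation $\alpha:F\Rightarrow G$ and another $\bar\alpha:\bar F\Rightarrow\bar G$ strictly over $\alpha$, such that for each $A\in\mathcal T$ with $p(A)=\Gamma$, the domain component of $\chi'(\bar\alpha_A)$ is $\alpha_{\Gamma.A}$,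 where $\Gamma.A$ is the domain of $\chi(A)$. $\mathbf{CompCat}^{\mathrm{str2}}_{\mathrm{sub}}$ is the 2-category of those comprehension categories for which $\chi$ is a full subcategory inclusion, with strict maps and transformations, and $\mathbf{CompCat}^{\mathrm{str2}}_{\mathrm{repl}}$ its full sub-2-category on those for which $\mathcal T$ is moreover a replete subcategory of $\mathcal C^{\to}$. (Structured) display map categories $(\mathcal C,\mathcal D)$ correspond to subcategorical (resp. replete) comprehension categories by taking $\mathcal T=\mathcal D$ as a full subcategory of $\mathcal C^{\to}$, with $\chi$ the inclusion. **Conventions.** 2-categories and 2-functors are strict; a left adjoint is a left 2-adjoint (2-natural isomorphisms of hom-categories). *)

theory Defs
  imports Main "HOL-Library.FuncSet"
begin

section \<open>Categories, functors and natural transformations\<close>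

text \<open>
  Small categories with objects in type \<open>'o\<close> and arrows in type \<open>'a\<close>. All structure maps are
  required to be extensional (equal to \<open>undefined\<close> outside their domain), so that equality of
  records is equality of categories, functors and natural transformations. Composition
  \<open>Cmp C g f\<close> is in applicative order (\<open>g\<close> after \<open>f\<close>).
\<close>

record ('o, 'a) cat =
  Obj :: "'o set"
  Arr :: "'a set"
  Dom :: "'a \<Rightarrow> 'o"
  Cod :: "'a \<Rightarrow> 'o"
  Idt :: "'o \<Rightarrow> 'a"
  Cmp :: "'a \<Rightarrow> 'a \<Rightarrow> 'a"

locale category =
  fixes C :: "('o, 'a) cat"
  assumes Dom_ext: "Dom C \<in> Arr C \<rightarrow>\<^sub>E Obj C"
    and Cod_ext: "Cod C \<in> Arr C \<rightarrow>\<^sub>E Obj C"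
    and Idt_ext: "Idt C \<in> Obj C \<rightarrow>\<^sub>E Arr C"
    and Cmp_ext: "\<not> (f \<in> Arr C \<and> g \<in> Arr C \<and> Dom C g = Cod C f) \<Longrightarrow> Cmp C g f = undefined"
    and Dom_Idt: "x \<in> Obj C \<Longrightarrow> Dom C (Idt C x) = x"
    and Cod_Idt: "x \<in> Obj C \<Longrightarrow> Cod C (Idt C x) = x"
    and Cmp_Arr: "\<lbrakk>f \<in> Arr C; g \<in> Arr C; Dom C g = Cod C f\<rbrakk> \<Longrightarrow> Cmp C g f \<in> Arr C"
    and Dom_Cmp: "\<lbrakk>f \<in> Arr C; g \<in> Arr C; Dom C g = Cod C f\<rbrakk> \<Longrightarrow> Dom C (Cmp C g f) = Dom C f"
    and Cod_Cmp: "\<lbrakk>f \<in> Arr C; g \<in> Arr C; Dom C g = Cod C f\<rbrakk> \<Longrightarrow> Cod C (Cmp C g f) = Cod C g"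
    and Cmp_Idt_right: "f \<in> Arr C \<Longrightarrow> Cmp C f (Idt C (Dom C f)) = f"
    and Cmp_Idt_left: "f \<in> Arr C \<Longrightarrow> Cmp C (Idt C (Cod C f)) f = f"
    and Cmp_assoc: "\<lbrakk>f \<in> Arr C; g \<in> Arr C; h \<in> Arr C; Dom C g = Cod C f; Dom C h = Cod C g\<rbrakk>
      \<Longrightarrow> Cmp C h (Cmp C g f) = Cmp C (Cmp C h g) f"

definition is_iso :: "('o, 'a) cat \<Rightarrow> 'a \<Rightarrow> bool" where
  "is_iso C f \<longleftrightarrow> f \<in> Arr C \<and> (\<exists>g\<in>Arr C. Dom C g = Cod C f \<and> Cod C g = Dom C f
     \<and> Cmp C g f = Idt C (Dom C f) \<and> Cmp C f g = Idt C (Cod C f))"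

definition isomorphic :: "('o, 'a) cat \<Rightarrow> 'o \<Rightarrow> 'o \<Rightarrow> bool" where
  "isomorphic C x y \<longleftrightarrow> (\<exists>f. is_iso C f \<and> Dom C f = x \<and> Cod C f = y)"

definition full_subcat :: "('o, 'a) cat \<Rightarrow> 'o set \<Rightarrow> ('o, 'a) cat" where
  "full_subcat C S =
    (let A = {f \<in> Arr C. Dom C f \<in> S \<and> Cod C f \<in> S} in
     \<lparr> Obj = Obj C \<inter> S,
       Arr = A,
       Dom = restrict (Dom C) A,
       Cod = restrict (Cod C) A,
       Idt = restrict (Idt C) (Obj C \<inter> S),
       Cmp = (\<lambda>g f. if f \<in> A \<and> g \<in> A \<and> Dom C g = Cod C f then Cmp C g f else undefined) \<rparr>)"

definition full_subcategory :: "('o, 'a) cat \<Rightarrow> ('o, 'a) cat \<Rightarrow> bool" where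
  "full_subcategory S C \<longleftrightarrow> (\<exists>X\<subseteq>Obj C. S = full_subcat C X)"

definition replete_in :: "('o, 'a) cat \<Rightarrow> ('o, 'a) cat \<Rightarrow> bool" where
  "replete_in S C \<longleftrightarrow> (\<forall>f. is_iso C f \<and> Dom C f \<in> Obj S \<longrightarrow> Cod C f \<in> Obj S \<and> f \<in> Arr S)"

record ('o, 'a, 'p, 'b) ftor =
  Fo :: "'o \<Rightarrow> 'p"
  Fa :: "'a \<Rightarrow> 'b"

locale is_functor =
  fixes C :: "('o, 'a) cat" and D :: "('p, 'b) cat" and F :: "('o, 'a, 'p, 'b) ftor"
  assumes Fo_ext: "Fo F \<in> Obj C \<rightarrow>\<^sub>E Obj D"
    and Fa_ext: "Fa F \<in> Arr C \<rightarrow>\<^sub>E Arr D"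
    and Fa_Dom: "f \<in> Arr C \<Longrightarrow> Dom D (Fa F f) = Fo F (Dom C f)"
    and Fa_Cod: "f \<in> Arr C \<Longrightarrow> Cod D (Fa F f) = Fo F (Cod C f)"
    and Fa_Idt: "x \<in> Obj C \<Longrightarrow> Fa F (Idt C x) = Idt D (Fo F x)"
    and Fa_Cmp: "\<lbrakk>f \<in> Arr C; g \<in> Arr C; Dom C g = Cod C f\<rbrakk>
      \<Longrightarrow> Fa F (Cmp C g f) = Cmp D (Fa F g) (Fa F f)"

text \<open>
  \<open>incl_ftor S\<close> is the identity functor of \<open>S\<close> and also, when \<open>S\<close> is a subcategory of \<open>C\<close>,
  the inclusion \<open>S \<rightarrow> C\<close>, since functors do not store their codomain.
\<close>

definition incl_ftor :: "('o, 'a) cat \<Rightarrow> ('o, 'a, 'o, 'a) ftor" where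
  "incl_ftor S = \<lparr> Fo = restrict (\<lambda>x. x) (Obj S), Fa = restrict (\<lambda>f. f) (Arr S) \<rparr>"

abbreviation id_ftor :: "('o, 'a) cat \<Rightarrow> ('o, 'a, 'o, 'a) ftor" where
  "id_ftor \<equiv> incl_ftor"

definition comp_ftor ::
  "('o, 'a) cat \<Rightarrow> ('p, 'b, 'q, 'c) ftor \<Rightarrow> ('o, 'a, 'p, 'b) ftor \<Rightarrow> ('o, 'a, 'q, 'c) ftor" where
  "comp_ftor C G F = \<lparr> Fo = restrict (\<lambda>x. Fo G (Fo F x)) (Obj C),
                       Fa = restrict (\<lambda>f. Fa G (Fa F f)) (Arr C) \<rparr>"

definition cat_iso :: "('o, 'a) cat \<Rightarrow> ('p, 'b) cat \<Rightarrow> ('o, 'a, 'p, 'b) ftor \<Rightarrow> bool" where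
  "cat_iso C D F \<longleftrightarrow> is_functor C D F \<and>
     (\<exists>G. is_functor D C G \<and> comp_ftor C G F = id_ftor C \<and> comp_ftor D F G = id_ftor D)"

record ('o, 'a, 'p, 'b) nt =
  nsrc :: "('o, 'a, 'p, 'b) ftor"
  ntgt :: "('o, 'a, 'p, 'b) ftor"
  cmpt :: "'o \<Rightarrow> 'b"

locale is_nt =
  fixes C :: "('o, 'a) cat" and D :: "('p, 'b) cat" and \<alpha> :: "('o, 'a, 'p, 'b) nt"
  assumes nsrc_functor: "is_functor C D (nsrc \<alpha>)"
    and ntgt_functor: "is_functor C D (ntgt \<alpha>)"
    and cmpt_ext: "cmpt \<alpha> \<in> Obj C \<rightarrow>\<^sub>E Arr D"
    and cmpt_Dom: "x \<in> Obj C \<Longrightarrow> Dom D (cmpt \<alpha> x) = Fo (nsrc \<alpha>) x"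
    and cmpt_Cod: "x \<in> Obj C \<Longrightarrow> Cod D (cmpt \<alpha> x) = Fo (ntgt \<alpha>) x"
    and naturality: "f \<in> Arr C \<Longrightarrow>
      Cmp D (cmpt \<alpha> (Cod C f)) (Fa (nsrc \<alpha>) f) = Cmp D (Fa (ntgt \<alpha>) f) (cmpt \<alpha> (Dom C f))"

definition id_nt :: "('o, 'a) cat \<Rightarrow> ('p, 'b) cat \<Rightarrow> ('o, 'a, 'p, 'b) ftor \<Rightarrow> ('o, 'a, 'p, 'b) nt"
  where "id_nt C D F = \<lparr> nsrc = F, ntgt = F, cmpt = restrict (\<lambda>x. Idt D (Fo F x)) (Obj C) \<rparr>"

definition vcomp_nt :: "('o, 'a) cat \<Rightarrow> ('p, 'b) cat \<Rightarrow>
    ('o, 'a, 'p, 'b) nt \<Rightarrow> ('o, 'a, 'p, 'b) nt \<Rightarrow> ('o, 'a, 'p, 'b) nt" where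
  "vcomp_nt C D \<beta> \<alpha> = \<lparr> nsrc = nsrc \<alpha>, ntgt = ntgt \<beta>,
     cmpt = restrict (\<lambda>x. Cmp D (cmpt \<beta> x) (cmpt \<alpha> x)) (Obj C) \<rparr>"

text \<open>Horizontal composite of \<open>\<alpha> : F \<Rightarrow> F' : C \<rightarrow> D\<close> and \<open>\<beta> : G \<Rightarrow> G' : D \<rightarrow> E\<close>.\<close>

definition hcomp_nt :: "('o, 'a) cat \<Rightarrow> ('q, 'c) cat \<Rightarrow>
    ('p, 'b, 'q, 'c) nt \<Rightarrow> ('o, 'a, 'p, 'b) nt \<Rightarrow> ('o, 'a, 'q, 'c) nt" where
  "hcomp_nt C E \<beta> \<alpha> =
    \<lparr> nsrc = comp_ftor C (nsrc \<beta>) (nsrc \<alpha>), ntgt = comp_ftor C (ntgt \<beta>) (ntgt \<alpha>),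
      cmpt = restrict (\<lambda>x. Cmp E (cmpt \<beta> (Fo (ntgt \<alpha>) x)) (Fa (nsrc \<beta>) (cmpt \<alpha> x))) (Obj C) \<rparr>"

definition fun_cat :: "('o, 'a) cat \<Rightarrow> ('p, 'b) cat \<Rightarrow>
    (('o, 'a, 'p, 'b) ftor, ('o, 'a, 'p, 'b) nt) cat" where
  "fun_cat C D =
    \<lparr> Obj = {F. is_functor C D F},
      Arr = {\<alpha>. is_nt C D \<alpha>},
      Dom = restrict nsrc {\<alpha>. is_nt C D \<alpha>},
      Cod = restrict ntgt {\<alpha>. is_nt C D \<alpha>},
      Idt = restrict (id_nt C D) {F. is_functor C D F},
      Cmp = (\<lambda>\<beta> \<alpha>. if is_nt C D \<alpha> \<and> is_nt C D \<beta> \<and> nsrc \<beta> = ntgt \<alpha>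
                   then vcomp_nt C D \<beta> \<alpha> else undefined) \<rparr>"

section \<open>The arrow category and pullbacks\<close>

text \<open>
  \<open>Square d e u v\<close> is the arrow from \<open>d\<close> to \<open>e\<close> in the arrow category with domain component \<open>u\<close>
  and codomain component \<open>v\<close>.
\<close>

datatype 'a square = Square (sq_src: 'a) (sq_tgt: 'a) (sq_top: 'a) (sq_bot: 'a)

definition squares :: "('o, 'a) cat \<Rightarrow> 'a square set" where
  "squares C = {Square d e u v | d e u v. d \<in> Arr C \<and> e \<in> Arr C \<and> u \<in> Arr C \<and> v \<in> Arr C
     \<and> Dom C u = Dom C d \<and> Cod C u = Dom C e \<and> Dom C v = Cod C d \<and> Cod C v = Cod C e
     \<and> Cmp C e u = Cmp C v d}"

definition arrow_cat :: "('o, 'a) cat \<Rightarrow> ('a, 'a square) cat" where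
  "arrow_cat C =
    \<lparr> Obj = Arr C,
      Arr = squares C,
      Dom = restrict sq_src (squares C),
      Cod = restrict sq_tgt (squares C),
      Idt = restrict (\<lambda>d. Square d d (Idt C (Dom C d)) (Idt C (Cod C d))) (Arr C),
      Cmp = (\<lambda>t s. if s \<in> squares C \<and> t \<in> squares C \<and> sq_src t = sq_tgt s
                   then Square (sq_src s) (sq_tgt t) (Cmp C (sq_top t) (sq_top s))
                          (Cmp C (sq_bot t) (sq_bot s))
                   else undefined) \<rparr>"

definition cod_ftor :: "('o, 'a) cat \<Rightarrow> ('a, 'a square, 'o, 'a) ftor" where
  "cod_ftor C = \<lparr> Fo = restrict (Cod C) (Arr C), Fa = restrict sq_bot (squares C) \<rparr>"

definition arr_ftor :: "('o, 'a) cat \<Rightarrow> ('o, 'a, 'p, 'b) ftor \<Rightarrow> ('a, 'a square, 'b, 'b square) ftor"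
  where "arr_ftor C F = \<lparr> Fo = restrict (Fa F) (Arr C),
                          Fa = restrict (map_square (Fa F)) (squares C) \<rparr>"

text \<open>\<open>Square d e u v\<close> as a pullback square exhibits \<open>d\<close> as a pullback of \<open>e\<close> along \<open>v\<close>.\<close>

definition pullback_square :: "('o, 'a) cat \<Rightarrow> 'a square \<Rightarrow> bool" where
  "pullback_square C s \<longleftrightarrow> s \<in> squares C \<and>
    (\<forall>x\<in>Arr C. \<forall>y\<in>Arr C. Dom C x = Dom C y \<and> Cod C x = Dom C (sq_tgt s) \<and> Cod C y = Dom C (sq_bot s)
       \<and> Cmp C (sq_tgt s) x = Cmp C (sq_bot s) y \<longrightarrow>
      (\<exists>!h. h \<in> Arr C \<and> Dom C h = Dom C x \<and> Cod C h = Dom C (sq_src s)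
         \<and> Cmp C (sq_top s) h = x \<and> Cmp C (sq_src s) h = y))"

section \<open>2-categories and 2-adjunctions\<close>

text \<open>
  A strict 2-category given by its hom-categories, units and horizontal composition:
  \<open>Cmp1 X a b c\<close> and \<open>Cmp2 X a b c\<close> are the object and arrow parts of the composition functor
  \<open>Hom X b c \<times> Hom X a b \<rightarrow> Hom X a c\<close>.
\<close>

record ('o, 'f, 't) twocat =
  Cells0 :: "'o set"
  Hom :: "'o \<Rightarrow> 'o \<Rightarrow> ('f, 't) cat"
  Unit :: "'o \<Rightarrow> 'f"
  Cmp1 :: "'o \<Rightarrow> 'o \<Rightarrow> 'o \<Rightarrow> 'f \<Rightarrow> 'f \<Rightarrow> 'f"
  Cmp2 :: "'o \<Rightarrow> 'o \<Rightarrow> 'o \<Rightarrow> 't \<Rightarrow> 't \<Rightarrow> 't"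

locale two_category =
  fixes X :: "('o, 'f, 't) twocat"
  assumes Hom_category: "\<lbrakk>a \<in> Cells0 X; b \<in> Cells0 X\<rbrakk> \<Longrightarrow> category (Hom X a b)"
    and Unit_cell: "a \<in> Cells0 X \<Longrightarrow> Unit X a \<in> Obj (Hom X a a)"
    and Cmp1_cell: "\<lbrakk>a \<in> Cells0 X; b \<in> Cells0 X; c \<in> Cells0 X;
        f \<in> Obj (Hom X a b); g \<in> Obj (Hom X b c)\<rbrakk> \<Longrightarrow> Cmp1 X a b c g f \<in> Obj (Hom X a c)"
    and Cmp2_cell: "\<lbrakk>a \<in> Cells0 X; b \<in> Cells0 X; c \<in> Cells0 X;
        s \<in> Arr (Hom X a b); t \<in> Arr (Hom X b c)\<rbrakk> \<Longrightarrow> Cmp2 X a b c t s \<in> Arr (Hom X a c)"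
    and Cmp2_Dom: "\<lbrakk>a \<in> Cells0 X; b \<in> Cells0 X; c \<in> Cells0 X;
        s \<in> Arr (Hom X a b); t \<in> Arr (Hom X b c)\<rbrakk> \<Longrightarrow>
        Dom (Hom X a c) (Cmp2 X a b c t s) = Cmp1 X a b c (Dom (Hom X b c) t) (Dom (Hom X a b) s)"
    and Cmp2_Cod: "\<lbrakk>a \<in> Cells0 X; b \<in> Cells0 X; c \<in> Cells0 X;
        s \<in> Arr (Hom X a b); t \<in> Arr (Hom X b c)\<rbrakk> \<Longrightarrow>
        Cod (Hom X a c) (Cmp2 X a b c t s) = Cmp1 X a b c (Cod (Hom X b c) t) (Cod (Hom X a b) s)"
    and Cmp2_Idt: "\<lbrakk>a \<in> Cells0 X; b \<in> Cells0 X; c \<in> Cells0 X;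
        f \<in> Obj (Hom X a b); g \<in> Obj (Hom X b c)\<rbrakk> \<Longrightarrow>
        Cmp2 X a b c (Idt (Hom X b c) g) (Idt (Hom X a b) f) = Idt (Hom X a c) (Cmp1 X a b c g f)"
    and interchange: "\<lbrakk>a \<in> Cells0 X; b \<in> Cells0 X; c \<in> Cells0 X;
        s \<in> Arr (Hom X a b); s' \<in> Arr (Hom X a b); Dom (Hom X a b) s' = Cod (Hom X a b) s;
        t \<in> Arr (Hom X b c); t' \<in> Arr (Hom X b c); Dom (Hom X b c) t' = Cod (Hom X b c) t\<rbrakk> \<Longrightarrow>
        Cmp2 X a b c (Cmp (Hom X b c) t' t) (Cmp (Hom X a b) s' s) =
        Cmp (Hom X a c) (Cmp2 X a b c t' s') (Cmp2 X a b c t s)"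
    and Cmp1_assoc: "\<lbrakk>a \<in> Cells0 X; b \<in> Cells0 X; c \<in> Cells0 X; d \<in> Cells0 X;
        f \<in> Obj (Hom X a b); g \<in> Obj (Hom X b c); h \<in> Obj (Hom X c d)\<rbrakk> \<Longrightarrow>
        Cmp1 X a c d h (Cmp1 X a b c g f) = Cmp1 X a b d (Cmp1 X b c d h g) f"
    and Cmp2_assoc: "\<lbrakk>a \<in> Cells0 X; b \<in> Cells0 X; c \<in> Cells0 X; d \<in> Cells0 X;
        s \<in> Arr (Hom X a b); t \<in> Arr (Hom X b c); r \<in> Arr (Hom X c d)\<rbrakk> \<Longrightarrow>
        Cmp2 X a c d r (Cmp2 X a b c t s) = Cmp2 X a b d (Cmp2 X b c d r t) s"
    and Cmp1_Unit_right: "\<lbrakk>a \<in> Cells0 X; b \<in> Cells0 X; f \<in> Obj (Hom X a b)\<rbrakk> \<Longrightarrow>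
        Cmp1 X a a b f (Unit X a) = f"
    and Cmp1_Unit_left: "\<lbrakk>a \<in> Cells0 X; b \<in> Cells0 X; f \<in> Obj (Hom X a b)\<rbrakk> \<Longrightarrow>
        Cmp1 X a b b (Unit X b) f = f"
    and Cmp2_Unit_right: "\<lbrakk>a \<in> Cells0 X; b \<in> Cells0 X; s \<in> Arr (Hom X a b)\<rbrakk> \<Longrightarrow>
        Cmp2 X a a b s (Idt (Hom X a a) (Unit X a)) = s"
    and Cmp2_Unit_left: "\<lbrakk>a \<in> Cells0 X; b \<in> Cells0 X; s \<in> Arr (Hom X a b)\<rbrakk> \<Longrightarrow>
        Cmp2 X a b b (Idt (Hom X b b) (Unit X b)) s = s"

definition full_sub_twocat :: "('o, 'f, 't) twocat \<Rightarrow> ('o \<Rightarrow> bool) \<Rightarrow> ('o, 'f, 't) twocat" where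
  "full_sub_twocat X P = X \<lparr> Cells0 := {a \<in> Cells0 X. P a} \<rparr>"

record ('o, 'f, 't, 'p, 'g, 's) twoftor =
  on0 :: "'o \<Rightarrow> 'p"
  onHom :: "'o \<Rightarrow> 'o \<Rightarrow> ('f, 't, 'g, 's) ftor"

locale is_two_functor =
  fixes X :: "('o, 'f, 't) twocat" and Y :: "('p, 'g, 's) twocat"
    and K :: "('o, 'f, 't, 'p, 'g, 's) twoftor"
  assumes on0_cell: "a \<in> Cells0 X \<Longrightarrow> on0 K a \<in> Cells0 Y"
    and onHom_functor: "\<lbrakk>a \<in> Cells0 X; b \<in> Cells0 X\<rbrakk> \<Longrightarrow>
        is_functor (Hom X a b) (Hom Y (on0 K a) (on0 K b)) (onHom K a b)"
    and onHom_Unit: "a \<in> Cells0 X \<Longrightarrow> Fo (onHom K a a) (Unit X a) = Unit Y (on0 K a)"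
    and onHom_Cmp1: "\<lbrakk>a \<in> Cells0 X; b \<in> Cells0 X; c \<in> Cells0 X;
        f \<in> Obj (Hom X a b); g \<in> Obj (Hom X b c)\<rbrakk> \<Longrightarrow>
        Fo (onHom K a c) (Cmp1 X a b c g f) =
        Cmp1 Y (on0 K a) (on0 K b) (on0 K c) (Fo (onHom K b c) g) (Fo (onHom K a b) f)"
    and onHom_Cmp2: "\<lbrakk>a \<in> Cells0 X; b \<in> Cells0 X; c \<in> Cells0 X;
        s \<in> Arr (Hom X a b); t \<in> Arr (Hom X b c)\<rbrakk> \<Longrightarrow>
        Fa (onHom K a c) (Cmp2 X a b c t s) =
        Cmp2 Y (on0 K a) (on0 K b) (on0 K c) (Fa (onHom K b c) t) (Fa (onHom K a b) s)"

definition incl_twoftor :: "('o, 'f, 't) twocat \<Rightarrow> ('o, 'f, 't, 'o, 'f, 't) twoftor" where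
  "incl_twoftor X = \<lparr> on0 = (\<lambda>a. a), onHom = (\<lambda>a b. incl_ftor (Hom X a b)) \<rparr>"

definition twocat_iso :: "('o, 'f, 't) twocat \<Rightarrow> ('p, 'g, 's) twocat \<Rightarrow>
    ('o, 'f, 't, 'p, 'g, 's) twoftor \<Rightarrow> bool" where
  "twocat_iso X Y K \<longleftrightarrow> is_two_functor X Y K \<and> bij_betw (on0 K) (Cells0 X) (Cells0 Y) \<and>
     (\<forall>a\<in>Cells0 X. \<forall>b\<in>Cells0 X. cat_iso (Hom X a b) (Hom Y (on0 K a) (on0 K b)) (onHom K a b))"

text \<open>
  \<open>\<phi> b a\<close> is an isomorphism of categories \<open>X(L b, a) \<cong> Y(b, U a)\<close>. The last two conditions are
  2-naturality in \<open>b\<close> and \<open>a\<close>, on 1-cells and on 2-cells.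
\<close>

locale left_two_adjoint =
  fixes X :: "('o, 'f, 't) twocat" and Y :: "('p, 'g, 's) twocat"
    and U :: "('o, 'f, 't, 'p, 'g, 's) twoftor"
    and L :: "('p, 'g, 's, 'o, 'f, 't) twoftor"
    and \<phi> :: "'p \<Rightarrow> 'o \<Rightarrow> ('f, 't, 'g, 's) ftor"
  assumes X_two_category: "two_category X"
    and Y_two_category: "two_category Y"
    and U_two_functor: "is_two_functor X Y U"
    and L_two_functor: "is_two_functor Y X L"
    and hom_iso: "\<lbrakk>b \<in> Cells0 Y; a \<in> Cells0 X\<rbrakk> \<Longrightarrow>
        cat_iso (Hom X (on0 L b) a) (Hom Y b (on0 U a)) (\<phi> b a)"
    and natural1: "\<lbrakk>b \<in> Cells0 Y; b' \<in> Cells0 Y; a \<in> Cells0 X; a' \<in> Cells0 X;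
        g \<in> Obj (Hom Y b' b); h \<in> Obj (Hom X (on0 L b) a); f \<in> Obj (Hom X a a')\<rbrakk> \<Longrightarrow>
        Fo (\<phi> b' a') (Cmp1 X (on0 L b') a a' f
                        (Cmp1 X (on0 L b') (on0 L b) a h (Fo (onHom L b' b) g))) =
        Cmp1 Y b' (on0 U a) (on0 U a') (Fo (onHom U a a') f)
          (Cmp1 Y b' b (on0 U a) (Fo (\<phi> b a) h) g)"
    and natural2: "\<lbrakk>b \<in> Cells0 Y; b' \<in> Cells0 Y; a \<in> Cells0 X; a' \<in> Cells0 X;
        t \<in> Arr (Hom Y b' b); r \<in> Arr (Hom X (on0 L b) a); s \<in> Arr (Hom X a a')\<rbrakk> \<Longrightarrow>
        Fa (\<phi> b' a') (Cmp2 X (on0 L b') a a' s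
                        (Cmp2 X (on0 L b') (on0 L b) a r (Fa (onHom L b' b) t))) =
        Cmp2 Y b' (on0 U a) (on0 U a') (Fa (onHom U a a') s)
          (Cmp2 Y b' b (on0 U a) (Fa (\<phi> b a) r) t)"

definition has_left_two_adjoint :: "('o, 'f, 't) twocat \<Rightarrow> ('p, 'g, 's) twocat \<Rightarrow>
    ('o, 'f, 't, 'p, 'g, 's) twoftor \<Rightarrow> bool" where
  "has_left_two_adjoint X Y U \<longleftrightarrow> (\<exists>L \<phi>. left_two_adjoint X Y U L \<phi>)"

section \<open>Structured display map categories\<close>

definition display_structure :: "('o, 'a) cat \<Rightarrow> 'a set \<Rightarrow> bool" where
  "display_structure C D \<longleftrightarrow> D \<subseteq> Arr C \<and>
     (\<forall>d\<in>D. \<forall>f\<in>Arr C. Cod C f = Cod C d \<longrightarrow> (\<exists>d'\<in>D. \<exists>u. pullback_square C (Square d' d u f)))"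

definition replete_maps :: "('o, 'a) cat \<Rightarrow> 'a set \<Rightarrow> bool" where
  "replete_maps C D \<longleftrightarrow> (\<forall>d\<in>D. \<forall>e. isomorphic (arrow_cat C) d e \<longrightarrow> e \<in> D)"

type_synonym ('o, 'a) sdmcat = "('o, 'a) cat \<times> 'a set"

text \<open>
  Pullbacks of display maps are to be preserved whether or not the pulled back map is itself
  in the display class. No choice of pullbacks is part of the structure.
\<close>

definition display_functor ::
    "('o, 'a) sdmcat \<Rightarrow> ('p, 'b) sdmcat \<Rightarrow> ('o, 'a, 'p, 'b) ftor \<Rightarrow> bool" where
  "display_functor A B F \<longleftrightarrow> is_functor (fst A) (fst B) F \<and> Fa F ` snd A \<subseteq> snd B \<and>
     (\<forall>s. pullback_square (fst A) s \<and> sq_tgt s \<in> snd A \<longrightarrow>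
          pullback_square (fst B) (map_square (Fa F) s))"

type_synonym ('o, 'a) dm_twocat =
  "(('o, 'a) sdmcat, ('o, 'a, 'o, 'a) ftor, ('o, 'a, 'o, 'a) nt) twocat"

definition sDMC :: "('o, 'a) dm_twocat" where
  "sDMC =
    \<lparr> Cells0 = {(C, D). category C \<and> display_structure C D},
      Hom = (\<lambda>A B. full_subcat (fun_cat (fst A) (fst B)) {F. display_functor A B F}),
      Unit = (\<lambda>A. id_ftor (fst A)),
      Cmp1 = (\<lambda>A B E G F. comp_ftor (fst A) G F),
      Cmp2 = (\<lambda>A B E \<beta> \<alpha>. hcomp_nt (fst A) (fst E) \<beta> \<alpha>) \<rparr>"

definition DMC :: "('o, 'a) dm_twocat" where
  "DMC = full_sub_twocat sDMC (\<lambda>(C, D). replete_maps C D)"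

section \<open>Comprehension categories\<close>

definition cartesian ::
    "('t, 's) cat \<Rightarrow> ('o, 'a) cat \<Rightarrow> ('t, 's, 'o, 'a) ftor \<Rightarrow> 's \<Rightarrow> bool" where
  "cartesian T C p \<phi> \<longleftrightarrow> \<phi> \<in> Arr T \<and>
    (\<forall>\<psi>\<in>Arr T. \<forall>g\<in>Arr C. Cod T \<psi> = Cod T \<phi> \<and> Dom C g = Fo p (Dom T \<psi>) \<and> Cod C g = Fo p (Dom T \<phi>)
       \<and> Cmp C (Fa p \<phi>) g = Fa p \<psi> \<longrightarrow>
      (\<exists>!h. h \<in> Arr T \<and> Dom T h = Dom T \<psi> \<and> Cod T h = Dom T \<phi> \<and> Cmp T \<phi> h = \<psi> \<and> Fa p h = g))"

definition fibration :: "('t, 's) cat \<Rightarrow> ('o, 'a) cat \<Rightarrow> ('t, 's, 'o, 'a) ftor \<Rightarrow> bool" where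
  "fibration T C p \<longleftrightarrow> is_functor T C p \<and>
    (\<forall>B\<in>Obj T. \<forall>f\<in>Arr C. Cod C f = Fo p B \<longrightarrow> (\<exists>\<phi>. cartesian T C p \<phi> \<and> Cod T \<phi> = B \<and> Fa p \<phi> = f))"

record ('o, 'a, 't, 's) ccat =
  base :: "('o, 'a) cat"
  total :: "('t, 's) cat"
  proj :: "('t, 's, 'o, 'a) ftor"
  compr :: "('t, 's, 'a, 'a square) ftor"

definition comprehension_category :: "('o, 'a, 't, 's) ccat \<Rightarrow> bool" where
  "comprehension_category A \<longleftrightarrow>
     category (base A) \<and> category (total A) \<and> fibration (total A) (base A) (proj A) \<and>
     is_functor (total A) (arrow_cat (base A)) (compr A) \<and>
     comp_ftor (total A) (cod_ftor (base A)) (compr A) = proj A \<and>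
     (\<forall>\<phi>. cartesian (total A) (base A) (proj A) \<phi> \<longrightarrow> pullback_square (base A) (Fa (compr A) \<phi>))"

type_synonym ('o, 'a, 't, 's) ccat_map = "('o, 'a, 'o, 'a) ftor \<times> ('t, 's, 't, 's) ftor"
type_synonym ('o, 'a, 't, 's) ccat_trans = "('o, 'a, 'o, 'a) nt \<times> ('t, 's, 't, 's) nt"

definition strict_map ::
    "('o, 'a, 't, 's) ccat \<Rightarrow> ('o, 'a, 't, 's) ccat \<Rightarrow> ('o, 'a, 't, 's) ccat_map \<Rightarrow> bool" where
  "strict_map A B M \<longleftrightarrow> (case M of (F, Fb) \<Rightarrow>
     is_functor (base A) (base B) F \<and> is_functor (total A) (total B) Fb \<and>
     comp_ftor (total A) (proj B) Fb = comp_ftor (total A) F (proj A) \<and>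
     (\<forall>\<phi>. cartesian (total A) (base A) (proj A) \<phi> \<longrightarrow> cartesian (total B) (base B) (proj B) (Fa Fb \<phi>)) \<and>
     comp_ftor (total A) (compr B) Fb = comp_ftor (total A) (arr_ftor (base A) F) (compr A))"

definition transformation ::
    "('o, 'a, 't, 's) ccat \<Rightarrow> ('o, 'a, 't, 's) ccat \<Rightarrow> ('o, 'a, 't, 's) ccat_trans \<Rightarrow> bool" where
  "transformation A B \<tau> \<longleftrightarrow> (case \<tau> of (\<alpha>, \<alpha>b) \<Rightarrow>
     is_nt (base A) (base B) \<alpha> \<and> is_nt (total A) (total B) \<alpha>b \<and>
     strict_map A B (nsrc \<alpha>, nsrc \<alpha>b) \<and> strict_map A B (ntgt \<alpha>, ntgt \<alpha>b) \<and>
     (\<forall>x\<in>Obj (total A). Fa (proj B) (cmpt \<alpha>b x) = cmpt \<alpha> (Fo (proj A) x)) \<and>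
     (\<forall>x\<in>Obj (total A). sq_top (Fa (compr B) (cmpt \<alpha>b x)) =
                          cmpt \<alpha> (Dom (base A) (Fo (compr A) x))))"

definition strict_hom :: "('o, 'a, 't, 's) ccat \<Rightarrow> ('o, 'a, 't, 's) ccat \<Rightarrow>
    (('o, 'a, 't, 's) ccat_map, ('o, 'a, 't, 's) ccat_trans) cat" where
  "strict_hom A B =
    \<lparr> Obj = {M. strict_map A B M},
      Arr = {\<tau>. transformation A B \<tau>},
      Dom = restrict (\<lambda>(\<alpha>, \<alpha>b). (nsrc \<alpha>, nsrc \<alpha>b)) {\<tau>. transformation A B \<tau>},
      Cod = restrict (\<lambda>(\<alpha>, \<alpha>b). (ntgt \<alpha>, ntgt \<alpha>b)) {\<tau>. transformation A B \<tau>},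
      Idt = restrict (\<lambda>(F, Fb). (id_nt (base A) (base B) F, id_nt (total A) (total B) Fb))
              {M. strict_map A B M},
      Cmp = (\<lambda>(\<beta>, \<beta>b) (\<alpha>, \<alpha>b).
               if transformation A B (\<alpha>, \<alpha>b) \<and> transformation A B (\<beta>, \<beta>b)
                  \<and> nsrc \<beta> = ntgt \<alpha> \<and> nsrc \<beta>b = ntgt \<alpha>b
               then (vcomp_nt (base A) (base B) \<beta> \<alpha>, vcomp_nt (total A) (total B) \<beta>b \<alpha>b)
               else undefined) \<rparr>"

type_synonym ('o, 'a, 't, 's) ccat_twocat =
  "(('o, 'a, 't, 's) ccat, ('o, 'a, 't, 's) ccat_map, ('o, 'a, 't, 's) ccat_trans) twocat"

definition CompCat_str2 :: "('o, 'a, 't, 's) ccat_twocat" where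
  "CompCat_str2 =
    \<lparr> Cells0 = {A. comprehension_category A},
      Hom = strict_hom,
      Unit = (\<lambda>A. (id_ftor (base A), id_ftor (total A))),
      Cmp1 = (\<lambda>A B E (G, Gb) (F, Fb). (comp_ftor (base A) G F, comp_ftor (total A) Gb Fb)),
      Cmp2 = (\<lambda>A B E (\<beta>, \<beta>b) (\<alpha>, \<alpha>b).
                (hcomp_nt (base A) (base E) \<beta> \<alpha>, hcomp_nt (total A) (total E) \<beta>b \<alpha>b)) \<rparr>"

definition subcategorical :: "('o, 'a, 'a, 'a square) ccat \<Rightarrow> bool" where
  "subcategorical A \<longleftrightarrow>
     full_subcategory (total A) (arrow_cat (base A)) \<and> compr A = incl_ftor (total A)"

type_synonym ('o, 'a) sub_ccat_twocat = "('o, 'a, 'a, 'a square) ccat_twocat"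

definition CompCat_sub_str2 :: "('o, 'a) sub_ccat_twocat" where
  "CompCat_sub_str2 = full_sub_twocat CompCat_str2 subcategorical"

definition CompCat_repl_str2 :: "('o, 'a) sub_ccat_twocat" where
  "CompCat_repl_str2 =
     full_sub_twocat CompCat_sub_str2 (\<lambda>A. replete_in (total A) (arrow_cat (base A)))"

section \<open>Display map categories as comprehension categories\<close>

text \<open>
  The correspondence sends \<open>(C, D)\<close> to the full subcategory of the arrow category on \<open>D\<close>. It will be
  considered both on all structured display map categories and on the replete ones, so that it
  commutes with the inclusions by construction.
\<close>

definition disp_total :: "('o, 'a) sdmcat \<Rightarrow> ('a, 'a square) cat" where
  "disp_total A = full_subcat (arrow_cat (fst A)) (snd A)"

definition disp_ccat :: "('o, 'a) sdmcat \<Rightarrow> ('o, 'a, 'a, 'a square) ccat" where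
  "disp_ccat A =
    \<lparr> base = fst A,
      total = disp_total A,
      proj = comp_ftor (disp_total A) (cod_ftor (fst A)) (incl_ftor (disp_total A)),
      compr = incl_ftor (disp_total A) \<rparr>"

definition disp_map ::
    "('o, 'a) sdmcat \<Rightarrow> ('o, 'a, 'o, 'a) ftor \<Rightarrow> ('o, 'a, 'a, 'a square) ccat_map" where
  "disp_map A F =
     (F, comp_ftor (disp_total A) (arr_ftor (fst A) F) (incl_ftor (disp_total A)))"

definition disp_trans ::
    "('o, 'a) sdmcat \<Rightarrow> ('o, 'a, 'o, 'a) nt \<Rightarrow> ('o, 'a, 'a, 'a square) ccat_trans" where
  "disp_trans A \<alpha> =
     (\<alpha>, \<lparr> nsrc = snd (disp_map A (nsrc \<alpha>)), ntgt = snd (disp_map A (ntgt \<alpha>)),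
           cmpt = restrict (\<lambda>d. Square (Fa (nsrc \<alpha>) d) (Fa (ntgt \<alpha>) d)
                    (cmpt \<alpha> (Dom (fst A) d)) (cmpt \<alpha> (Cod (fst A) d))) (Obj (disp_total A)) \<rparr>)"

definition disp_to_ccat ::
    "(('o, 'a) sdmcat, ('o, 'a, 'o, 'a) ftor, ('o, 'a, 'o, 'a) nt,
      ('o, 'a, 'a, 'a square) ccat, ('o, 'a, 'a, 'a square) ccat_map,
      ('o, 'a, 'a, 'a square) ccat_trans) twoftor" where
  "disp_to_ccat =
    \<lparr> on0 = disp_ccat,
      onHom = (\<lambda>A B. \<lparr> Fo = restrict (disp_map A) (Obj (Hom sDMC A B)),
                       Fa = restrict (disp_trans A) (Arr (Hom sDMC A B)) \<rparr>) \<rparr>"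

end

theory Submission
  imports Defs
begin

text \<open>
  The reflection of \<open>(C, D)\<close> is \<open>(C, repletion C D)\<close>. Isomorphisms in the arrow category are
  pullback squares, so by pasting, pullbacks of a map isomorphic to a display map \<open>d\<close> are pullbacks
  of \<open>d\<close> up to isomorphism. Hence the repletion is again a display structure, and a functor into a
  replete target is a display functor on \<open>(C, D)\<close> iff it is one on \<open>(C, repletion C D)\<close>: the two
  hom-categories are equal.

  For comprehension categories, the adjunction is transported along the isomorphism of 2-categories.
  There the point is that the cartesian maps of the total category are exactly the pullback squares
  between display maps, since a cartesian map is isomorphic to a chosen pullback; moreover
  strict compatibility with the comprehension inclusions determines the lifted functor, and the two conditions
  on a transformation determine the components of the lifted one.
\<close>

section \<open>The 2-category of structured display map categories\<close>

text \<open>A pullback of a display map may have a left side outside the display class.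
  \<open>display_functor\<close> asks for such squares to be preserved too, while a strict map of
  comprehension categories sees only squares with both sides in the class.
  \<open>pullback_unique\<close> closes this gap: two pullbacks of one map along the same arrow
  differ by an isomorphism of the arrow category, and functors preserve isomorphisms. Pullbacks are
  never chosen as structure and repletion leaves the underlying category alone, so identities and
  inclusions serve as comparison functors throughout. Equality of records is meaningful because all
  structure maps have a fixed default value outside their domains; the price is that these default
  values have to be tracked in every transport. The axioms of a 2-category are checked directly only
  for \<open>sDMC\<close>. Since \<open>twocat_iso\<close> does not presuppose that its target is a
  2-category, the axioms for comprehension categories can be read off from the isomorphism
  itself.\<close>

lemma (in category) Dom_Obj [simp]: "f \<in> Arr C \<Longrightarrow> Dom C f \<in> Obj C"
  using Dom_ext by auto

lemma (in category) Cod_Obj [simp]: "f \<in> Arr C \<Longrightarrow> Cod C f \<in> Obj C"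
  using Cod_ext by auto

lemma (in category) Idt_Arr [simp]: "x \<in> Obj C \<Longrightarrow> Idt C x \<in> Arr C"
  using Idt_ext by auto

declare (in category) Dom_Idt [simp] Cod_Idt [simp] Cmp_Arr [simp] Dom_Cmp [simp] Cod_Cmp [simp]
  Cmp_Idt_right [simp] Cmp_Idt_left [simp]

lemma (in is_functor) Fo_Obj [simp]: "x \<in> Obj C \<Longrightarrow> Fo F x \<in> Obj D"
  using Fo_ext by auto

lemma (in is_functor) Fa_Arr [simp]: "f \<in> Arr C \<Longrightarrow> Fa F f \<in> Arr D"
  using Fa_ext by auto

declare (in is_functor) Fa_Dom [simp] Fa_Cod [simp] Fa_Idt [simp] Fa_Cmp [simp]

lemma (in is_nt) cmpt_Arr [simp]: "x \<in> Obj C \<Longrightarrow> cmpt \<alpha> x \<in> Arr D"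
  using cmpt_ext by auto

declare (in is_nt) cmpt_Dom [simp] cmpt_Cod [simp]

lemma (in is_functor) Fo_extensional: "Fo F \<in> extensional (Obj C)"
  using Fo_ext by (rule PiE_iff[THEN iffD1, THEN conjunct2])

lemma (in is_functor) Fa_extensional: "Fa F \<in> extensional (Arr C)"
  using Fa_ext by (rule PiE_iff[THEN iffD1, THEN conjunct2])

lemma (in is_nt) cmpt_extensional: "cmpt \<alpha> \<in> extensional (Obj C)"
  using cmpt_ext by (rule PiE_iff[THEN iffD1, THEN conjunct2])

text \<open>The targets \<open>D\<close> and \<open>D'\<close> may differ because a functor record
  stores no codomain; both functors are extensional on \<open>C\<close>, so their values there
  decide equality.\<close>

lemma ftor_eqI:
  assumes "is_functor C D F" "is_functor C D' G"
    and "\<And>x. x \<in> Obj C \<Longrightarrow> Fo F x = Fo G x" "\<And>f. f \<in> Arr C \<Longrightarrow> Fa F f = Fa G f"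
  shows "F = G"
proof -
  have "Fo F = Fo G"
    by (rule extensionalityI[OF is_functor.Fo_extensional[OF assms(1)]
          is_functor.Fo_extensional[OF assms(2)] assms(3)])
  moreover have "Fa F = Fa G"
    by (rule extensionalityI[OF is_functor.Fa_extensional[OF assms(1)]
          is_functor.Fa_extensional[OF assms(2)] assms(4)])
  ultimately show ?thesis by simp
qed

lemma nt_eqI:
  assumes "is_nt C D \<alpha>" "is_nt C D' \<beta>" "nsrc \<alpha> = nsrc \<beta>" "ntgt \<alpha> = ntgt \<beta>"
    and "\<And>x. x \<in> Obj C \<Longrightarrow> cmpt \<alpha> x = cmpt \<beta> x"
  shows "\<alpha> = \<beta>"
proof -
  have "cmpt \<alpha> = cmpt \<beta>"
    by (rule extensionalityI[OF is_nt.cmpt_extensional[OF assms(1)]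
          is_nt.cmpt_extensional[OF assms(2)] assms(5)])
  then show ?thesis using assms by simp
qed

section \<open>Composition of functors and of natural transformations\<close>

lemma is_functor_comp:
  assumes "category C" "is_functor C D F" "is_functor D E G"
  shows "is_functor C E (comp_ftor C G F)"
proof -
  interpret C: category C by fact
  interpret F: is_functor C D F by fact
  interpret G: is_functor D E G by fact
  show ?thesis by unfold_locales (auto simp: comp_ftor_def)
qed

lemma is_functor_id: "category C \<Longrightarrow> is_functor C C (id_ftor C)"
proof -
  assume "category C"
  then interpret C: category C .
  show ?thesis by unfold_locales (auto simp: incl_ftor_def)
qed

lemma comp_ftor_id_left: "is_functor C D F \<Longrightarrow> comp_ftor C (id_ftor D) F = F"
proof -
  assume "is_functor C D F"
  then interpret F: is_functor C D F .
  have "restrict (\<lambda>x. restrict (\<lambda>x. x) (Obj D) (Fo F x)) (Obj C) = Fo F"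
    "restrict (\<lambda>x. restrict (\<lambda>x. x) (Arr D) (Fa F x)) (Arr C) = Fa F"
    using F.Fo_ext F.Fa_ext by (auto simp: fun_eq_iff restrict_def PiE_def extensional_def)
  then show ?thesis by (simp add: comp_ftor_def incl_ftor_def)
qed

lemma comp_ftor_id_right: "is_functor C D F \<Longrightarrow> comp_ftor C F (id_ftor C) = F"
proof -
  assume "is_functor C D F"
  then interpret F: is_functor C D F .
  have "restrict (\<lambda>x. Fo F (restrict (\<lambda>x. x) (Obj C) x)) (Obj C) = Fo F"
    "restrict (\<lambda>x. Fa F (restrict (\<lambda>x. x) (Arr C) x)) (Arr C) = Fa F"
    using F.Fo_ext F.Fa_ext by (auto simp: fun_eq_iff restrict_def PiE_def extensional_def)
  then show ?thesis by (simp add: comp_ftor_def incl_ftor_def)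
qed

text \<open>The values of \<open>F\<close> lie in \<open>D\<close>, where the restricted composite
  of \<open>H\<close> and \<open>G\<close> agrees with the plain one.\<close>

lemma comp_ftor_assoc:
  assumes "is_functor C D F"
  shows "comp_ftor C H (comp_ftor C G F) = comp_ftor C (comp_ftor D H G) F"
proof -
  interpret F: is_functor C D F by fact
  show ?thesis by (auto simp: comp_ftor_def fun_eq_iff restrict_def)
qed

lemma nt_simps [simp]:
  "nsrc (id_nt C D F) = F" "ntgt (id_nt C D F) = F"
  "nsrc (vcomp_nt C D \<beta> \<alpha>) = nsrc \<alpha>" "ntgt (vcomp_nt C D \<beta> \<alpha>) = ntgt \<beta>"
  by (simp_all add: id_nt_def vcomp_nt_def)

lemma hcomp_nt_simps [simp]:
  "nsrc (hcomp_nt C E \<beta> \<alpha>) = comp_ftor C (nsrc \<beta>) (nsrc \<alpha>)"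
  "ntgt (hcomp_nt C E \<beta> \<alpha>) = comp_ftor C (ntgt \<beta>) (ntgt \<alpha>)"
  by (simp_all add: hcomp_nt_def)

lemma is_nt_id:
  assumes "category C" "category D" "is_functor C D F"
  shows "is_nt C D (id_nt C D F)"
proof -
  interpret C: category C by fact
  interpret D: category D by fact
  interpret F: is_functor C D F by fact
  show ?thesis
  proof unfold_locales
    fix f assume f: "f \<in> Arr C"
    have "Cmp D (Idt D (Fo F (Cod C f))) (Fa F f) = Fa F f"
      "Cmp D (Fa F f) (Idt D (Fo F (Dom C f))) = Fa F f"
      using f D.Cmp_Idt_left[of "Fa F f"] D.Cmp_Idt_right[of "Fa F f"] by auto
    then show "Cmp D (cmpt (id_nt C D F) (Cod C f)) (Fa (nsrc (id_nt C D F)) f) =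
      Cmp D (Fa (ntgt (id_nt C D F)) f) (cmpt (id_nt C D F) (Dom C f))"
      using f by (simp add: id_nt_def)
  qed (use assms in \<open>auto simp: id_nt_def is_functor_def\<close>)
qed

lemma is_nt_vcomp:
  assumes "category C" "category D" "is_nt C D \<alpha>" "is_nt C D \<beta>" "nsrc \<beta> = ntgt \<alpha>"
  shows "is_nt C D (vcomp_nt C D \<beta> \<alpha>)"
proof -
  interpret C: category C by fact
  interpret D: category D by fact
  interpret a: is_nt C D \<alpha> by fact
  interpret b: is_nt C D \<beta> by fact
  interpret F: is_functor C D "nsrc \<alpha>" by (rule a.nsrc_functor)
  interpret G: is_functor C D "ntgt \<alpha>" by (rule a.ntgt_functor)
  interpret H: is_functor C D "ntgt \<beta>" by (rule b.ntgt_functor)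
  note [simp] = assms(5)
  show ?thesis
  proof (rule is_nt.intro)
    show "is_functor C D (nsrc (vcomp_nt C D \<beta> \<alpha>))" "is_functor C D (ntgt (vcomp_nt C D \<beta> \<alpha>))"
      by (simp_all add: vcomp_nt_def F.is_functor_axioms H.is_functor_axioms)
    fix f assume f: "f \<in> Arr C"
    have "Cmp D (Cmp D (cmpt \<beta> (Cod C f)) (cmpt \<alpha> (Cod C f))) (Fa (nsrc \<alpha>) f)
        = Cmp D (cmpt \<beta> (Cod C f)) (Cmp D (Fa (ntgt \<alpha>) f) (cmpt \<alpha> (Dom C f)))"
      using f a.naturality[OF f, symmetric] by (simp add: D.Cmp_assoc)
    also have "\<dots> = Cmp D (Cmp D (Fa (ntgt \<beta>) f) (cmpt \<beta> (Dom C f))) (cmpt \<alpha> (Dom C f))"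
      using f b.naturality[OF f] by (simp add: D.Cmp_assoc)
    also have "\<dots> = Cmp D (Fa (ntgt \<beta>) f) (Cmp D (cmpt \<beta> (Dom C f)) (cmpt \<alpha> (Dom C f)))"
      using f by (simp add: D.Cmp_assoc)
    finally show "Cmp D (cmpt (vcomp_nt C D \<beta> \<alpha>) (Cod C f)) (Fa (nsrc (vcomp_nt C D \<beta> \<alpha>)) f) =
      Cmp D (Fa (ntgt (vcomp_nt C D \<beta> \<alpha>)) f) (cmpt (vcomp_nt C D \<beta> \<alpha>) (Dom C f))"
      using f by (simp add: vcomp_nt_def)
  qed (auto simp: vcomp_nt_def)
qed

text \<open>Naturality is a pasting of two squares: the image under \<open>nsrc \<beta>\<close> of
  the naturality square of \<alpha> at \<open>f\<close>, and the naturality square of \<beta> at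
  \<open>Fa (ntgt \<alpha>) f\<close>.\<close>

lemma is_nt_hcomp:
  assumes "category C" "category D" "category E" "is_nt C D \<alpha>" "is_nt D E \<beta>"
  shows "is_nt C E (hcomp_nt C E \<beta> \<alpha>)"
proof -
  interpret C: category C by fact
  interpret D: category D by fact
  interpret E: category E by fact
  interpret a: is_nt C D \<alpha> by fact
  interpret b: is_nt D E \<beta> by fact
  interpret F: is_functor C D "nsrc \<alpha>" by (rule a.nsrc_functor)
  interpret F': is_functor C D "ntgt \<alpha>" by (rule a.ntgt_functor)
  interpret G: is_functor D E "nsrc \<beta>" by (rule b.nsrc_functor)
  interpret G': is_functor D E "ntgt \<beta>" by (rule b.ntgt_functor)
  show ?thesis
  proof (rule is_nt.intro)
    show "is_functor C E (nsrc (hcomp_nt C E \<beta> \<alpha>))" "is_functor C E (ntgt (hcomp_nt C E \<beta> \<alpha>))"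
      using is_functor_comp[OF C.category_axioms F.is_functor_axioms G.is_functor_axioms]
        is_functor_comp[OF C.category_axioms F'.is_functor_axioms G'.is_functor_axioms]
      by (simp_all add: hcomp_nt_def)
    fix f assume f: "f \<in> Arr C"
    let ?x = "Dom C f" and ?y = "Cod C f"
    have "Cmp E (Cmp E (cmpt \<beta> (Fo (ntgt \<alpha>) ?y)) (Fa (nsrc \<beta>) (cmpt \<alpha> ?y)))
              (Fa (nsrc \<beta>) (Fa (nsrc \<alpha>) f))
        = Cmp E (cmpt \<beta> (Fo (ntgt \<alpha>) ?y)) (Fa (nsrc \<beta>) (Cmp D (cmpt \<alpha> ?y) (Fa (nsrc \<alpha>) f)))"
      using f by (simp add: E.Cmp_assoc)
    also have "\<dots> = Cmp E (Cmp E (cmpt \<beta> (Fo (ntgt \<alpha>) ?y)) (Fa (nsrc \<beta>) (Fa (ntgt \<alpha>) f)))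
              (Fa (nsrc \<beta>) (cmpt \<alpha> ?x))"
      using f by (simp add: a.naturality E.Cmp_assoc)
    also have "\<dots> = Cmp E (Cmp E (Fa (ntgt \<beta>) (Fa (ntgt \<alpha>) f)) (cmpt \<beta> (Fo (ntgt \<alpha>) ?x)))
              (Fa (nsrc \<beta>) (cmpt \<alpha> ?x))"
      using f b.naturality[of "Fa (ntgt \<alpha>) f"] by simp
    also have "\<dots> = Cmp E (Fa (ntgt \<beta>) (Fa (ntgt \<alpha>) f))
              (Cmp E (cmpt \<beta> (Fo (ntgt \<alpha>) ?x)) (Fa (nsrc \<beta>) (cmpt \<alpha> ?x)))"
      using f by (simp add: E.Cmp_assoc)
    finally show "Cmp E (cmpt (hcomp_nt C E \<beta> \<alpha>) (Cod C f)) (Fa (nsrc (hcomp_nt C E \<beta> \<alpha>)) f) =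
      Cmp E (Fa (ntgt (hcomp_nt C E \<beta> \<alpha>)) f) (cmpt (hcomp_nt C E \<beta> \<alpha>) (Dom C f))"
      using f by (simp add: hcomp_nt_def comp_ftor_def)
  qed (auto simp: hcomp_nt_def comp_ftor_def)
qed

lemma vcomp_nt_id_right:
  assumes "category D" "is_nt C D \<alpha>"
  shows "vcomp_nt C D \<alpha> (id_nt C D (nsrc \<alpha>)) = \<alpha>"
proof -
  interpret D: category D by fact
  interpret a: is_nt C D \<alpha> by fact
  have "Cmp D (cmpt \<alpha> x) (Idt D (Fo (nsrc \<alpha>) x)) = cmpt \<alpha> x" if "x \<in> Obj C" for x
    using that D.Cmp_Idt_right[of "cmpt \<alpha> x"] by simp
  then have "restrict (\<lambda>x. Cmp D (cmpt \<alpha> x) (restrict (\<lambda>x. Idt D (Fo (nsrc \<alpha>) x)) (Obj C) x)) (Obj C)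
      = cmpt \<alpha>"
    using a.cmpt_ext by (auto simp: fun_eq_iff restrict_def PiE_def extensional_def)
  then show ?thesis by (simp add: vcomp_nt_def id_nt_def)
qed

lemma vcomp_nt_id_left:
  assumes "category D" "is_nt C D \<alpha>"
  shows "vcomp_nt C D (id_nt C D (ntgt \<alpha>)) \<alpha> = \<alpha>"
proof -
  interpret D: category D by fact
  interpret a: is_nt C D \<alpha> by fact
  have "Cmp D (Idt D (Fo (ntgt \<alpha>) x)) (cmpt \<alpha> x) = cmpt \<alpha> x" if "x \<in> Obj C" for x
    using that D.Cmp_Idt_left[of "cmpt \<alpha> x"] by simp
  then have "restrict (\<lambda>x. Cmp D (restrict (\<lambda>x. Idt D (Fo (ntgt \<alpha>) x)) (Obj C) x) (cmpt \<alpha> x)) (Obj C)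
      = cmpt \<alpha>"
    using a.cmpt_ext by (auto simp: fun_eq_iff restrict_def PiE_def extensional_def)
  then show ?thesis by (simp add: vcomp_nt_def id_nt_def)
qed

lemma vcomp_nt_assoc:
  assumes "category D" "is_nt C D \<alpha>" "is_nt C D \<beta>" "is_nt C D \<gamma>"
    and "nsrc \<beta> = ntgt \<alpha>" "nsrc \<gamma> = ntgt \<beta>"
  shows "vcomp_nt C D \<gamma> (vcomp_nt C D \<beta> \<alpha>) = vcomp_nt C D (vcomp_nt C D \<gamma> \<beta>) \<alpha>"
proof -
  interpret D: category D by fact
  interpret a: is_nt C D \<alpha> by fact
  interpret b: is_nt C D \<beta> by fact
  interpret c: is_nt C D \<gamma> by fact
  show ?thesis using assms(5,6) by (auto simp: vcomp_nt_def fun_eq_iff restrict_def D.Cmp_assoc)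
qed

lemma fun_cat_simps [simp]:
  "Obj (fun_cat C D) = {F. is_functor C D F}"
  "Arr (fun_cat C D) = {\<alpha>. is_nt C D \<alpha>}"
  "is_nt C D \<alpha> \<Longrightarrow> Dom (fun_cat C D) \<alpha> = nsrc \<alpha>"
  "is_nt C D \<alpha> \<Longrightarrow> Cod (fun_cat C D) \<alpha> = ntgt \<alpha>"
  "is_functor C D F \<Longrightarrow> Idt (fun_cat C D) F = id_nt C D F"
  "is_nt C D \<alpha> \<Longrightarrow> is_nt C D \<beta> \<Longrightarrow> nsrc \<beta> = ntgt \<alpha> \<Longrightarrow> Cmp (fun_cat C D) \<beta> \<alpha> = vcomp_nt C D \<beta> \<alpha>"
  by (simp_all add: fun_cat_def)

lemma category_fun_cat:
  assumes "category C" "category D"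
  shows "category (fun_cat C D)"
proof
  show "Dom (fun_cat C D) \<in> Arr (fun_cat C D) \<rightarrow>\<^sub>E Obj (fun_cat C D)"
    "Cod (fun_cat C D) \<in> Arr (fun_cat C D) \<rightarrow>\<^sub>E Obj (fun_cat C D)"
    "Idt (fun_cat C D) \<in> Obj (fun_cat C D) \<rightarrow>\<^sub>E Arr (fun_cat C D)"
    using is_nt_id[OF assms] by (auto simp: fun_cat_def is_nt.nsrc_functor is_nt.ntgt_functor)
  show "Cmp (fun_cat C D) g f = undefined"
    if "\<not> (f \<in> Arr (fun_cat C D) \<and> g \<in> Arr (fun_cat C D) \<and>
      Dom (fun_cat C D) g = Cod (fun_cat C D) f)" for f g
    using that by (auto simp: fun_cat_def)
qed (use assms in \<open>simp_all add: is_nt_id is_nt_vcomp vcomp_nt_id_left vcomp_nt_id_right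
      vcomp_nt_assoc is_nt.nsrc_functor is_nt.ntgt_functor\<close>)

lemma category_full_subcat:
  assumes "category C"
  shows "category (full_subcat C S)"
proof -
  interpret C: category C by fact
  show ?thesis
    by unfold_locales (auto simp: full_subcat_def Let_def C.Cmp_assoc)
qed

lemma is_functor_hom:
  assumes "is_nt C D \<alpha>"
  shows "is_functor C D (nsrc \<alpha>)" "is_functor C D (ntgt \<alpha>)"
  using assms by (simp_all add: is_nt.nsrc_functor is_nt.ntgt_functor)

lemma hcomp_nt_id:
  assumes "category C" "category D" "category E" "is_functor C D F" "is_functor D E G"
  shows "hcomp_nt C E (id_nt D E G) (id_nt C D F) = id_nt C E (comp_ftor C G F)"
proof -
  interpret D: category D by fact
  interpret E: category E by fact
  interpret F: is_functor C D F by fact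
  interpret G: is_functor D E G by fact
  have "Cmp E (Idt E (Fo G (Fo F x))) (Idt E (Fo G (Fo F x))) = Idt E (Fo G (Fo F x))"
    if "x \<in> Obj C" for x
    using that E.Cmp_Idt_left[of "Idt E (Fo G (Fo F x))"] by simp
  then show ?thesis
    by (auto simp: hcomp_nt_def id_nt_def comp_ftor_def fun_eq_iff restrict_def)
qed

text \<open>After reassociating, the two sides differ only in the order of their two middle factors,
  which naturality of \<tau> at the component \<open>cmpt \<sigma>' x\<close> exchanges.\<close>

lemma hcomp_nt_interchange:
  assumes "category C" "category D" "category E"
    and "is_nt C D \<sigma>" "is_nt C D \<sigma>'" "nsrc \<sigma>' = ntgt \<sigma>"
    and "is_nt D E \<tau>" "is_nt D E \<tau>'" "nsrc \<tau>' = ntgt \<tau>"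
  shows "hcomp_nt C E (vcomp_nt D E \<tau>' \<tau>) (vcomp_nt C D \<sigma>' \<sigma>) =
    vcomp_nt C E (hcomp_nt C E \<tau>' \<sigma>') (hcomp_nt C E \<tau> \<sigma>)"
proof -
  interpret D: category D by fact
  interpret E: category E by fact
  interpret s: is_nt C D \<sigma> by fact
  interpret s': is_nt C D \<sigma>' by fact
  interpret t: is_nt D E \<tau> by fact
  interpret t': is_nt D E \<tau>' by fact
  interpret F: is_functor C D "nsrc \<sigma>" by (rule s.nsrc_functor)
  interpret F': is_functor C D "ntgt \<sigma>" by (rule s.ntgt_functor)
  interpret F'': is_functor C D "ntgt \<sigma>'" by (rule s'.ntgt_functor)
  interpret G: is_functor D E "nsrc \<tau>" by (rule t.nsrc_functor)
  interpret G': is_functor D E "ntgt \<tau>" by (rule t.ntgt_functor)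
  interpret G'': is_functor D E "ntgt \<tau>'" by (rule t'.ntgt_functor)
  note [simp] = assms(6,9)
  have "Cmp E (Cmp E (cmpt \<tau>' (Fo (ntgt \<sigma>') x)) (cmpt \<tau> (Fo (ntgt \<sigma>') x)))
      (Fa (nsrc \<tau>) (Cmp D (cmpt \<sigma>' x) (cmpt \<sigma> x))) =
    Cmp E (Cmp E (cmpt \<tau>' (Fo (ntgt \<sigma>') x)) (Fa (ntgt \<tau>) (cmpt \<sigma>' x)))
      (Cmp E (cmpt \<tau> (Fo (ntgt \<sigma>) x)) (Fa (nsrc \<tau>) (cmpt \<sigma> x)))" if x: "x \<in> Obj C" for x
  proof -
    let ?a = "cmpt \<tau>' (Fo (ntgt \<sigma>') x)"
    have "Cmp E (Cmp E ?a (cmpt \<tau> (Fo (ntgt \<sigma>') x))) (Fa (nsrc \<tau>) (Cmp D (cmpt \<sigma>' x) (cmpt \<sigma> x)))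
      = Cmp E ?a (Cmp E (Cmp E (cmpt \<tau> (Fo (ntgt \<sigma>') x)) (Fa (nsrc \<tau>) (cmpt \<sigma>' x)))
          (Fa (nsrc \<tau>) (cmpt \<sigma> x)))"
      using x by (simp add: E.Cmp_assoc)
    also have "Cmp E (cmpt \<tau> (Fo (ntgt \<sigma>') x)) (Fa (nsrc \<tau>) (cmpt \<sigma>' x)) =
        Cmp E (Fa (ntgt \<tau>) (cmpt \<sigma>' x)) (cmpt \<tau> (Fo (ntgt \<sigma>) x))"
      using x t.naturality[of "cmpt \<sigma>' x"] by simp
    finally show ?thesis using x by (simp add: E.Cmp_assoc)
  qed
  then show ?thesis by (auto simp: hcomp_nt_def vcomp_nt_def fun_eq_iff restrict_def)
qed

lemma hcomp_nt_assoc: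
  assumes "category C" "category D" "category E" "category H"
    and "is_nt C D \<alpha>" "is_nt D E \<beta>" "is_nt E H \<gamma>"
  shows "hcomp_nt C H \<gamma> (hcomp_nt C E \<beta> \<alpha>) = hcomp_nt C H (hcomp_nt D H \<gamma> \<beta>) \<alpha>"
proof -
  interpret H: category H by fact
  interpret a: is_nt C D \<alpha> by fact
  interpret b: is_nt D E \<beta> by fact
  interpret c: is_nt E H \<gamma> by fact
  interpret F: is_functor C D "nsrc \<alpha>" by (rule a.nsrc_functor)
  interpret F': is_functor C D "ntgt \<alpha>" by (rule a.ntgt_functor)
  interpret G: is_functor D E "nsrc \<beta>" by (rule b.nsrc_functor)
  interpret G': is_functor D E "ntgt \<beta>" by (rule b.ntgt_functor)
  interpret K: is_functor E H "nsrc \<gamma>" by (rule c.nsrc_functor)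
  have "nsrc (hcomp_nt C H \<gamma> (hcomp_nt C E \<beta> \<alpha>)) = nsrc (hcomp_nt C H (hcomp_nt D H \<gamma> \<beta>) \<alpha>)"
    "ntgt (hcomp_nt C H \<gamma> (hcomp_nt C E \<beta> \<alpha>)) = ntgt (hcomp_nt C H (hcomp_nt D H \<gamma> \<beta>) \<alpha>)"
    by (simp_all add: comp_ftor_assoc[OF F.is_functor_axioms] comp_ftor_assoc[OF F'.is_functor_axioms])
  moreover have "cmpt (hcomp_nt C H \<gamma> (hcomp_nt C E \<beta> \<alpha>)) = cmpt (hcomp_nt C H (hcomp_nt D H \<gamma> \<beta>) \<alpha>)"
    by (auto simp: hcomp_nt_def comp_ftor_def H.Cmp_assoc fun_eq_iff restrict_def)
  ultimately show ?thesis by simp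
qed

lemma hcomp_nt_unit_right:
  assumes "category C" "category D" "is_nt C D \<alpha>"
  shows "hcomp_nt C D \<alpha> (id_nt C C (id_ftor C)) = \<alpha>"
proof (rule nt_eqI)
  interpret C: category C by fact
  interpret D: category D by fact
  interpret a: is_nt C D \<alpha> by fact
  interpret F: is_functor C D "nsrc \<alpha>" by (rule a.nsrc_functor)
  interpret F': is_functor C D "ntgt \<alpha>" by (rule a.ntgt_functor)
  show "is_nt C D (hcomp_nt C D \<alpha> (id_nt C C (id_ftor C)))"
    using assms by (simp add: is_nt_hcomp is_nt_id is_functor_id)
  show "cmpt (hcomp_nt C D \<alpha> (id_nt C C (id_ftor C))) x = cmpt \<alpha> x" if "x \<in> Obj C" for x
    using that D.Cmp_Idt_right[of "cmpt \<alpha> x"] by (simp add: hcomp_nt_def id_nt_def incl_ftor_def)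
qed (use assms in \<open>simp_all add: comp_ftor_id_right[OF is_functor_hom(1)] comp_ftor_id_right[OF is_functor_hom(2)]\<close>)

lemma hcomp_nt_unit_left:
  assumes "category C" "category D" "is_nt C D \<alpha>"
  shows "hcomp_nt C D (id_nt D D (id_ftor D)) \<alpha> = \<alpha>"
proof (rule nt_eqI)
  interpret C: category C by fact
  interpret D: category D by fact
  interpret a: is_nt C D \<alpha> by fact
  interpret F: is_functor C D "nsrc \<alpha>" by (rule a.nsrc_functor)
  interpret F': is_functor C D "ntgt \<alpha>" by (rule a.ntgt_functor)
  show "is_nt C D (hcomp_nt C D (id_nt D D (id_ftor D)) \<alpha>)"
    using assms by (simp add: is_nt_hcomp is_nt_id is_functor_id)
  show "cmpt (hcomp_nt C D (id_nt D D (id_ftor D)) \<alpha>) x = cmpt \<alpha> x" if "x \<in> Obj C" for x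
    using that D.Cmp_Idt_left[of "cmpt \<alpha> x"] by (simp add: hcomp_nt_def id_nt_def incl_ftor_def)
qed (use assms in \<open>simp_all add: comp_ftor_id_left[OF is_functor_hom(1)] comp_ftor_id_left[OF is_functor_hom(2)]\<close>)

section \<open>Squares, display functors and the axioms of \<open>sDMC\<close>\<close>

lemma Square_in_squares [simp]:
  "Square d e u v \<in> squares C \<longleftrightarrow> d \<in> Arr C \<and> e \<in> Arr C \<and> u \<in> Arr C \<and> v \<in> Arr C
     \<and> Dom C u = Dom C d \<and> Cod C u = Dom C e \<and> Dom C v = Cod C d \<and> Cod C v = Cod C e
     \<and> Cmp C e u = Cmp C v d"
  by (auto simp: squares_def)

lemma pullback_square_in_squares: "pullback_square C s \<Longrightarrow> s \<in> squares C"
  by (simp add: pullback_square_def)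

lemma map_square_in_squares:
  assumes "is_functor C D F" "s \<in> squares C"
  shows "map_square (Fa F) s \<in> squares D"
proof -
  interpret F: is_functor C D F by fact
  obtain d e u v where s: "s = Square d e u v" by (cases s)
  with assms(2) have a: "d \<in> Arr C" "e \<in> Arr C" "u \<in> Arr C" "v \<in> Arr C"
     "Dom C u = Dom C d" "Cod C u = Dom C e" "Dom C v = Cod C d" "Cod C v = Cod C e"
     "Cmp C e u = Cmp C v d" by auto
  then have "Cmp D (Fa F e) (Fa F u) = Cmp D (Fa F v) (Fa F d)"
    using F.Fa_Cmp[of u e] F.Fa_Cmp[of d v] by simp
  then show ?thesis using s a by simp
qed

lemma map_square_id_ftor: "s \<in> squares C \<Longrightarrow> map_square (Fa (id_ftor C)) s = s"
  by (cases s) (auto simp: incl_ftor_def)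

lemma map_square_comp_ftor:
  "s \<in> squares C \<Longrightarrow> map_square (Fa (comp_ftor C G F)) s = map_square (Fa G) (map_square (Fa F) s)"
  by (cases s) (auto simp: comp_ftor_def)

lemma display_functor_is_functor: "display_functor A B F \<Longrightarrow> is_functor (fst A) (fst B) F"
  by (simp add: display_functor_def)

lemma display_functor_id:
  assumes "category (fst A)" "display_structure (fst A) (snd A)"
  shows "display_functor A A (id_ftor (fst A))"
  using assms is_functor_id[OF assms(1)]
  by (auto simp: display_functor_def display_structure_def map_square_id_ftor
      pullback_square_in_squares) (auto simp: incl_ftor_def)

text \<open>The image of a pullback square over a display map is again one over a display map, so
  the second functor can be applied to it.\<close>

lemma display_functor_comp:
  assumes "category (fst A)" "display_structure (fst A) (snd A)"
    and "display_functor A B F" "display_functor B E G"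
  shows "display_functor A E (comp_ftor (fst A) G F)"
proof -
  have "pullback_square (fst E) (map_square (Fa (comp_ftor (fst A) G F)) s)"
    if "pullback_square (fst A) s" "sq_tgt s \<in> snd A" for s
  proof -
    have "pullback_square (fst B) (map_square (Fa F) s)" "sq_tgt (map_square (Fa F) s) \<in> snd B"
      using assms(3) that by (auto simp: display_functor_def square.map_sel)
    then show ?thesis
      using assms(4) that by (auto simp: display_functor_def map_square_comp_ftor
          pullback_square_in_squares)
  qed
  moreover have "Fa (comp_ftor (fst A) G F) ` snd A \<subseteq> snd E"
    using assms by (fastforce simp: display_functor_def comp_ftor_def display_structure_def)
  ultimately show ?thesis
    using assms is_functor_comp by (auto simp: display_functor_def)
qed

lemma sDMC_simps [simp]:
  "A \<in> Cells0 sDMC \<longleftrightarrow> category (fst A) \<and> display_structure (fst A) (snd A)"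
  "Unit sDMC A = id_ftor (fst A)"
  "Cmp1 sDMC A B E G F = comp_ftor (fst A) G F"
  "Cmp2 sDMC A B E \<beta> \<alpha> = hcomp_nt (fst A) (fst E) \<beta> \<alpha>"
  by (auto simp: sDMC_def)

lemma Hom_sDMC_simps [simp]:
  "Obj (Hom sDMC A B) = {F. display_functor A B F}"
  "Arr (Hom sDMC A B) = {\<alpha>. is_nt (fst A) (fst B) \<alpha> \<and> display_functor A B (nsrc \<alpha>)
     \<and> display_functor A B (ntgt \<alpha>)}"
  "\<alpha> \<in> Arr (Hom sDMC A B) \<Longrightarrow> Dom (Hom sDMC A B) \<alpha> = nsrc \<alpha>"
  "\<alpha> \<in> Arr (Hom sDMC A B) \<Longrightarrow> Cod (Hom sDMC A B) \<alpha> = ntgt \<alpha>"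
  "F \<in> Obj (Hom sDMC A B) \<Longrightarrow> Idt (Hom sDMC A B) F = id_nt (fst A) (fst B) F"
  "\<alpha> \<in> Arr (Hom sDMC A B) \<Longrightarrow> \<beta> \<in> Arr (Hom sDMC A B) \<Longrightarrow> nsrc \<beta> = ntgt \<alpha> \<Longrightarrow>
     Cmp (Hom sDMC A B) \<beta> \<alpha> = vcomp_nt (fst A) (fst B) \<beta> \<alpha>"
  by (auto simp: sDMC_def full_subcat_def Let_def display_functor_is_functor)

lemma Hom_sDMC_Dom_Cod [simp]:
  assumes "is_nt (fst A) (fst B) \<alpha>" "display_functor A B (nsrc \<alpha>)" "display_functor A B (ntgt \<alpha>)"
  shows "Dom (Hom sDMC A B) \<alpha> = nsrc \<alpha>" "Cod (Hom sDMC A B) \<alpha> = ntgt \<alpha>"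
  using assms by simp_all

lemma category_Hom_sDMC:
  "category (fst A) \<Longrightarrow> category (fst B) \<Longrightarrow> category (Hom sDMC A B)"
  by (simp add: sDMC_def category_full_subcat category_fun_cat)

text \<open>All equations are those of categories, functors and natural transformations.
  Hom-categories are full in functor categories, so only 1-cells carry an extra condition, and it is
  stable under identities and composition.\<close>

theorem two_category_sDMC: "two_category (sDMC :: ('o, 'a) dm_twocat)"
proof (rule two_category.intro)
  fix A B E H :: "('o, 'a) sdmcat"
  assume "A \<in> Cells0 sDMC" "B \<in> Cells0 sDMC" "E \<in> Cells0 sDMC" "H \<in> Cells0 sDMC"
  then have cells [simp]: "category (fst A)" "display_structure (fst A) (snd A)" "category (fst B)"
    "display_structure (fst B) (snd B)" "category (fst E)" "category (fst H)" by simp_all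
  note [simp] = display_functor_comp[of A B _ E] is_nt_hcomp[of "fst A" "fst B" "fst E"]
    is_nt_id is_nt_vcomp display_functor_is_functor hcomp_nt_interchange hcomp_nt_id display_functor_id
  fix F G L
  show "category (Hom sDMC A B)" by (simp add: category_Hom_sDMC)
  show "Unit sDMC A \<in> Obj (Hom sDMC A A)" by simp
  assume "F \<in> Obj (Hom sDMC A B)"
  then have F [simp]: "display_functor A B F" by simp
  show "Cmp1 sDMC A A B F (Unit sDMC A) = F" "Cmp1 sDMC A B B (Unit sDMC B) F = F"
    by (simp_all add: comp_ftor_id_right[of _ "fst B"] comp_ftor_id_left)
  assume "G \<in> Obj (Hom sDMC B E)"
  then have G [simp]: "display_functor B E G" by simp
  show "Cmp1 sDMC A B E G F \<in> Obj (Hom sDMC A E)"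
    "Cmp2 sDMC A B E (Idt (Hom sDMC B E) G) (Idt (Hom sDMC A B) F) =
      Idt (Hom sDMC A E) (Cmp1 sDMC A B E G F)"
    by simp_all
  assume "L \<in> Obj (Hom sDMC E H)"
  show "Cmp1 sDMC A E H L (Cmp1 sDMC A B E G F) = Cmp1 sDMC A B H (Cmp1 sDMC B E H L G) F"
    by (simp add: comp_ftor_assoc[of "fst A" "fst B"])
next
  fix A B E H :: "('o, 'a) sdmcat"
  assume "A \<in> Cells0 sDMC" "B \<in> Cells0 sDMC" "E \<in> Cells0 sDMC" "H \<in> Cells0 sDMC"
  then have cells [simp]: "category (fst A)" "display_structure (fst A) (snd A)" "category (fst B)"
    "display_structure (fst B) (snd B)" "category (fst E)" "category (fst H)" by simp_all
  note [simp] = display_functor_comp[of A B _ E] is_nt_hcomp[of "fst A" "fst B" "fst E"]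
    is_nt_id is_nt_vcomp
  fix s s' t t' r
  assume s: "s \<in> Arr (Hom sDMC A B)"
  then have [simp]: "is_nt (fst A) (fst B) s" "display_functor A B (nsrc s)"
    "display_functor A B (ntgt s)" by simp_all
  show "Cmp2 sDMC A A B s (Idt (Hom sDMC A A) (Unit sDMC A)) = s"
    "Cmp2 sDMC A B B (Idt (Hom sDMC B B) (Unit sDMC B)) s = s"
    by (simp_all add: hcomp_nt_unit_left hcomp_nt_unit_right display_functor_id)
  assume t: "t \<in> Arr (Hom sDMC B E)"
  then have [simp]: "is_nt (fst B) (fst E) t" "display_functor B E (nsrc t)"
    "display_functor B E (ntgt t)" by simp_all
  show "Cmp2 sDMC A B E t s \<in> Arr (Hom sDMC A E)"
    "Dom (Hom sDMC A E) (Cmp2 sDMC A B E t s) =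
      Cmp1 sDMC A B E (Dom (Hom sDMC B E) t) (Dom (Hom sDMC A B) s)"
    "Cod (Hom sDMC A E) (Cmp2 sDMC A B E t s) =
      Cmp1 sDMC A B E (Cod (Hom sDMC B E) t) (Cod (Hom sDMC A B) s)"
    by simp_all
  show "Cmp2 sDMC A E H r (Cmp2 sDMC A B E t s) = Cmp2 sDMC A B H (Cmp2 sDMC B E H r t) s"
    if "r \<in> Arr (Hom sDMC E H)"
    using that by (simp add: hcomp_nt_assoc[of _ "fst B" "fst E"])
  assume "s' \<in> Arr (Hom sDMC A B)" "Dom (Hom sDMC A B) s' = Cod (Hom sDMC A B) s"
    "t' \<in> Arr (Hom sDMC B E)" "Dom (Hom sDMC B E) t' = Cod (Hom sDMC B E) t"
  then show "Cmp2 sDMC A B E (Cmp (Hom sDMC B E) t' t) (Cmp (Hom sDMC A B) s' s) =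
      Cmp (Hom sDMC A E) (Cmp2 sDMC A B E t' s') (Cmp2 sDMC A B E t s)"
    by (simp add: hcomp_nt_interchange)
qed

lemma two_category_full_sub:
  assumes "two_category X"
  shows "two_category (full_sub_twocat X P)"
proof -
  interpret X: two_category X by fact
  show ?thesis
    unfolding full_sub_twocat_def
    by (rule two_category.intro) (auto simp: X.Hom_category X.Unit_cell X.Cmp1_cell X.Cmp2_cell
        X.Cmp2_Dom X.Cmp2_Cod X.Cmp2_Idt X.interchange X.Cmp1_assoc X.Cmp2_assoc
        X.Cmp1_Unit_right X.Cmp1_Unit_left X.Cmp2_Unit_right X.Cmp2_Unit_left)
qed

section \<open>Repletion of a display structure\<close>

lemma arrow_cat_simps [simp]:
  "Obj (arrow_cat C) = Arr C"
  "Arr (arrow_cat C) = squares C"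
  "s \<in> squares C \<Longrightarrow> Dom (arrow_cat C) s = sq_src s"
  "s \<in> squares C \<Longrightarrow> Cod (arrow_cat C) s = sq_tgt s"
  "d \<in> Arr C \<Longrightarrow> Idt (arrow_cat C) d = Square d d (Idt C (Dom C d)) (Idt C (Cod C d))"
  "s \<in> squares C \<Longrightarrow> t \<in> squares C \<Longrightarrow> sq_src t = sq_tgt s \<Longrightarrow> Cmp (arrow_cat C) t s =
     Square (sq_src s) (sq_tgt t) (Cmp C (sq_top t) (sq_top s)) (Cmp C (sq_bot t) (sq_bot s))"
  by (simp_all add: arrow_cat_def)

lemma squares_iff:
  "s \<in> squares C \<longleftrightarrow> sq_src s \<in> Arr C \<and> sq_tgt s \<in> Arr C \<and> sq_top s \<in> Arr C \<and> sq_bot s \<in> Arr C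
     \<and> Dom C (sq_top s) = Dom C (sq_src s) \<and> Cod C (sq_top s) = Dom C (sq_tgt s)
     \<and> Dom C (sq_bot s) = Cod C (sq_src s) \<and> Cod C (sq_bot s) = Cod C (sq_tgt s)
     \<and> Cmp C (sq_tgt s) (sq_top s) = Cmp C (sq_bot s) (sq_src s)"
  by (cases s) simp

lemma (in category) square_comp:
  assumes "Square d e u v \<in> squares C" "Square e f u' v' \<in> squares C"
  shows "Square d f (Cmp C u' u) (Cmp C v' v) \<in> squares C"
proof -
  have "Cmp C f (Cmp C u' u) = Cmp C (Cmp C v' e) u"
    using assms by (simp add: Cmp_assoc)
  also have "\<dots> = Cmp C v' (Cmp C v d)"
    using assms by (simp flip: Cmp_assoc)
  finally show ?thesis using assms by (simp add: Cmp_assoc)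
qed

lemma category_arrow_cat:
  assumes "category C"
  shows "category (arrow_cat C)"
proof -
  interpret category C by fact
  have comp: "Square (sq_src s) (sq_tgt t) (Cmp C (sq_top t) (sq_top s)) (Cmp C (sq_bot t) (sq_bot s))
      \<in> squares C" if "s \<in> squares C" "t \<in> squares C" "sq_src t = sq_tgt s" for s t
    using square_comp[of "sq_src s" "sq_tgt s" "sq_top s" "sq_bot s" "sq_tgt t" "sq_top t" "sq_bot t"]
      that by (cases s; cases t) auto
  show ?thesis
  proof
    show "Dom (arrow_cat C) \<in> Arr (arrow_cat C) \<rightarrow>\<^sub>E Obj (arrow_cat C)"
      "Cod (arrow_cat C) \<in> Arr (arrow_cat C) \<rightarrow>\<^sub>E Obj (arrow_cat C)"
      "Idt (arrow_cat C) \<in> Obj (arrow_cat C) \<rightarrow>\<^sub>E Arr (arrow_cat C)"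
      by (auto simp: arrow_cat_def squares_iff)
    show "Cmp (arrow_cat C) t s = undefined"
      if "\<not> (s \<in> Arr (arrow_cat C) \<and> t \<in> Arr (arrow_cat C) \<and>
        Dom (arrow_cat C) t = Cod (arrow_cat C) s)" for s t
      using that by (auto simp: arrow_cat_def)
    show "Cmp (arrow_cat C) f (Idt (arrow_cat C) (Dom (arrow_cat C) f)) = f"
      if "f \<in> Arr (arrow_cat C)" for f
      using that Cmp_Idt_right[of "sq_top f"] Cmp_Idt_right[of "sq_bot f"]
      by (simp add: squares_iff)
    show "Cmp (arrow_cat C) (Idt (arrow_cat C) (Cod (arrow_cat C) f)) f = f"
      if "f \<in> Arr (arrow_cat C)" for f
      using that Cmp_Idt_left[of "sq_top f"] Cmp_Idt_left[of "sq_bot f"]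
      by (simp add: squares_iff)
    show "Cmp (arrow_cat C) h (Cmp (arrow_cat C) g f) = Cmp (arrow_cat C) (Cmp (arrow_cat C) h g) f"
      if "f \<in> Arr (arrow_cat C)" "g \<in> Arr (arrow_cat C)" "h \<in> Arr (arrow_cat C)"
        "Dom (arrow_cat C) g = Cod (arrow_cat C) f" "Dom (arrow_cat C) h = Cod (arrow_cat C) g"
      for f g h
      using that comp[of f g] comp[of g h]
      by (simp del: Square_in_squares) (simp add: squares_iff Cmp_assoc)
  qed (auto simp: comp simp del: Square_in_squares, auto simp: squares_iff)
qed

lemma is_functor_arr_ftor:
  assumes "category C" "is_functor C D F"
  shows "is_functor (arrow_cat C) (arrow_cat D) (arr_ftor C F)"
proof -
  interpret C: category C by fact
  interpret A: category "arrow_cat C" by (rule category_arrow_cat) fact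
  interpret F: is_functor C D F by fact
  note [simp] = map_square_in_squares[OF assms(2)]
  show ?thesis
  proof
    show "Fa (arr_ftor C F) (Cmp (arrow_cat C) g f) =
        Cmp (arrow_cat D) (Fa (arr_ftor C F) g) (Fa (arr_ftor C F) f)"
      if "f \<in> Arr (arrow_cat C)" "g \<in> Arr (arrow_cat C)"
        "Dom (arrow_cat C) g = Cod (arrow_cat C) f" for f g
      using that A.Cmp_Arr[OF that]
      by (simp add: arr_ftor_def square.map_sel) (simp add: squares_iff)
  qed (auto simp: arr_ftor_def square.map_sel, auto simp: squares_iff)
qed

lemma is_functor_iso:
  assumes "category C" "is_functor C D F" "is_iso C f"
  shows "is_iso D (Fa F f)"
proof -
  interpret C: category C by fact
  interpret F: is_functor C D F by fact
  from assms(3) obtain g where f: "f \<in> Arr C" and g: "g \<in> Arr C" "Dom C g = Cod C f" "Cod C g = Dom C f"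
    "Cmp C g f = Idt C (Dom C f)" "Cmp C f g = Idt C (Cod C f)"
    by (auto simp: is_iso_def)
  show ?thesis
    using f g F.Fa_Cmp[of f g] F.Fa_Cmp[of g f]
    by (auto simp: is_iso_def intro!: bexI[of _ "Fa F g"])
qed

text \<open>Applying \<open>F\<close> to a square is the arrow part of the induced functor between
  arrow categories, and functors preserve isomorphisms.\<close>

lemma map_square_iso:
  assumes "category C" "is_functor C D F" "is_iso (arrow_cat C) s"
  shows "is_iso (arrow_cat D) (map_square (Fa F) s)"
proof -
  have "s \<in> squares C" using assms(3) by (simp add: is_iso_def)
  then show ?thesis
    using is_functor_iso[OF category_arrow_cat[OF assms(1)] is_functor_arr_ftor[OF assms(1,2)] assms(3)]
    by (simp add: arr_ftor_def)
qed

section \<open>Pullback squares and isomorphisms of the arrow category\<close>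

context category
begin

lemma iso_Cmp:
  assumes "is_iso C f" "is_iso C g" "Dom C g = Cod C f"
  shows "is_iso C (Cmp C g f)"
proof -
  from assms(1) obtain f' where f: "f \<in> Arr C" "f' \<in> Arr C" "Dom C f' = Cod C f" "Cod C f' = Dom C f"
    "Cmp C f' f = Idt C (Dom C f)" "Cmp C f f' = Idt C (Cod C f)"
    by (auto simp: is_iso_def)
  from assms(2) obtain g' where g: "g \<in> Arr C" "g' \<in> Arr C" "Dom C g' = Cod C g" "Cod C g' = Dom C g"
    "Cmp C g' g = Idt C (Dom C g)" "Cmp C g g' = Idt C (Cod C g)"
    by (auto simp: is_iso_def)
  have "Cmp C (Cmp C f' g') (Cmp C g f) = Cmp C f' (Cmp C (Cmp C g' g) f)"
    using f(1-4) g(1-4) assms(3) by (simp add: Cmp_assoc)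
  also have "\<dots> = Idt C (Dom C f)" using f g assms(3) by simp
  finally have 1: "Cmp C (Cmp C f' g') (Cmp C g f) = Idt C (Dom C f)" .
  have "Cmp C (Cmp C g f) (Cmp C f' g') = Cmp C g (Cmp C (Cmp C f f') g')"
    using f(1-4) g(1-4) assms(3) by (simp add: Cmp_assoc)
  also have "\<dots> = Idt C (Cod C g)"
    using f g assms(3) Cmp_Idt_left[of g'] by simp
  finally show ?thesis using f g assms(3) 1
    by (auto simp: is_iso_def intro!: bexI[of _ "Cmp C f' g'"])
qed

lemma isomorphic_refl: "x \<in> Obj C \<Longrightarrow> isomorphic C x x"
  using Cmp_Idt_left[of "Idt C x"]
  by (auto simp: isomorphic_def is_iso_def intro!: exI[of _ "Idt C x"] bexI[of _ "Idt C x"])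

lemma isomorphic_trans: "isomorphic C x y \<Longrightarrow> isomorphic C y z \<Longrightarrow> isomorphic C x z"
  unfolding isomorphic_def using iso_Cmp Dom_Cmp Cod_Cmp by (metis is_iso_def)

text \<open>The mediating map of a cone is its leg \<open>x\<close> followed by the top component of
  the inverse square. Invertibility of the top of \<open>s\<close> leaves no other candidate, and
  invertibility of the bottom gives the equation for the other leg.\<close>

lemma pullback_iso:
  assumes "is_iso (arrow_cat C) s"
  shows "pullback_square C s"
proof -
  obtain d e u v where s: "s = Square d e u v" by (cases s)
  from assms obtain t where t: "s \<in> squares C" "t \<in> squares C" "sq_src t = e" "sq_tgt t = d"
    "Cmp (arrow_cat C) t s = Idt (arrow_cat C) d" "Cmp (arrow_cat C) s t = Idt (arrow_cat C) e"
    by (auto simp: is_iso_def s)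
  then have sq: "Square d e u v \<in> squares C" using s by simp
  obtain u' v' where t': "t = Square e d u' v'" using t by (cases t) auto
  with t have sq': "Square e d u' v' \<in> squares C" by simp
  have inv: "Cmp C u' u = Idt C (Dom C d)" "Cmp C v' v = Idt C (Cod C d)"
    "Cmp C u u' = Idt C (Dom C e)" "Cmp C v v' = Idt C (Cod C e)"
    using t sq by (auto simp: s t')
  note [simp] = sq[simplified] sq'[simplified]
  have "\<exists>!h. h \<in> Arr C \<and> Dom C h = Dom C x \<and> Cod C h = Dom C d \<and> Cmp C u h = x \<and> Cmp C d h = y"
    if xy: "x \<in> Arr C" "y \<in> Arr C" "Dom C x = Dom C y" "Cod C x = Dom C e" "Cod C y = Dom C v"
      "Cmp C e x = Cmp C v y" for x y
  proof (rule ex1I)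
    have "Cmp C u (Cmp C u' x) = Cmp C (Cmp C u u') x"
      using xy(1-5) by (simp add: Cmp_assoc del: inv)
    also have "\<dots> = x" using xy(1-5) Cmp_Idt_left[of x] by (simp add: inv)
    finally have 1: "Cmp C u (Cmp C u' x) = x" .
    have "Cmp C d (Cmp C u' x) = Cmp C (Cmp C d u') x" using xy(1-5) by (simp add: Cmp_assoc)
    also have "\<dots> = Cmp C v' (Cmp C e x)" using xy(1-5) by (simp add: Cmp_assoc)
    also have "\<dots> = Cmp C (Cmp C v' v) y" using xy by (simp add: Cmp_assoc)
    also have "\<dots> = y" using xy(1-5) Cmp_Idt_left[of y] by (simp add: inv)
    finally show "Cmp C u' x \<in> Arr C \<and> Dom C (Cmp C u' x) = Dom C x \<and> Cod C (Cmp C u' x) = Dom C d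
        \<and> Cmp C u (Cmp C u' x) = x \<and> Cmp C d (Cmp C u' x) = y"
      using xy 1 by simp
    fix h assume h: "h \<in> Arr C \<and> Dom C h = Dom C x \<and> Cod C h = Dom C d \<and> Cmp C u h = x \<and> Cmp C d h = y"
    then have "Cmp C u' x = Cmp C (Cmp C u' u) h" using Cmp_assoc[of h u u'] by simp
    then show "h = Cmp C u' x" using h Cmp_Idt_left[of h] by (simp add: inv)
  qed
  then show ?thesis using sq by (simp add: pullback_square_def s)
qed

text \<open>A cone \<open>(x, y)\<close> over the composite induces the cone
  \<open>(x, Cmp C v y)\<close> over \<open>t\<close>, whose mediating map \<open>k\<close> forms
  with \<open>y\<close> a cone over \<open>s\<close>.\<close>

lemma pullback_paste:
  assumes "pullback_square C s" "pullback_square C t" "sq_src t = sq_tgt s"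
  shows "pullback_square C (Cmp (arrow_cat C) t s)"
proof -
  obtain d e u v where s: "s = Square d e u v" by (cases s)
  obtain f u' v' where t: "t = Square e f u' v'" using assms(3) s by (cases t) auto
  have sq: "Square d e u v \<in> squares C" "Square e f u' v' \<in> squares C"
    using assms(1,2) by (simp_all add: pullback_square_def s t)
  note [simp] = sq[simplified]
  have "\<exists>!h. h \<in> Arr C \<and> Dom C h = Dom C x \<and> Cod C h = Dom C d \<and> Cmp C (Cmp C u' u) h = x
      \<and> Cmp C d h = y"
    if xy: "x \<in> Arr C" "y \<in> Arr C" "Dom C x = Dom C y" "Cod C x = Dom C f" "Cod C y = Dom C v"
      "Cmp C f x = Cmp C (Cmp C v' v) y" for x y
  proof -
    have pb: "\<exists>!h. h \<in> Arr C \<and> Dom C h = Dom C x \<and> Cod C h = Dom C e \<and> Cmp C u' h = x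
        \<and> Cmp C e h = Cmp C v y"
      using assms(2)[unfolded pullback_square_def, THEN conjunct2, rule_format, of x "Cmp C v y"] xy
      by (simp add: t Cmp_assoc)
    then obtain k where k: "k \<in> Arr C" "Dom C k = Dom C x" "Cod C k = Dom C e" "Cmp C u' k = x"
        "Cmp C e k = Cmp C v y" by blast
    then have "\<exists>!h. h \<in> Arr C \<and> Dom C h = Dom C x \<and> Cod C h = Dom C d \<and> Cmp C u h = k \<and> Cmp C d h = y"
      using assms(1) xy by (simp add: pullback_square_def s)
    \<comment> \<open>This equivalence turns the mediating maps of \<open>(k, y)\<close> for
      \<open>s\<close> into those of \<open>(x, y)\<close> for the composite, existence and
      uniqueness alike. Its backward direction is uniqueness of \<open>k\<close> for
      \<open>t\<close>.\<close>
    moreover have "Cmp C u h = k \<longleftrightarrow> Cmp C (Cmp C u' u) h = x"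
      if h: "h \<in> Arr C" "Dom C h = Dom C x" "Cod C h = Dom C d" "Cmp C d h = y" for h
    proof
      show "Cmp C u h = k \<Longrightarrow> Cmp C (Cmp C u' u) h = x"
        using h k Cmp_assoc[of h u u'] by simp
      assume "Cmp C (Cmp C u' u) h = x"
      moreover have "Cmp C e (Cmp C u h) = Cmp C (Cmp C v d) h" using h by (simp add: Cmp_assoc)
      moreover have "Cmp C (Cmp C v d) h = Cmp C v y" using h Cmp_assoc[of h d v] by simp
      ultimately have "Cmp C u h \<in> Arr C \<and> Dom C (Cmp C u h) = Dom C x \<and> Cod C (Cmp C u h) = Dom C e
          \<and> Cmp C u' (Cmp C u h) = x \<and> Cmp C e (Cmp C u h) = Cmp C v y"
        using h Cmp_assoc[of h u u'] by simp
      then show "Cmp C u h = k" using pb k by blast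
    qed
    ultimately show ?thesis by metis
  qed
  then show ?thesis using sq square_comp[OF sq] by (simp add: pullback_square_def s t)
qed

text \<open>Uniqueness of pullbacks is phrased in the arrow category so that the comparison is a
  square that can be pasted and mapped by functors.\<close>

lemma pullback_unique:
  assumes "pullback_square C s" "pullback_square C t" "sq_tgt s = sq_tgt t" "sq_bot s = sq_bot t"
  obtains h where "is_iso (arrow_cat C) h" "sq_src h = sq_src s" "sq_tgt h = sq_src t"
    "s = Cmp (arrow_cat C) t h"
proof -
  obtain d f u v where s: "s = Square d f u v" by (cases s)
  obtain e u' where t: "t = Square e f u' v" using assms(3,4) s by (cases t) auto
  have sq: "Square d f u v \<in> squares C" "Square e f u' v \<in> squares C"
    using assms(1,2) by (simp_all add: pullback_square_def s t)
  note [simp] = sq[simplified]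
  let ?P = "\<lambda>d u x h. h \<in> Arr C \<and> Dom C h = Dom C x \<and> Cod C h = Dom C d \<and> Cmp C u h = x"
  have pbs: "\<exists>!h. ?P d u x h \<and> Cmp C d h = y"
    if "x \<in> Arr C" "y \<in> Arr C" "Dom C x = Dom C y" "Cod C x = Dom C f" "Cod C y = Dom C v"
      "Cmp C f x = Cmp C v y" for x y
    using assms(1) that by (simp add: pullback_square_def s)
  have pbt: "\<exists>!h. ?P e u' x h \<and> Cmp C e h = y"
    if "x \<in> Arr C" "y \<in> Arr C" "Dom C x = Dom C y" "Cod C x = Dom C f" "Cod C y = Dom C v"
      "Cmp C f x = Cmp C v y" for x y
    using assms(2) that by (simp add: pullback_square_def t)
  \<comment> \<open>A pullback square is a cone over itself, with the identity as its only mediating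
    map. Both composites of the comparisons \<open>h\<close> and \<open>k\<close> mediate such a
    cone, hence are identities.\<close>
  have uniq_s: "\<exists>!h. ?P d u u h \<and> Cmp C d h = d" by (rule pbs) simp_all
  have uniq_t: "\<exists>!h. ?P e u' u' h \<and> Cmp C e h = e" by (rule pbt) simp_all
  obtain h where h: "?P e u' u h" "Cmp C e h = d" using pbt[of u d] by auto
  obtain k where k: "?P d u u' k" "Cmp C d k = e" using pbs[of u' e] by auto
  note [simp] = h(1)[THEN conjunct1] k(1)[THEN conjunct1]
  have cod: "Cod C d = Cod C e" using sq by (metis Square_in_squares)
  have "Cmp C u (Cmp C k h) = Cmp C (Cmp C u k) h" "Cmp C d (Cmp C k h) = Cmp C (Cmp C d k) h"
    using h k by (simp_all add: Cmp_assoc)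
  then have "?P d u u (Cmp C k h) \<and> Cmp C d (Cmp C k h) = d"
    using h k by simp
  moreover have "?P d u u (Idt C (Dom C d)) \<and> Cmp C d (Idt C (Dom C d)) = d"
    using Cmp_Idt_right[of u] by simp
  ultimately have kh: "Cmp C k h = Idt C (Dom C d)"
    using uniq_s by blast
  have "Cmp C u' (Cmp C h k) = Cmp C (Cmp C u' h) k" "Cmp C e (Cmp C h k) = Cmp C (Cmp C e h) k"
    using h k by (simp_all add: Cmp_assoc)
  then have "?P e u' u' (Cmp C h k) \<and> Cmp C e (Cmp C h k) = e"
    using h k by simp
  moreover have "?P e u' u' (Idt C (Dom C e)) \<and> Cmp C e (Idt C (Dom C e)) = e"
    using Cmp_Idt_right[of u'] by simp
  ultimately have hk: "Cmp C h k = Idt C (Dom C e)"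
    using uniq_t by blast
  \<comment> \<open>The two squares share their bottom arrow, so the comparison moves only the
    domains and its bottom component is an identity.\<close>
  let ?i = "Idt C (Cod C e)"
  let ?h = "Square d e h ?i" and ?k = "Square e d k ?i"
  have sqh: "?h \<in> squares C" "?k \<in> squares C"
    using h k cod Cmp_Idt_left[of d] Cmp_Idt_left[of e] by simp_all
  have "Cmp (arrow_cat C) ?k ?h = Idt (arrow_cat C) d" "Cmp (arrow_cat C) ?h ?k = Idt (arrow_cat C) e"
    using sqh kh hk cod Cmp_Idt_left[of ?i] by (simp_all del: Square_in_squares)
  then have iso: "is_iso (arrow_cat C) ?h"
    unfolding is_iso_def using sqh by (intro conjI bexI[of _ ?k]) (simp_all del: Square_in_squares)
  have "s = Cmp (arrow_cat C) t ?h"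
    using sqh sq h cod Cmp_Idt_right[of v] by (simp add: s t)
  from that[OF iso _ _ this] show ?thesis by (simp add: s t)
qed

end


section \<open>Closure of a display structure under isomorphism\<close>

text \<open>One closure step suffices since isomorphy is transitive. The new maps are arrows of the
  same category, so no type has to change.\<close>

definition repletion :: "('o, 'a) cat \<Rightarrow> 'a set \<Rightarrow> 'a set" where
  "repletion C D = {e. \<exists>d\<in>D. isomorphic (arrow_cat C) d e}"

lemma subset_repletion:
  assumes "category C" "D \<subseteq> Arr C"
  shows "D \<subseteq> repletion C D"
  using category.isomorphic_refl[OF category_arrow_cat[OF assms(1)]] assms(2)
  by (auto simp: repletion_def)

lemma replete_maps_repletion:
  assumes "category C"
  shows "replete_maps C (repletion C D)"
proof -
  interpret A: category "arrow_cat C" by (rule category_arrow_cat) fact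
  show ?thesis by (auto simp: repletion_def replete_maps_def intro: A.isomorphic_trans)
qed

text \<open>Both directions of the isomorphism are supplied as squares: \<open>s\<close> carries
  data over \<open>e\<close> to data over \<open>d\<close>, where the display structure applies, and
  the inverse law recovers the original data after pasting with \<open>t\<close>.\<close>

lemma repletionE:
  assumes "e \<in> repletion C D"
  obtains d s t where "d \<in> D" "is_iso (arrow_cat C) s" "is_iso (arrow_cat C) t"
    "sq_src s = e" "sq_tgt s = d" "sq_src t = d" "sq_tgt t = e"
    "Cmp (arrow_cat C) t s = Idt (arrow_cat C) e"
proof -
  from assms obtain d t where t: "d \<in> D" "is_iso (arrow_cat C) t" "Dom (arrow_cat C) t = d"
    "Cod (arrow_cat C) t = e"
    by (auto simp: repletion_def isomorphic_def)
  then obtain s where s: "t \<in> squares C" "s \<in> squares C" "Dom (arrow_cat C) s = e" "Cod (arrow_cat C) s = d"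
    "Cmp (arrow_cat C) s t = Idt (arrow_cat C) d" "Cmp (arrow_cat C) t s = Idt (arrow_cat C) e"
    by (auto simp: is_iso_def)
  then have "is_iso (arrow_cat C) s" using t by (auto simp: is_iso_def intro!: bexI[of _ t])
  then show ?thesis using that[of d s t] s t by simp
qed

lemma display_structure_repletion:
  assumes "category C" "display_structure C D"
  shows "display_structure C (repletion C D)"
proof -
  interpret category C by fact
  have sub: "D \<subseteq> Arr C" using assms(2) by (simp add: display_structure_def)
  have "repletion C D \<subseteq> Arr C"
    by (auto simp: repletion_def isomorphic_def is_iso_def squares_iff)
  moreover have "\<exists>d'\<in>repletion C D. \<exists>u. pullback_square C (Square d' e u f)"
    if e: "e \<in> repletion C D" and f: "f \<in> Arr C" "Cod C f = Cod C e" for e f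
  proof -
    from e obtain d s t where d: "d \<in> D" and iso: "is_iso (arrow_cat C) s" "is_iso (arrow_cat C) t"
      and inv: "sq_src s = e" "sq_tgt s = d" "sq_src t = d" "sq_tgt t = e"
        "Cmp (arrow_cat C) t s = Idt (arrow_cat C) e"
      by (rule repletionE)
    then have st: "sq_src s = e" "sq_tgt s = d" "sq_src t = d" "sq_tgt t = e"
        "Cmp (arrow_cat C) t s = Idt (arrow_cat C) e" "s \<in> squares C" "t \<in> squares C"
      by (simp_all add: is_iso_def)
    \<comment> \<open>The arrow \<open>f\<close> ends at the codomain of \<open>e\<close>; the
      bottom of \<open>s\<close> moves it to the codomain of \<open>d\<close>, along which
      \<open>D\<close> supplies a pullback.\<close>
    let ?g = "Cmp C (sq_bot s) f"
    have "?g \<in> Arr C" "Cod C ?g = Cod C d" using f st by (auto simp: squares_iff)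
    then obtain d' u where d': "d' \<in> D" and pb: "pullback_square C (Square d' d u ?g)"
      using assms(2) d unfolding display_structure_def by blast
    \<comment> \<open>This is the bottom of the square pasted with \<open>t\<close>. That it equals
      \<open>f\<close> shows that the pasted square is a pullback along the given arrow; its source
      is the unchanged \<open>d'\<close> in \<open>D\<close>.\<close>
    have "Cmp C (sq_bot t) ?g = Cmp C (Cmp C (sq_bot t) (sq_bot s)) f"
      using f st by (simp add: Cmp_assoc squares_iff)
    also have "\<dots> = f" using st f Cmp_Idt_left[of f] by (simp add: squares_iff)
    finally have "Cmp (arrow_cat C) t (Square d' d u ?g) = Square d' e (Cmp C (sq_top t) u) f"
      using pullback_square_in_squares[OF pb] st by (simp del: Square_in_squares)
    moreover have "pullback_square C (Cmp (arrow_cat C) t (Square d' d u ?g))"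
      using pullback_paste[OF pb pullback_iso[OF iso(2)]] st by simp
    ultimately show ?thesis using d' subset_repletion[OF assms(1) sub] by auto
  qed
  ultimately show ?thesis by (auto simp: display_structure_def)
qed

lemma display_functor_repletion_iff:
  assumes "category C" "category C'" "D \<subseteq> Arr C" "replete_maps C' D'"
  shows "display_functor (C, repletion C D) (C', D') F \<longleftrightarrow> display_functor (C, D) (C', D') F"
proof
  assume "display_functor (C, repletion C D) (C', D') F"
  then show "display_functor (C, D) (C', D') F"
    using subset_repletion[OF assms(1,3)] by (auto simp: display_functor_def)
next
  interpret C: category C by fact
  interpret C': category C' by fact
  interpret A: category "arrow_cat C" by (rule category_arrow_cat) fact
  assume F: "display_functor (C, D) (C', D') F"
  then have fF: "is_functor C C' F" by (simp add: display_functor_def)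
  interpret F: is_functor "arrow_cat C" "arrow_cat C'" "arr_ftor C F"
    by (rule is_functor_arr_ftor) fact+
  have map_iso: "is_iso (arrow_cat C') (map_square (Fa F) s)" if "is_iso (arrow_cat C) s" for s
    by (rule map_square_iso) fact+
  have "Fa F e \<in> D'" if "e \<in> repletion C D" for e
  proof -
    from that obtain d t where d: "d \<in> D" "is_iso (arrow_cat C) t" "sq_src t = d" "sq_tgt t = e"
      by (auto elim!: repletionE)
    then have t: "map_square (Fa F) t \<in> squares C'"
      using map_square_in_squares[OF fF] by (simp add: is_iso_def)
    \<comment> \<open>Here repleteness of the target enters: the image of \<open>e\<close> is
      isomorphic to the image of \<open>d\<close>, which lies in \<open>D'\<close>.\<close>
    have "isomorphic (arrow_cat C') (Fa F d) (Fa F e)"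
      unfolding isomorphic_def using map_iso[of t] d t
      by (auto simp: square.map_sel intro!: exI[of _ "map_square (Fa F) t"])
    moreover have "Fa F d \<in> D'" using F d by (auto simp: display_functor_def)
    ultimately show ?thesis using assms(4) by (auto simp: replete_maps_def)
  qed
  moreover have "pullback_square C' (map_square (Fa F) r)"
    if r: "pullback_square C r" "sq_tgt r \<in> repletion C D" for r
  proof -
    from r(2) obtain d s t where d: "d \<in> D" and iso: "is_iso (arrow_cat C) s" "is_iso (arrow_cat C) t"
      and st: "sq_src s = sq_tgt r" "sq_tgt s = d" "sq_src t = d" "sq_tgt t = sq_tgt r"
        "Cmp (arrow_cat C) t s = Idt (arrow_cat C) (sq_tgt r)"
      by (rule repletionE)
    have sq: "s \<in> squares C" "t \<in> squares C" "r \<in> squares C"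
      using iso r(1) by (auto simp: is_iso_def pullback_square_def)
    \<comment> \<open>Pasting with \<open>s\<close> replaces the target of \<open>r\<close> by the
      display map \<open>d\<close>, so the hypothesis on \<open>F\<close> applies to
      \<open>?q\<close>. Pasting the image with the image of the inverse \<open>t\<close> then gives
      back the image of \<open>r\<close>.\<close>
    let ?q = "Cmp (arrow_cat C) s r"
    have q: "?q \<in> squares C" "sq_tgt ?q = d" "sq_src ?q = sq_src r"
      using A.Cmp_Arr[of r s] sq st by simp_all
    have "pullback_square C ?q"
      using C.pullback_paste[OF r(1) C.pullback_iso[OF iso(1)]] st by simp
    then have "pullback_square C' (map_square (Fa F) ?q)"
      using F d q by (auto simp: display_functor_def)
    moreover have "pullback_square C' (map_square (Fa F) t)"
      by (rule C'.pullback_iso[OF map_iso[OF iso(2)]])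
    ultimately have "pullback_square C' (Cmp (arrow_cat C') (map_square (Fa F) t) (map_square (Fa F) ?q))"
      using C'.pullback_paste q st sq by (simp add: square.map_sel)
    moreover have "r = Cmp (arrow_cat C) t ?q"
      using A.Cmp_assoc[of r s t] A.Cmp_Idt_left[of r] sq st by (simp del: arrow_cat_simps(5,6))
    ultimately show ?thesis
      using F.Fa_Cmp[of ?q t] q st sq A.Cmp_Arr[of ?q t] by (simp add: arr_ftor_def del: arrow_cat_simps(5,6))
  qed
  ultimately show "display_functor (C, repletion C D) (C', D') F"
    using fF by (auto simp: display_functor_def)
qed

section \<open>The reflection of structured display map categories\<close>

lemma DMC_simps [simp]:
  "A \<in> Cells0 DMC \<longleftrightarrow> category (fst A) \<and> display_structure (fst A) (snd A) \<and> replete_maps (fst A) (snd A)"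
  "Hom DMC = Hom sDMC" "Unit DMC = Unit sDMC" "Cmp1 DMC = Cmp1 sDMC" "Cmp2 DMC = Cmp2 sDMC"
  by (auto simp: DMC_def full_sub_twocat_def)

lemma two_category_DMC: "two_category DMC"
  by (simp add: DMC_def two_category_full_sub two_category_sDMC)

definition reflect :: "('o, 'a) sdmcat \<Rightarrow> ('o, 'a) sdmcat" where
  "reflect A = (fst A, repletion (fst A) (snd A))"

lemma reflect_cell: "A \<in> Cells0 sDMC \<Longrightarrow> reflect A \<in> Cells0 DMC"
  by (simp add: reflect_def display_structure_repletion replete_maps_repletion)

text \<open>The functors and natural transformations are the same on both sides, so the adjunction
  isomorphism is an identity.\<close>

lemma Hom_reflect:
  assumes "A \<in> Cells0 sDMC" "B \<in> Cells0 DMC"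
  shows "Hom sDMC (reflect A) B = Hom sDMC A B"
proof -
  have "snd A \<subseteq> Arr (fst A)" using assms(1) by (simp add: display_structure_def)
  then have "display_functor (reflect A) B F = display_functor A B F" for F
    using display_functor_repletion_iff[of "fst A" "fst B" "snd A" "snd B" F] assms
    by (simp add: reflect_def)
  then have "display_functor (reflect A) B = display_functor A B" by (rule ext)
  moreover have "fst (reflect A) = fst A" by (simp add: reflect_def)
  ultimately show ?thesis by (simp add: sDMC_def)
qed

text \<open>The target can be enlarged first, since the pullback condition does not mention its
  display class. The enlarged target is replete, so \<open>Hom_reflect\<close> takes care of the
  source.\<close>

lemma display_functor_reflect:
  fixes A B :: "('o, 'a) sdmcat"
  assumes "A \<in> Cells0 sDMC" "B \<in> Cells0 sDMC" "display_functor A B F"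
  shows "display_functor (reflect A) (reflect B) F"
proof -
  have "snd B \<subseteq> Arr (fst B)" using assms(2) by (simp add: display_structure_def)
  then have "snd B \<subseteq> snd (reflect B)"
    using assms(2) subset_repletion[of "fst B" "snd B"] by (simp add: reflect_def)
  moreover have "fst (reflect B) = fst B" by (simp add: reflect_def)
  ultimately have "display_functor A (reflect B) F"
    using assms(3) by (auto simp: display_functor_def)
  then have "F \<in> Obj (Hom sDMC (reflect A) (reflect B))"
    by (simp add: Hom_reflect[OF assms(1) reflect_cell[OF assms(2)]])
  then show ?thesis by simp
qed

lemma incl_ftor_simps [simp]:
  "x \<in> Obj C \<Longrightarrow> Fo (incl_ftor C) x = x" "f \<in> Arr C \<Longrightarrow> Fa (incl_ftor C) f = f"
  by (simp_all add: incl_ftor_def)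

lemma is_functor_incl_ftor:
  assumes "category C" "category D" "Obj C \<subseteq> Obj D" "Arr C \<subseteq> Arr D"
    and "\<And>f. f \<in> Arr C \<Longrightarrow> Dom D f = Dom C f" "\<And>f. f \<in> Arr C \<Longrightarrow> Cod D f = Cod C f"
    and "\<And>x. x \<in> Obj C \<Longrightarrow> Idt D x = Idt C x"
    and "\<And>f g. f \<in> Arr C \<Longrightarrow> g \<in> Arr C \<Longrightarrow> Dom C g = Cod C f \<Longrightarrow> Cmp D g f = Cmp C g f"
  shows "is_functor C D (incl_ftor C)"
proof -
  interpret category C by fact
  show ?thesis
    using assms by unfold_locales (auto simp: incl_ftor_def)
qed

lemma two_functor_incl:
  assumes "two_category X"
  shows "is_two_functor (full_sub_twocat X P) X (incl_twoftor (full_sub_twocat X P))"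
proof -
  interpret X: two_category X by fact
  show ?thesis
    by (rule is_two_functor.intro)
      (auto simp: full_sub_twocat_def incl_twoftor_def is_functor_id X.Hom_category,
        auto simp: incl_ftor_def X.Unit_cell X.Cmp1_cell X.Cmp2_cell)
qed

text \<open>The hom functors are inclusions because a display functor, taken as a bare record, is
  also a display functor between the repletions.\<close>

definition reflection :: "(('o, 'a) sdmcat, ('o, 'a, 'o, 'a) ftor, ('o, 'a, 'o, 'a) nt,
    ('o, 'a) sdmcat, ('o, 'a, 'o, 'a) ftor, ('o, 'a, 'o, 'a) nt) twoftor" where
  "reflection = \<lparr> on0 = reflect, onHom = (\<lambda>A B. incl_ftor (Hom sDMC A B)) \<rparr>"

lemma two_functor_reflection:
  "is_two_functor (sDMC :: ('o, 'a) dm_twocat) DMC reflection"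
proof (rule is_two_functor.intro)
  fix A B E :: "('o, 'a) sdmcat"
  assume cells: "A \<in> Cells0 sDMC" "B \<in> Cells0 sDMC" "E \<in> Cells0 sDMC"
  interpret S: two_category sDMC by (rule two_category_sDMC)
  note dr = display_functor_reflect
  note [simp] = S.Unit_cell[OF cells(1), simplified] S.Cmp1_cell[OF cells, simplified]
    S.Cmp2_cell[OF cells, simplified]
  have [simp]: "fst (reflect A) = fst A" "fst (reflect B) = fst B" "fst (reflect E) = fst E"
    by (simp_all add: reflect_def)
  show "on0 reflection A \<in> Cells0 DMC"
    using reflect_cell[OF cells(1)] by (simp add: reflection_def)
  have "is_functor (Hom sDMC A B) (Hom sDMC (reflect A) (reflect B)) (incl_ftor (Hom sDMC A B))"
    using cells dr[OF cells(1,2)]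
    by (intro is_functor_incl_ftor) (auto simp: category_Hom_sDMC display_functor_is_functor)
  then show "is_functor (Hom sDMC A B) (Hom DMC (on0 reflection A) (on0 reflection B)) (onHom reflection A B)"
    by (simp add: reflection_def)
  show "Fo (onHom reflection A A) (Unit sDMC A) = Unit DMC (on0 reflection A)"
    using display_functor_id[of A] cells by (simp add: reflection_def)
  show "Fo (onHom reflection A E) (Cmp1 sDMC A B E g f) =
        Cmp1 DMC (on0 reflection A) (on0 reflection B) (on0 reflection E)
          (Fo (onHom reflection B E) g) (Fo (onHom reflection A B) f)"
    if "f \<in> Obj (Hom sDMC A B)" "g \<in> Obj (Hom sDMC B E)" for f g
    using that by (simp add: reflection_def incl_ftor_def)
  show "Fa (onHom reflection A E) (Cmp2 sDMC A B E t s) =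
        Cmp2 DMC (on0 reflection A) (on0 reflection B) (on0 reflection E)
          (Fa (onHom reflection B E) t) (Fa (onHom reflection A B) s)"
    if "s \<in> Arr (Hom sDMC A B)" "t \<in> Arr (Hom sDMC B E)" for s t
    using that S.Cmp2_cell[OF cells that] by (simp add: reflection_def incl_ftor_def)
qed

lemma cat_iso_id: "category C \<Longrightarrow> cat_iso C C (id_ftor C)"
  by (auto simp: cat_iso_def is_functor_id comp_ftor_id_left intro!: exI[of _ "id_ftor C"])

theorem left_two_adjoint_DMC:
  "left_two_adjoint (DMC :: ('o, 'a) dm_twocat) sDMC (incl_twoftor DMC) reflection (\<lambda>B A. id_ftor (Hom sDMC B A))"
proof (rule left_two_adjoint.intro)
  interpret S: two_category sDMC by (rule two_category_sDMC)
  show "two_category DMC" "two_category sDMC" by (rule two_category_DMC two_category_sDMC)+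
  show "is_two_functor sDMC DMC reflection" by (rule two_functor_reflection)
  show "is_two_functor DMC sDMC (incl_twoftor DMC)"
    unfolding DMC_def by (rule two_functor_incl[OF two_category_sDMC])
  fix B B' A A' :: "('o, 'a) sdmcat"
  assume cells: "B \<in> Cells0 sDMC" "A \<in> Cells0 DMC"
  show "cat_iso (Hom DMC (on0 reflection B) A) (Hom sDMC B (on0 (incl_twoftor DMC) A))
      (id_ftor (Hom sDMC B A))"
    using cells cat_iso_id[OF S.Hom_category, of B A]
    by (simp add: reflection_def incl_twoftor_def Hom_reflect[OF cells])
  assume cells': "B' \<in> Cells0 sDMC" "A' \<in> Cells0 DMC"
  have sc: "A \<in> Cells0 sDMC" "A' \<in> Cells0 sDMC" using cells cells' by simp_all
  have [simp]: "fst (reflect X) = fst X" for X by (simp add: reflect_def)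
  \<comment> \<open>All functors in the naturality equations are restricted identities, so both
    sides agree as soon as the composites are known to be cells of the hom-categories.\<close>
  note c1 = S.Cmp1_cell[OF cells'(1) cells(1) sc(1)] S.Cmp1_cell[OF cells'(1) sc]
  note c2 = S.Cmp2_cell[OF cells'(1) cells(1) sc(1)] S.Cmp2_cell[OF cells'(1) sc]
  show "Fo (id_ftor (Hom sDMC B' A')) (Cmp1 DMC (on0 reflection B') A A' f
         (Cmp1 DMC (on0 reflection B') (on0 reflection B) A h (Fo (onHom reflection B' B) g))) =
        Cmp1 sDMC B' (on0 (incl_twoftor DMC) A) (on0 (incl_twoftor DMC) A')
          (Fo (onHom (incl_twoftor DMC) A A') f)
          (Cmp1 sDMC B' B (on0 (incl_twoftor DMC) A) (Fo (id_ftor (Hom sDMC B A)) h) g)"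
    if "g \<in> Obj (Hom sDMC B' B)" "h \<in> Obj (Hom DMC (on0 reflection B) A)" "f \<in> Obj (Hom DMC A A')"
    for g h f
  proof -
    \<comment> \<open>A 1-cell out of the reflection of \<open>B\<close> is a 1-cell out of
      \<open>B\<close> itself, so it can be composed with \<open>g\<close> in
      \<open>sDMC\<close>.\<close>
    have h: "h \<in> Obj (Hom sDMC B A)"
      using that(2) Hom_reflect[OF cells] by (simp add: reflection_def)
    show ?thesis
      using that h c1(1)[OF that(1) h] c1(2)[OF c1(1)[OF that(1) h], of f]
      by (simp add: reflection_def incl_twoftor_def incl_ftor_def)
  qed
  show "Fa (id_ftor (Hom sDMC B' A')) (Cmp2 DMC (on0 reflection B') A A' s
         (Cmp2 DMC (on0 reflection B') (on0 reflection B) A r (Fa (onHom reflection B' B) t))) =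
        Cmp2 sDMC B' (on0 (incl_twoftor DMC) A) (on0 (incl_twoftor DMC) A')
          (Fa (onHom (incl_twoftor DMC) A A') s)
          (Cmp2 sDMC B' B (on0 (incl_twoftor DMC) A) (Fa (id_ftor (Hom sDMC B A)) r) t)"
    if "t \<in> Arr (Hom sDMC B' B)" "r \<in> Arr (Hom DMC (on0 reflection B) A)" "s \<in> Arr (Hom DMC A A')"
    for t r s
  proof -
    have r: "r \<in> Arr (Hom sDMC B A)"
      using that(2) Hom_reflect[OF cells] by (simp add: reflection_def)
    show ?thesis
      using that r c2(1)[OF that(1) r] c2(2)[OF c2(1)[OF that(1) r], of s]
      by (simp add: reflection_def incl_twoftor_def incl_ftor_def)
  qed
qed

section \<open>Transport along isomorphisms of 2-categories\<close>

lemma comp_ftor_simps [simp]: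
  "x \<in> Obj C \<Longrightarrow> Fo (comp_ftor C G F) x = Fo G (Fo F x)"
  "f \<in> Arr C \<Longrightarrow> Fa (comp_ftor C G F) f = Fa G (Fa F f)"
  by (simp_all add: comp_ftor_def)

lemma cat_isoE:
  assumes "cat_iso C D F"
  obtains G where "is_functor C D F" "is_functor D C G" "cat_iso D C G"
    "\<And>x. x \<in> Obj C \<Longrightarrow> Fo G (Fo F x) = x" "\<And>f. f \<in> Arr C \<Longrightarrow> Fa G (Fa F f) = f"
    "\<And>x. x \<in> Obj D \<Longrightarrow> Fo F (Fo G x) = x" "\<And>f. f \<in> Arr D \<Longrightarrow> Fa F (Fa G f) = f"
proof -
  from assms obtain G where G: "is_functor C D F" "is_functor D C G"
    "comp_ftor C G F = id_ftor C" "comp_ftor D F G = id_ftor D"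
    by (auto simp: cat_iso_def)
  then have "cat_iso D C G" by (auto simp: cat_iso_def)
  moreover have "Fo G (Fo F x) = x" if "x \<in> Obj C" for x
    using comp_ftor_simps(1)[OF that, of G F] that by (simp add: G)
  moreover have "Fa G (Fa F f) = f" if "f \<in> Arr C" for f
    using comp_ftor_simps(2)[OF that, of G F] that by (simp add: G)
  moreover have "Fo F (Fo G x) = x" if "x \<in> Obj D" for x
    using comp_ftor_simps(1)[OF that, of F G] that by (simp add: G)
  moreover have "Fa F (Fa G f) = f" if "f \<in> Arr D" for f
    using comp_ftor_simps(2)[OF that, of F G] that by (simp add: G)
  ultimately show ?thesis using G that by blast
qed

lemma cat_isoI:
  assumes "category C" "category D" "is_functor C D F" "is_functor D C G"
    and "\<And>x. x \<in> Obj C \<Longrightarrow> Fo G (Fo F x) = x" "\<And>f. f \<in> Arr C \<Longrightarrow> Fa G (Fa F f) = f"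
    and "\<And>x. x \<in> Obj D \<Longrightarrow> Fo F (Fo G x) = x" "\<And>f. f \<in> Arr D \<Longrightarrow> Fa F (Fa G f) = f"
  shows "cat_iso C D F"
proof -
  have "comp_ftor C G F = id_ftor C"
    by (rule ftor_eqI[OF is_functor_comp is_functor_id]) (use assms in simp_all)
  moreover have "comp_ftor D F G = id_ftor D"
    by (rule ftor_eqI[OF is_functor_comp is_functor_id]) (use assms in simp_all)
  ultimately show ?thesis using assms(3,4) by (auto simp: cat_iso_def)
qed

lemma cat_iso_comp:
  assumes "category C" "category E" "cat_iso C D F" "cat_iso D E G"
  shows "cat_iso C E (comp_ftor C G F)"
proof -
  from assms(3) obtain F' where F: "is_functor C D F" "is_functor D C F'"
    "\<And>x. x \<in> Obj C \<Longrightarrow> Fo F' (Fo F x) = x" "\<And>f. f \<in> Arr C \<Longrightarrow> Fa F' (Fa F f) = f"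
    "\<And>x. x \<in> Obj D \<Longrightarrow> Fo F (Fo F' x) = x" "\<And>f. f \<in> Arr D \<Longrightarrow> Fa F (Fa F' f) = f"
    by (rule cat_isoE) blast
  from assms(4) obtain G' where G: "is_functor D E G" "is_functor E D G'"
    "\<And>x. x \<in> Obj D \<Longrightarrow> Fo G' (Fo G x) = x" "\<And>f. f \<in> Arr D \<Longrightarrow> Fa G' (Fa G f) = f"
    "\<And>x. x \<in> Obj E \<Longrightarrow> Fo G (Fo G' x) = x" "\<And>f. f \<in> Arr E \<Longrightarrow> Fa G (Fa G' f) = f"
    by (rule cat_isoE) blast
  interpret F: is_functor C D F by (rule F)
  interpret F': is_functor D C F' by (rule F)
  interpret G: is_functor D E G by (rule G)
  interpret G': is_functor E D G' by (rule G)
  show ?thesis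
    by (rule cat_isoI[where G = "comp_ftor E F' G'"])
      (use assms(1,2) F G in \<open>simp_all add: is_functor_comp\<close>)
qed

text \<open>Every object and arrow of \<open>D\<close> is an image under \<open>F\<close>, so each
  law of \<open>D\<close> is the image of a law of \<open>C\<close>. An isomorphism controls no
  values outside the domains, hence the separate hypotheses on default values.\<close>

lemma category_transport:
  assumes "category C" "cat_iso C D F"
    and "Dom D \<in> extensional (Arr D)" "Cod D \<in> extensional (Arr D)" "Idt D \<in> extensional (Obj D)"
    and "\<And>f g. \<not> (f \<in> Arr D \<and> g \<in> Arr D \<and> Dom D g = Cod D f) \<Longrightarrow> Cmp D g f = undefined"
  shows "category D"
proof -
  interpret C: category C by fact
  from assms(2) obtain G where FG: "is_functor C D F" "is_functor D C G"
    "\<And>x. x \<in> Obj C \<Longrightarrow> Fo G (Fo F x) = x" "\<And>f. f \<in> Arr C \<Longrightarrow> Fa G (Fa F f) = f"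
    "\<And>x. x \<in> Obj D \<Longrightarrow> Fo F (Fo G x) = x" "\<And>f. f \<in> Arr D \<Longrightarrow> Fa F (Fa G f) = f"
    by (rule cat_isoE) blast
  interpret F: is_functor C D F by (rule FG)
  interpret G: is_functor D C G by (rule FG)
  have obj: "\<exists>x0\<in>Obj C. x = Fo F x0" if "x \<in> Obj D" for x
    using that FG by (intro bexI[of _ "Fo G x"]) simp_all
  have arr: "\<exists>f0\<in>Arr C. f = Fa F f0" if "f \<in> Arr D" for f
    using that FG by (intro bexI[of _ "Fa G f"]) simp_all
  \<comment> \<open>Injectivity on objects reflects composability: arrows of \<open>C\<close> with
    composable images are composable.\<close>
  have obj_eq: "Fo F x = Fo F y \<longleftrightarrow> x = y" if "x \<in> Obj C" "y \<in> Obj C" for x y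
    using that FG(3) by metis
  note FF = F.Fa_Idt[symmetric] F.Fa_Cmp[symmetric]
  show ?thesis
  proof (rule category.intro)
    show "Dom D \<in> Arr D \<rightarrow>\<^sub>E Obj D" "Cod D \<in> Arr D \<rightarrow>\<^sub>E Obj D" "Idt D \<in> Obj D \<rightarrow>\<^sub>E Arr D"
      using assms(3-5) by (auto simp: PiE_iff dest!: obj arr simp del: F.Fa_Idt simp add: FF)
  qed (use assms(6) in \<open>auto dest!: arr obj simp: obj_eq FF C.Cmp_assoc simp del: F.Fa_Idt F.Fa_Cmp\<close>)
qed

definition comp_twoftor :: "('o, 'f, 't) twocat \<Rightarrow> ('p, 'g, 's, 'q, 'h, 'r) twoftor \<Rightarrow>
    ('o, 'f, 't, 'p, 'g, 's) twoftor \<Rightarrow> ('o, 'f, 't, 'q, 'h, 'r) twoftor" where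
  "comp_twoftor X N M = \<lparr> on0 = (\<lambda>a. on0 N (on0 M a)),
     onHom = (\<lambda>a b. comp_ftor (Hom X a b) (onHom N (on0 M a) (on0 M b)) (onHom M a b)) \<rparr>"

lemma is_two_functor_comp:
  assumes "two_category X" "is_two_functor X Y M" "is_two_functor Y Z N"
  shows "is_two_functor X Z (comp_twoftor X N M)"
proof -
  interpret X: two_category X by fact
  interpret M: is_two_functor X Y M by fact
  interpret N: is_two_functor Y Z N by fact
  note [simp] = M.on0_cell N.on0_cell
  have M: "Fo (onHom M a b) f \<in> Obj (Hom Y (on0 M a) (on0 M b))"
    if "a \<in> Cells0 X" "b \<in> Cells0 X" "f \<in> Obj (Hom X a b)" for a b f
    using is_functor.Fo_Obj[OF M.onHom_functor] that by simp
  have M': "Fa (onHom M a b) f \<in> Arr (Hom Y (on0 M a) (on0 M b))"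
    if "a \<in> Cells0 X" "b \<in> Cells0 X" "f \<in> Arr (Hom X a b)" for a b f
    using is_functor.Fa_Arr[OF M.onHom_functor] that by simp
  show ?thesis
  proof (rule is_two_functor.intro)
    show "is_functor (Hom X a b) (Hom Z (on0 (comp_twoftor X N M) a) (on0 (comp_twoftor X N M) b))
        (onHom (comp_twoftor X N M) a b)" if "a \<in> Cells0 X" "b \<in> Cells0 X" for a b
      using is_functor_comp[OF X.Hom_category M.onHom_functor N.onHom_functor, of a b] that
      by (simp add: comp_twoftor_def)
  qed (auto simp: comp_twoftor_def X.Unit_cell X.Cmp1_cell X.Cmp2_cell M.onHom_Unit N.onHom_Unit
      M.onHom_Cmp1 M.onHom_Cmp2 N.onHom_Cmp1 N.onHom_Cmp2 M M')
qed

text \<open>Only \<open>X\<close> is taken to be a 2-category. For \<open>Y\<close> this is the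
  conclusion of \<open>two_category_target\<close>, obtained from the isomorphism.\<close>

locale two_isomorphism = is_two_functor X Y K
  for X :: "('o, 'f, 't) twocat" and Y :: "('p, 'g, 's) twocat" and K +
  assumes iso: "twocat_iso X Y K" and X_two_category: "two_category X"
begin

sublocale X: two_category X by (rule X_two_category)

lemma cell: "y \<in> Cells0 Y \<Longrightarrow> \<exists>a\<in>Cells0 X. y = on0 K a"
  using iso by (auto simp: twocat_iso_def bij_betw_def)

lemma on0_eq [simp]: "a \<in> Cells0 X \<Longrightarrow> b \<in> Cells0 X \<Longrightarrow> on0 K a = on0 K b \<longleftrightarrow> a = b"
  using iso by (auto simp: twocat_iso_def bij_betw_def inj_on_def)

context
  fixes a b
  assumes ab [simp]: "a \<in> Cells0 X" "b \<in> Cells0 X"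
begin

lemma hom_iso: "cat_iso (Hom X a b) (Hom Y (on0 K a) (on0 K b)) (onHom K a b)"
  using iso by (auto simp: twocat_iso_def)

interpretation is_functor "Hom X a b" "Hom Y (on0 K a) (on0 K b)" "onHom K a b"
  by (rule onHom_functor) simp_all

lemmas Fo_cell [simp] = Fo_Obj
lemmas Fa_cell [simp] = Fa_Arr
lemmas Fa_Dom_hom = Fa_Dom
lemmas Fa_Cod_hom = Fa_Cod
lemmas Fa_Idt_hom = Fa_Idt
lemmas Fa_Cmp_hom = Fa_Cmp

lemma obj: "g \<in> Obj (Hom Y (on0 K a) (on0 K b)) \<Longrightarrow> \<exists>f\<in>Obj (Hom X a b). g = Fo (onHom K a b) f"
  using hom_iso by (rule cat_isoE) (metis is_functor.Fo_Obj)

lemma arr: "g \<in> Arr (Hom Y (on0 K a) (on0 K b)) \<Longrightarrow> \<exists>f\<in>Arr (Hom X a b). g = Fa (onHom K a b) f"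
  using hom_iso by (rule cat_isoE) (metis is_functor.Fa_Arr)

lemma Fo_eq: "f \<in> Obj (Hom X a b) \<Longrightarrow> g \<in> Obj (Hom X a b) \<Longrightarrow>
    Fo (onHom K a b) f = Fo (onHom K a b) g \<longleftrightarrow> f = g"
  using hom_iso by (rule cat_isoE) metis

end

text \<open>All cells of \<open>Y\<close> are images, so its laws are images of the laws of
  \<open>X\<close>. That each hom is a category is left as a hypothesis, because the default values
  in \<open>Y\<close> are not determined by \<open>K\<close>.\<close>

lemma two_category_target:
  assumes "\<And>a b. a \<in> Cells0 Y \<Longrightarrow> b \<in> Cells0 Y \<Longrightarrow> category (Hom Y a b)"
  shows "two_category Y"
proof (rule two_category.intro)
  fix y1 y2 y3 y4
  assume y: "y1 \<in> Cells0 Y" "y2 \<in> Cells0 Y" "y3 \<in> Cells0 Y" "y4 \<in> Cells0 Y"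
  from cell[OF y(1)] obtain a where a [simp]: "a \<in> Cells0 X" "y1 = on0 K a" by blast
  from cell[OF y(2)] obtain b where b [simp]: "b \<in> Cells0 X" "y2 = on0 K b" by blast
  from cell[OF y(3)] obtain c where c [simp]: "c \<in> Cells0 X" "y3 = on0 K c" by blast
  from cell[OF y(4)] obtain d where d [simp]: "d \<in> Cells0 X" "y4 = on0 K d" by blast
  \<comment> \<open>Read from right to left, the functor laws turn each operation of
    \<open>Y\<close> on images into the image of an operation of \<open>X\<close>.\<close>
  note K1 = onHom_Cmp1[symmetric] onHom_Cmp2[symmetric] onHom_Unit[symmetric]
    Fa_Idt_hom[symmetric] Fa_Cmp_hom[symmetric] Fa_Dom_hom Fa_Cod_hom Fo_eq
  interpret ab: category "Hom X a b" by (simp add: X.Hom_category)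
  interpret bc: category "Hom X b c" by (simp add: X.Hom_category)
  interpret ac: category "Hom X a c" by (simp add: X.Hom_category)
  note [simp] = X.Unit_cell X.Cmp1_cell X.Cmp2_cell X.Cmp1_Unit_right X.Cmp1_Unit_left
    X.Cmp2_Unit_right X.Cmp2_Unit_left X.Cmp2_Dom X.Cmp2_Cod X.Cmp2_Idt
  have [simp]: "Idt (Hom X x x) (Unit X x) \<in> Arr (Hom X x x)" if "x \<in> Cells0 X" for x
    using category.Idt_Arr[OF X.Hom_category X.Unit_cell] that by simp
  show "category (Hom Y y1 y2)" using y assms by blast
  show "Unit Y y1 \<in> Obj (Hom Y y1 y1)" by (simp add: K1)
  {
    fix f assume "f \<in> Obj (Hom Y y1 y2)"
    then obtain f0 where [simp]: "f0 \<in> Obj (Hom X a b)" "f = Fo (onHom K a b) f0"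
      using obj[of a b f] by auto
    show "Cmp1 Y y1 y1 y2 f (Unit Y y1) = f" "Cmp1 Y y1 y2 y2 (Unit Y y2) f = f"
      by (simp_all add: K1)
    fix g assume "g \<in> Obj (Hom Y y2 y3)"
    then obtain g0 where [simp]: "g0 \<in> Obj (Hom X b c)" "g = Fo (onHom K b c) g0"
      using obj[of b c g] by auto
    show "Cmp1 Y y1 y2 y3 g f \<in> Obj (Hom Y y1 y3)" by (simp add: K1)
    show "Cmp2 Y y1 y2 y3 (Idt (Hom Y y2 y3) g) (Idt (Hom Y y1 y2) f) =
        Idt (Hom Y y1 y3) (Cmp1 Y y1 y2 y3 g f)"
      by (simp add: K1)
    fix h assume "h \<in> Obj (Hom Y y3 y4)"
    then obtain h0 where [simp]: "h0 \<in> Obj (Hom X c d)" "h = Fo (onHom K c d) h0"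
      using obj[of c d h] by auto
    show "Cmp1 Y y1 y3 y4 h (Cmp1 Y y1 y2 y3 g f) = Cmp1 Y y1 y2 y4 (Cmp1 Y y2 y3 y4 h g) f"
      using X.Cmp1_assoc[of a b c d f0 g0 h0] by (simp add: K1)
  next
    fix s assume s: "s \<in> Arr (Hom Y y1 y2)"
    then obtain s0 where [simp]: "s0 \<in> Arr (Hom X a b)" "s = Fa (onHom K a b) s0"
      using arr[of a b s] by auto
    show "Cmp2 Y y1 y1 y2 s (Idt (Hom Y y1 y1) (Unit Y y1)) = s"
      "Cmp2 Y y1 y2 y2 (Idt (Hom Y y2 y2) (Unit Y y2)) s = s"
      by (simp_all add: K1)
    fix t assume "t \<in> Arr (Hom Y y2 y3)"
    then obtain t0 where [simp]: "t0 \<in> Arr (Hom X b c)" "t = Fa (onHom K b c) t0"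
      using arr[of b c t] by auto
    show "Cmp2 Y y1 y2 y3 t s \<in> Arr (Hom Y y1 y3)"
      "Dom (Hom Y y1 y3) (Cmp2 Y y1 y2 y3 t s) =
        Cmp1 Y y1 y2 y3 (Dom (Hom Y y2 y3) t) (Dom (Hom Y y1 y2) s)"
      "Cod (Hom Y y1 y3) (Cmp2 Y y1 y2 y3 t s) =
        Cmp1 Y y1 y2 y3 (Cod (Hom Y y2 y3) t) (Cod (Hom Y y1 y2) s)"
      by (simp_all add: K1)
    {
      fix r assume "r \<in> Arr (Hom Y y3 y4)"
      then obtain r0 where [simp]: "r0 \<in> Arr (Hom X c d)" "r = Fa (onHom K c d) r0"
        using arr[of c d r] by auto
      show "Cmp2 Y y1 y3 y4 r (Cmp2 Y y1 y2 y3 t s) = Cmp2 Y y1 y2 y4 (Cmp2 Y y2 y3 y4 r t) s"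
        using X.Cmp2_assoc[of a b c d s0 t0 r0] by (simp add: K1)
    }
    fix s' assume s': "s' \<in> Arr (Hom Y y1 y2)" "Dom (Hom Y y1 y2) s' = Cod (Hom Y y1 y2) s"
    then obtain s0' where [simp]: "s0' \<in> Arr (Hom X a b)" "s' = Fa (onHom K a b) s0'"
      using arr[of a b s'] by auto
    fix t' assume t': "t' \<in> Arr (Hom Y y2 y3)" "Dom (Hom Y y2 y3) t' = Cod (Hom Y y2 y3) t"
    then obtain t0' where [simp]: "t0' \<in> Arr (Hom X b c)" "t' = Fa (onHom K b c) t0'"
      using arr[of b c t'] by auto
    \<comment> \<open>Interchange in \<open>X\<close> needs composable 2-cells there; composability
      comes back from \<open>Y\<close> by injectivity of \<open>K\<close> on 1-cells.\<close>
    have [simp]: "Dom (Hom X a b) s0' = Cod (Hom X a b) s0" "Dom (Hom X b c) t0' = Cod (Hom X b c) t0"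
      using s'(2) t'(2) by (simp_all add: K1)
    show "Cmp2 Y y1 y2 y3 (Cmp (Hom Y y2 y3) t' t) (Cmp (Hom Y y1 y2) s' s) =
        Cmp (Hom Y y1 y3) (Cmp2 Y y1 y2 y3 t' s') (Cmp2 Y y1 y2 y3 t s)"
      using X.interchange[of a b c s0 s0' t0 t0'] by (simp add: K1)
  }
qed

lemma inverse:
  obtains J where "is_two_functor Y X J"
    "\<And>a. a \<in> Cells0 X \<Longrightarrow> on0 J (on0 K a) = a"
    "\<And>a b f. a \<in> Cells0 X \<Longrightarrow> b \<in> Cells0 X \<Longrightarrow> f \<in> Obj (Hom X a b) \<Longrightarrow>
       Fo (onHom J (on0 K a) (on0 K b)) (Fo (onHom K a b) f) = f"
    "\<And>a b s. a \<in> Cells0 X \<Longrightarrow> b \<in> Cells0 X \<Longrightarrow> s \<in> Arr (Hom X a b) \<Longrightarrow>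
       Fa (onHom J (on0 K a) (on0 K b)) (Fa (onHom K a b) s) = s"
    "\<And>a b. a \<in> Cells0 X \<Longrightarrow> b \<in> Cells0 X \<Longrightarrow>
       cat_iso (Hom Y (on0 K a) (on0 K b)) (Hom X a b) (onHom J (on0 K a) (on0 K b))"
proof -
  define I where "I = inv_into (Cells0 X) (on0 K)"
  \<comment> \<open>\<open>cat_iso\<close> merely asserts that an inverse exists, so the hom
    functors of \<open>J\<close> have to be chosen. \<open>P\<close> records everything the choice
    must satisfy.\<close>
  define P where "P a b G \<longleftrightarrow> is_functor (Hom Y (on0 K a) (on0 K b)) (Hom X a b) G \<and>
    cat_iso (Hom Y (on0 K a) (on0 K b)) (Hom X a b) G \<and>
    (\<forall>f\<in>Obj (Hom X a b). Fo G (Fo (onHom K a b) f) = f) \<and>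
    (\<forall>s\<in>Arr (Hom X a b). Fa G (Fa (onHom K a b) s) = s)" for a b G
  define J where "J = \<lparr> on0 = I, onHom = (\<lambda>y z. SOME G. P (I y) (I z) G) \<rparr>"
  have I [simp]: "on0 J (on0 K a) = a" if "a \<in> Cells0 X" for a
    using that iso by (simp add: J_def I_def twocat_iso_def bij_betw_def)
  have PJ: "P a b (onHom J (on0 K a) (on0 K b))" if "a \<in> Cells0 X" "b \<in> Cells0 X" for a b
  proof -
    have "\<exists>G. P a b G"
      using hom_iso[OF that] unfolding P_def by (rule cat_isoE) blast
    moreover have "onHom J (on0 K a) (on0 K b) = (SOME G. P a b G)"
      using I[OF that(1)] I[OF that(2)] by (simp add: J_def)
    ultimately show ?thesis by (simp add: someI_ex)
  qed
  have J0: "Fo (onHom J (on0 K a) (on0 K b)) (Fo (onHom K a b) f) = f"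
    if "a \<in> Cells0 X" "b \<in> Cells0 X" "f \<in> Obj (Hom X a b)" for a b f
    using PJ[OF that(1,2)] that(3) by (simp add: P_def)
  have J1: "Fa (onHom J (on0 K a) (on0 K b)) (Fa (onHom K a b) f) = f"
    if "a \<in> Cells0 X" "b \<in> Cells0 X" "f \<in> Arr (Hom X a b)" for a b f
    using PJ[OF that(1,2)] that(3) by (simp add: P_def)
  have J: "is_two_functor Y X J"
  proof (rule is_two_functor.intro)
    fix y1 y2 y3
    assume y: "y1 \<in> Cells0 Y" "y2 \<in> Cells0 Y" "y3 \<in> Cells0 Y"
    from cell[OF y(1)] obtain a where a [simp]: "a \<in> Cells0 X" "y1 = on0 K a" by blast
    from cell[OF y(2)] obtain b where b [simp]: "b \<in> Cells0 X" "y2 = on0 K b" by blast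
    from cell[OF y(3)] obtain c where c [simp]: "c \<in> Cells0 X" "y3 = on0 K c" by blast
    note K1 = onHom_Cmp1[symmetric] onHom_Cmp2[symmetric] onHom_Unit[symmetric] J0 J1
    note [simp] = X.Unit_cell X.Cmp1_cell X.Cmp2_cell
    show "on0 J y1 \<in> Cells0 X" by simp
    show "is_functor (Hom Y y1 y2) (Hom X (on0 J y1) (on0 J y2)) (onHom J y1 y2)"
      using PJ[of a b] by (simp add: P_def)
    show "Fo (onHom J y1 y1) (Unit Y y1) = Unit X (on0 J y1)" by (simp add: K1)
    show "Fo (onHom J y1 y3) (Cmp1 Y y1 y2 y3 g f) =
        Cmp1 X (on0 J y1) (on0 J y2) (on0 J y3) (Fo (onHom J y2 y3) g) (Fo (onHom J y1 y2) f)"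
      if "f \<in> Obj (Hom Y y1 y2)" "g \<in> Obj (Hom Y y2 y3)" for f g
      using obj[of a b f] obj[of b c g] that by (auto simp: K1)
    show "Fa (onHom J y1 y3) (Cmp2 Y y1 y2 y3 g f) =
        Cmp2 X (on0 J y1) (on0 J y2) (on0 J y3) (Fa (onHom J y2 y3) g) (Fa (onHom J y1 y2) f)"
      if "f \<in> Arr (Hom Y y1 y2)" "g \<in> Arr (Hom Y y2 y3)" for f g
      using arr[of a b f] arr[of b c g] that by (auto simp: K1)
  qed
  show ?thesis
    using that[of J] J J0 J1 PJ I by (auto simp: P_def)
qed

end

lemma full_sub_twocat_simps [simp]:
  "a \<in> Cells0 (full_sub_twocat X P) \<longleftrightarrow> a \<in> Cells0 X \<and> P a"
  "Hom (full_sub_twocat X P) = Hom X" "Unit (full_sub_twocat X P) = Unit X"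
  "Cmp1 (full_sub_twocat X P) = Cmp1 X" "Cmp2 (full_sub_twocat X P) = Cmp2 X"
  by (simp_all add: full_sub_twocat_def)

lemma twocat_iso_full_sub:
  assumes "twocat_iso X Y K" and PQ: "\<And>a. a \<in> Cells0 X \<Longrightarrow> P a \<longleftrightarrow> Q (on0 K a)"
  shows "twocat_iso (full_sub_twocat X P) (full_sub_twocat Y Q) K"
proof -
  from assms(1) have K: "is_two_functor X Y K" and bij: "bij_betw (on0 K) (Cells0 X) (Cells0 Y)"
    and iso: "\<And>a b. a \<in> Cells0 X \<Longrightarrow> b \<in> Cells0 X \<Longrightarrow>
      cat_iso (Hom X a b) (Hom Y (on0 K a) (on0 K b)) (onHom K a b)"
    by (auto simp: twocat_iso_def)
  interpret K: is_two_functor X Y K by (rule K)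
  have "is_two_functor (full_sub_twocat X P) (full_sub_twocat Y Q) K"
    by (rule is_two_functor.intro)
      (simp_all add: PQ[symmetric] K.on0_cell K.onHom_functor K.onHom_Unit K.onHom_Cmp1 K.onHom_Cmp2)
  moreover have "bij_betw (on0 K) (Cells0 (full_sub_twocat X P)) (Cells0 (full_sub_twocat Y Q))"
  proof (rule bij_betw_subset[OF bij])
    have "\<exists>a\<in>Cells0 X. y = on0 K a" if "y \<in> Cells0 Y" for y
      using bij that by (auto simp: bij_betw_def)
    then show "on0 K ` Cells0 (full_sub_twocat X P) = Cells0 (full_sub_twocat Y Q)"
      using PQ K.on0_cell by (auto simp: full_sub_twocat_def)
  qed (auto simp: full_sub_twocat_def)
  ultimately show ?thesis using iso by (simp add: twocat_iso_def)
qed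

text \<open>The transported left adjoint is \<open>L\<close> conjugated by the two isomorphisms, and
  its naturality is the image under \<open>K\<close> of naturality of \<phi>. That \<open>U'\<close>
  corresponds to \<open>U\<close> is stated cell by cell because 2-functor records may take
  arbitrary values outside their domain, so an equation of records would be too strong.\<close>

lemma has_left_two_adjoint_transport:
  fixes U :: "('o, 'f, 't, 'p, 'g, 's) twoftor" and U' :: "('oo, 'ff, 'tt, 'pp, 'gg, 'ss) twoftor"
  assumes "left_two_adjoint X Y U L \<phi>" "twocat_iso X X' H" "twocat_iso Y Y' K"
    and X': "two_category X'" and Y': "two_category Y'" and U': "is_two_functor X' Y' U'"
    and on0: "\<And>a. a \<in> Cells0 X \<Longrightarrow> on0 U' (on0 H a) = on0 K (on0 U a)"
    and onFo: "\<And>a b f. a \<in> Cells0 X \<Longrightarrow> b \<in> Cells0 X \<Longrightarrow> f \<in> Obj (Hom X a b) \<Longrightarrow>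
      Fo (onHom U' (on0 H a) (on0 H b)) (Fo (onHom H a b) f) =
      Fo (onHom K (on0 U a) (on0 U b)) (Fo (onHom U a b) f)"
    and onFa: "\<And>a b s. a \<in> Cells0 X \<Longrightarrow> b \<in> Cells0 X \<Longrightarrow> s \<in> Arr (Hom X a b) \<Longrightarrow>
      Fa (onHom U' (on0 H a) (on0 H b)) (Fa (onHom H a b) s) =
      Fa (onHom K (on0 U a) (on0 U b)) (Fa (onHom U a b) s)"
  shows "has_left_two_adjoint X' Y' U'"
proof -
  interpret A: left_two_adjoint X Y U L \<phi> by fact
  interpret X': two_category X' by fact
  interpret Y': two_category Y' by fact
  interpret X: two_category X by (rule A.X_two_category)
  interpret Y: two_category Y by (rule A.Y_two_category)
  interpret U: is_two_functor X Y U by (rule A.U_two_functor)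
  interpret L: is_two_functor Y X L by (rule A.L_two_functor)
  interpret H: two_isomorphism X X' H
    using assms(2) X.two_category_axioms
    by (auto intro!: two_isomorphism.intro simp: twocat_iso_def two_isomorphism_axioms_def)
  interpret K: two_isomorphism Y Y' K
    using assms(3) Y.two_category_axioms
    by (auto intro!: two_isomorphism.intro simp: twocat_iso_def two_isomorphism_axioms_def)
  obtain I where I: "is_two_functor X' X I" "\<And>a. a \<in> Cells0 X \<Longrightarrow> on0 I (on0 H a) = a"
    "\<And>a b f. a \<in> Cells0 X \<Longrightarrow> b \<in> Cells0 X \<Longrightarrow> f \<in> Obj (Hom X a b) \<Longrightarrow>
       Fo (onHom I (on0 H a) (on0 H b)) (Fo (onHom H a b) f) = f"
    "\<And>a b s. a \<in> Cells0 X \<Longrightarrow> b \<in> Cells0 X \<Longrightarrow> s \<in> Arr (Hom X a b) \<Longrightarrow>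
       Fa (onHom I (on0 H a) (on0 H b)) (Fa (onHom H a b) s) = s"
    "\<And>a b. a \<in> Cells0 X \<Longrightarrow> b \<in> Cells0 X \<Longrightarrow>
       cat_iso (Hom X' (on0 H a) (on0 H b)) (Hom X a b) (onHom I (on0 H a) (on0 H b))"
    by (rule H.inverse) blast
  obtain J where J: "is_two_functor Y' Y J" "\<And>a. a \<in> Cells0 Y \<Longrightarrow> on0 J (on0 K a) = a"
    "\<And>a b f. a \<in> Cells0 Y \<Longrightarrow> b \<in> Cells0 Y \<Longrightarrow> f \<in> Obj (Hom Y a b) \<Longrightarrow>
       Fo (onHom J (on0 K a) (on0 K b)) (Fo (onHom K a b) f) = f"
    "\<And>a b s. a \<in> Cells0 Y \<Longrightarrow> b \<in> Cells0 Y \<Longrightarrow> s \<in> Arr (Hom Y a b) \<Longrightarrow>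
       Fa (onHom J (on0 K a) (on0 K b)) (Fa (onHom K a b) s) = s"
    by (rule K.inverse) blast
  define M where "M = comp_twoftor Y' H (comp_twoftor Y' L J)"
  \<comment> \<open>Undo \<open>H\<close>, apply \<phi>, then apply \<open>K\<close>: the
    intermediate hom-categories are \<open>Hom X (on0 L (on0 J y)) (on0 I x)\<close> and
    \<open>Hom Y (on0 J y) (on0 U (on0 I x))\<close>.\<close>
  define \<psi> where "\<psi> y x = comp_ftor (Hom X' (on0 M y) x) (onHom K (on0 J y) (on0 U (on0 I x)))
    (comp_ftor (Hom X' (on0 M y) x) (\<phi> (on0 J y) (on0 I x)) (onHom I (on0 M y) x))" for y x
  note [simp] = L.on0_cell U.on0_cell H.on0_cell K.on0_cell I(2-4) J(2-4)
  have M: "is_two_functor Y' X' M"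
    unfolding M_def
    by (rule is_two_functor_comp[OF Y' is_two_functor_comp[OF Y' J(1) L.is_two_functor_axioms]
          H.is_two_functor_axioms])
  \<comment> \<open>All cells of \<open>X'\<close> and \<open>Y'\<close> are images, so it is enough
    to know \<open>M\<close> and \<psi> on images, where the chosen inverses cancel.\<close>
  have M0: "on0 M (on0 K b) = on0 H (on0 L b)" if "b \<in> Cells0 Y" for b
    using that by (simp add: M_def comp_twoftor_def)
  have Mo: "Fo (onHom M (on0 K b) (on0 K c)) (Fo (onHom K b c) g) =
      Fo (onHom H (on0 L b) (on0 L c)) (Fo (onHom L b c) g)"
    if "b \<in> Cells0 Y" "c \<in> Cells0 Y" "g \<in> Obj (Hom Y b c)" for b c g
    using that by (simp add: M_def comp_twoftor_def)
  have Ma: "Fa (onHom M (on0 K b) (on0 K c)) (Fa (onHom K b c) g) =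
      Fa (onHom H (on0 L b) (on0 L c)) (Fa (onHom L b c) g)"
    if "b \<in> Cells0 Y" "c \<in> Cells0 Y" "g \<in> Arr (Hom Y b c)" for b c g
    using that by (simp add: M_def comp_twoftor_def)
  have \<psi>o: "Fo (\<psi> (on0 K b) (on0 H a)) (Fo (onHom H (on0 L b) a) h) =
      Fo (onHom K b (on0 U a)) (Fo (\<phi> b a) h)"
    if "b \<in> Cells0 Y" "a \<in> Cells0 X" "h \<in> Obj (Hom X (on0 L b) a)" for b a h
    using that by (simp add: \<psi>_def M0)
  have \<psi>a: "Fa (\<psi> (on0 K b) (on0 H a)) (Fa (onHom H (on0 L b) a) h) =
      Fa (onHom K b (on0 U a)) (Fa (\<phi> b a) h)"
    if "b \<in> Cells0 Y" "a \<in> Cells0 X" "h \<in> Arr (Hom X (on0 L b) a)" for b a h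
    using that by (simp add: \<psi>_def M0)
  have \<phi>: "is_functor (Hom X (on0 L b) a) (Hom Y b (on0 U a)) (\<phi> b a)"
    if "b \<in> Cells0 Y" "a \<in> Cells0 X" for b a
    using A.hom_iso[OF that] by (simp add: cat_iso_def)
  note [simp] = is_functor.Fo_Obj[OF \<phi>] is_functor.Fa_Arr[OF \<phi>] is_functor.Fo_Obj[OF L.onHom_functor]
    is_functor.Fa_Arr[OF L.onHom_functor] is_functor.Fo_Obj[OF U.onHom_functor]
    is_functor.Fa_Arr[OF U.onHom_functor] X.Cmp1_cell X.Cmp2_cell Y.Cmp1_cell Y.Cmp2_cell
  have "left_two_adjoint X' Y' U' M \<psi>"
  proof (rule left_two_adjoint.intro)
    fix y y' x x'
    assume cells: "y \<in> Cells0 Y'" "x \<in> Cells0 X'"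
    from K.cell[OF cells(1)] obtain b where b [simp]: "b \<in> Cells0 Y" "y = on0 K b" by blast
    from H.cell[OF cells(2)] obtain a where a [simp]: "a \<in> Cells0 X" "x = on0 H a" by blast
    have "cat_iso (Hom X' (on0 M y) x) (Hom Y' y (on0 U' x))
      (comp_ftor (Hom X' (on0 M y) x) (onHom K b (on0 U a))
        (comp_ftor (Hom X' (on0 M y) x) (\<phi> b a) (onHom I (on0 M y) x)))"
    proof (rule cat_iso_comp)
      show "category (Hom X' (on0 M y) x)" by (rule X'.Hom_category) (simp_all add: M0)
      show "category (Hom Y' y (on0 U' x))" by (rule Y'.Hom_category) (simp_all add: on0)
      show "cat_iso (Hom X' (on0 M y) x) (Hom Y b (on0 U a))
        (comp_ftor (Hom X' (on0 M y) x) (\<phi> b a) (onHom I (on0 M y) x))"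
        by (rule cat_iso_comp[OF X'.Hom_category Y.Hom_category _ A.hom_iso])
          (simp_all add: M0 I(5))
      show "cat_iso (Hom Y b (on0 U a)) (Hom Y' y (on0 U' x)) (onHom K b (on0 U a))"
        using K.hom_iso[of b "on0 U a"] by (simp add: on0)
    qed
    then show "cat_iso (Hom X' (on0 M y) x) (Hom Y' y (on0 U' x)) (\<psi> y x)"
      by (simp add: \<psi>_def)
    assume cells': "y' \<in> Cells0 Y'" "x' \<in> Cells0 X'"
    from K.cell[OF cells'(1)] obtain b' where b' [simp]: "b' \<in> Cells0 Y" "y' = on0 K b'" by blast
    from H.cell[OF cells'(2)] obtain a' where a' [simp]: "a' \<in> Cells0 X" "x' = on0 H a'" by blast
    note Cmp = H.onHom_Cmp1[symmetric] H.onHom_Cmp2[symmetric] K.onHom_Cmp1[symmetric]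
      K.onHom_Cmp2[symmetric]
    show "Fo (\<psi> y' x') (Cmp1 X' (on0 M y') x x' f (Cmp1 X' (on0 M y') (on0 M y) x h
          (Fo (onHom M y' y) g))) =
        Cmp1 Y' y' (on0 U' x) (on0 U' x') (Fo (onHom U' x x') f)
          (Cmp1 Y' y' y (on0 U' x) (Fo (\<psi> y x) h) g)"
      if mem: "g \<in> Obj (Hom Y' y' y)" "h \<in> Obj (Hom X' (on0 M y) x)" "f \<in> Obj (Hom X' x x')" for g h f
    proof -
      obtain g0 h0 f0 where [simp]: "g0 \<in> Obj (Hom Y b' b)" "g = Fo (onHom K b' b) g0"
        "h0 \<in> Obj (Hom X (on0 L b) a)" "h = Fo (onHom H (on0 L b) a) h0"
        "f0 \<in> Obj (Hom X a a')" "f = Fo (onHom H a a') f0"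
        using K.obj[of b' b g] H.obj[of "on0 L b" a h] H.obj[of a a' f] mem by (auto simp: M0)
      show ?thesis
        using A.natural1[of b b' a a' g0 h0 f0] by (simp add: M0 Mo Cmp \<psi>o on0 onFo)
    qed
    show "Fa (\<psi> y' x') (Cmp2 X' (on0 M y') x x' f (Cmp2 X' (on0 M y') (on0 M y) x h
          (Fa (onHom M y' y) g))) =
        Cmp2 Y' y' (on0 U' x) (on0 U' x') (Fa (onHom U' x x') f)
          (Cmp2 Y' y' y (on0 U' x) (Fa (\<psi> y x) h) g)"
      if mem: "g \<in> Arr (Hom Y' y' y)" "h \<in> Arr (Hom X' (on0 M y) x)" "f \<in> Arr (Hom X' x x')" for g h f
    proof -
      obtain g0 h0 f0 where [simp]: "g0 \<in> Arr (Hom Y b' b)" "g = Fa (onHom K b' b) g0"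
        "h0 \<in> Arr (Hom X (on0 L b) a)" "h = Fa (onHom H (on0 L b) a) h0"
        "f0 \<in> Arr (Hom X a a')" "f = Fa (onHom H a a') f0"
        using K.arr[of b' b g] H.arr[of "on0 L b" a h] H.arr[of a a' f] mem by (auto simp: M0)
      show ?thesis
        using A.natural2[of b b' a a' g0 h0 f0] by (simp add: M0 Ma Cmp \<psi>a on0 onFa)
    qed
  qed (fact M U' X' Y')+
  then show ?thesis by (auto simp: has_left_two_adjoint_def)
qed

section \<open>Display map categories as comprehension categories\<close>

lemma comp_ftor_eqI:
  assumes "\<And>x. x \<in> Obj C \<Longrightarrow> Fo G (Fo F x) = Fo G' (Fo F' x)"
    and "\<And>f. f \<in> Arr C \<Longrightarrow> Fa G (Fa F f) = Fa G' (Fa F' f)"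
  shows "comp_ftor C G F = comp_ftor C G' F'"
  using assms by (simp add: comp_ftor_def cong: restrict_cong)

text \<open>By fullness only objects have to be tested; the arrows between them belong to the
  subcategory automatically.\<close>

lemma is_functor_into_full_subcat:
  assumes "category C" "is_functor C D F" "\<And>x. x \<in> Obj C \<Longrightarrow> Fo F x \<in> X"
  shows "is_functor C (full_subcat D X) F"
proof -
  interpret C: category C by fact
  interpret F: is_functor C D F by fact
  show ?thesis
    using assms(3) F.Fo_extensional F.Fa_extensional
    by unfold_locales (auto simp: full_subcat_def Let_def PiE_iff)
qed

lemma is_functor_full_subcat:
  "category C \<Longrightarrow> is_functor (full_subcat C X) C (incl_ftor (full_subcat C X))"
  by (rule is_functor_incl_ftor[OF category_full_subcat]) (auto simp: full_subcat_def Let_def)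

lemma is_functor_cod_ftor: "category C \<Longrightarrow> is_functor (arrow_cat C) C (cod_ftor C)"
proof -
  assume "category C"
  then interpret category C .
  interpret A: category "arrow_cat C" by (rule category_arrow_cat) fact
  show ?thesis
  proof
    show "Fa (cod_ftor C) (Cmp (arrow_cat C) g f) = Cmp C (Fa (cod_ftor C) g) (Fa (cod_ftor C) f)"
      if "f \<in> Arr (arrow_cat C)" "g \<in> Arr (arrow_cat C)" "Dom (arrow_cat C) g = Cod (arrow_cat C) f"
      for f g
      using that A.Cmp_Arr[OF that] by (simp add: cod_ftor_def del: Square_in_squares)
  qed (auto simp: cod_ftor_def squares_iff)
qed

text \<open>Each lift factors through the other by a vertical map, and uniqueness of factorizations
  makes the two vertical maps inverse to each other.\<close>

lemma cartesian_unique: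
  assumes "category T" "category C" "is_functor T C p" "cartesian T C p \<phi>" "cartesian T C p \<psi>"
    and "Cod T \<phi> = Cod T \<psi>" "Fa p \<phi> = Fa p \<psi>"
  obtains h where "is_iso T h" "Dom T h = Dom T \<phi>" "Cod T h = Dom T \<psi>" "Cmp T \<psi> h = \<phi>"
proof -
  interpret T: category T by fact
  interpret C: category C by fact
  interpret p: is_functor T C p by fact
  \<comment> \<open>The universal property of \<alpha> taken at an identity: a map over the same
    arrow with the same target factors uniquely through \<alpha> by a vertical map.\<close>
  have lift: "\<exists>!h. h \<in> Arr T \<and> Dom T h = Dom T \<beta> \<and> Cod T h = Dom T \<alpha> \<and> Cmp T \<alpha> h = \<beta>
      \<and> Fa p h = Idt C (Fo p (Dom T \<alpha>))"
    if "cartesian T C p \<alpha>" "\<beta> \<in> Arr T" "Cod T \<beta> = Cod T \<alpha>" "Fa p \<beta> = Fa p \<alpha>" for \<alpha> \<beta>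
  proof -
    have a: "\<alpha> \<in> Arr T" using that(1) by (simp add: cartesian_def)
    have "Fo p (Dom T \<beta>) = Fo p (Dom T \<alpha>)"
      using that(2,4) a p.Fa_Dom[of \<alpha>] p.Fa_Dom[of \<beta>] by simp
    moreover have "Cmp C (Fa p \<alpha>) (Idt C (Fo p (Dom T \<alpha>))) = Fa p \<alpha>"
      using a C.Cmp_Idt_right[of "Fa p \<alpha>"] by simp
    ultimately show ?thesis
      using that(1)[unfolded cartesian_def, THEN conjunct2, rule_format, of \<beta> "Idt C (Fo p (Dom T \<alpha>))"]
        that a by simp
  qed
  have arr: "\<phi> \<in> Arr T" "\<psi> \<in> Arr T" using assms(4,5) by (simp_all add: cartesian_def)
  have Fo: "Fo p (Dom T \<phi>) = Fo p (Dom T \<psi>)"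
    using arr assms(7) p.Fa_Dom[of \<phi>] p.Fa_Dom[of \<psi>] by simp
  obtain h where h: "h \<in> Arr T" "Dom T h = Dom T \<phi>" "Cod T h = Dom T \<psi>" "Cmp T \<psi> h = \<phi>"
    "Fa p h = Idt C (Fo p (Dom T \<psi>))"
    using lift[OF assms(5) arr(1) assms(6,7)] by blast
  obtain k where k: "k \<in> Arr T" "Dom T k = Dom T \<psi>" "Cod T k = Dom T \<phi>" "Cmp T \<phi> k = \<psi>"
    "Fa p k = Idt C (Fo p (Dom T \<phi>))"
    using lift[OF assms(4) arr(2) assms(6)[symmetric] assms(7)[symmetric]] by blast
  have idt: "Cmp C (Idt C x) (Idt C x) = Idt C x" if "x \<in> Obj C" for x
    using that C.Cmp_Idt_left[of "Idt C x"] by simp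
  have kh: "Cmp T k h = Idt T (Dom T \<phi>)"
  proof (rule ex1E[OF lift[OF assms(4) arr(1) refl refl]])
    fix m assume m: "\<forall>y. y \<in> Arr T \<and> Dom T y = Dom T \<phi> \<and> Cod T y = Dom T \<phi> \<and> Cmp T \<phi> y = \<phi>
      \<and> Fa p y = Idt C (Fo p (Dom T \<phi>)) \<longrightarrow> y = m"
    have "Cmp T k h = m" using m h k arr Fo by (simp add: T.Cmp_assoc idt)
    moreover have "Idt T (Dom T \<phi>) = m" using m arr by simp
    ultimately show ?thesis by simp
  qed
  have hk: "Cmp T h k = Idt T (Dom T \<psi>)"
  proof (rule ex1E[OF lift[OF assms(5) arr(2) refl refl]])
    fix m assume m: "\<forall>y. y \<in> Arr T \<and> Dom T y = Dom T \<psi> \<and> Cod T y = Dom T \<psi> \<and> Cmp T \<psi> y = \<psi>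
      \<and> Fa p y = Idt C (Fo p (Dom T \<psi>)) \<longrightarrow> y = m"
    have "Cmp T h k = m" using m h k arr Fo by (simp add: T.Cmp_assoc idt)
    moreover have "Idt T (Dom T \<psi>) = m" using m arr by simp
    ultimately show ?thesis by simp
  qed
  have "is_iso T h"
    unfolding is_iso_def using h k kh hk by (intro conjI bexI[of _ k]) simp_all
  then show ?thesis using h that by blast
qed

section \<open>The comprehension category of a display structure and its cartesian maps\<close>

lemma disp_total_simps [simp]:
  "Obj (disp_total A) = Arr (fst A) \<inter> snd A"
  "Arr (disp_total A) = {s \<in> squares (fst A). sq_src s \<in> snd A \<and> sq_tgt s \<in> snd A}"
  "s \<in> Arr (disp_total A) \<Longrightarrow> Dom (disp_total A) s = sq_src s"
  "s \<in> Arr (disp_total A) \<Longrightarrow> Cod (disp_total A) s = sq_tgt s"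
  "d \<in> Obj (disp_total A) \<Longrightarrow> Idt (disp_total A) d = Idt (arrow_cat (fst A)) d"
  "s \<in> Arr (disp_total A) \<Longrightarrow> t \<in> Arr (disp_total A) \<Longrightarrow> sq_src t = sq_tgt s \<Longrightarrow>
     Cmp (disp_total A) t s = Cmp (arrow_cat (fst A)) t s"
  by (auto simp: disp_total_def full_subcat_def Let_def)

lemma disp_ccat_simps [simp]:
  "base (disp_ccat A) = fst A" "total (disp_ccat A) = disp_total A"
  "compr (disp_ccat A) = incl_ftor (disp_total A)"
  by (simp_all add: disp_ccat_def)

abbreviation disp_proj :: "('o, 'a) sdmcat \<Rightarrow> ('a, 'a square, 'o, 'a) ftor" where
  "disp_proj A \<equiv> proj (disp_ccat A)"

lemma disp_proj_simps [simp]: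
  "d \<in> Obj (disp_total A) \<Longrightarrow> Fo (disp_proj A) d = Cod (fst A) d"
  "s \<in> Arr (disp_total A) \<Longrightarrow> Fa (disp_proj A) s = sq_bot s"
  by (auto simp: disp_ccat_def cod_ftor_def)

locale disp_category = category "fst A"
  for A :: "('o, 'a) sdmcat" +
  assumes disp: "display_structure (fst A) (snd A)"
begin

abbreviation "C \<equiv> fst A"
abbreviation "D \<equiv> snd A"
abbreviation "T \<equiv> disp_total A"

lemma D_Arr [simp]: "d \<in> D \<Longrightarrow> d \<in> Arr C"
  using disp by (auto simp: display_structure_def)

lemma Obj_T: "Obj T = D"
  by auto

sublocale arrow: category "arrow_cat C"
  by (rule category_arrow_cat) (rule category_axioms)

sublocale T: category T
  unfolding disp_total_def by (rule category_full_subcat) (rule arrow.category_axioms)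

sublocale T_incl: is_functor T "arrow_cat C" "incl_ftor T"
  unfolding disp_total_def by (rule is_functor_full_subcat) (rule arrow.category_axioms)

sublocale T_proj: is_functor T C "disp_proj A"
  unfolding disp_ccat_def
  using is_functor_comp[OF T.category_axioms T_incl.is_functor_axioms
      is_functor_cod_ftor[OF category_axioms]] by simp

lemma display_pullback:
  assumes "d \<in> D" "f \<in> Arr C" "Cod C f = Cod C d"
  obtains q where "pullback_square C q" "q \<in> Arr T" "sq_tgt q = d" "sq_bot q = f"
proof -
  from assms disp obtain d' u where "d' \<in> D" "pullback_square C (Square d' d u f)"
    unfolding display_structure_def by blast
  then show ?thesis
    using that[of "Square d' d u f"] assms(1) pullback_square_in_squares
    by (fastforce simp del: Square_in_squares)
qed

text \<open>A factorization of \<psi> through \<open>s\<close> over \<open>g\<close> is a square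
  with bottom \<open>g\<close>. Its top is the mediating map for the cone given by
  \<open>sq_top \<psi>\<close> and by \<open>g\<close> after \<open>sq_src \<psi>\<close>; fullness
  of the total category adds no further condition.\<close>

lemma pullback_cartesian:
  assumes "pullback_square C s" "s \<in> Arr T"
  shows "cartesian T C (disp_proj A) s"
proof -
  have "\<exists>!h. h \<in> Arr T \<and> Dom T h = Dom T \<psi> \<and> Cod T h = Dom T s \<and> Cmp T s h = \<psi>
      \<and> Fa (disp_proj A) h = g"
    if \<psi>: "\<psi> \<in> Arr T" and g: "g \<in> Arr C" and eq: "Cod T \<psi> = Cod T s"
      "Dom C g = Fo (disp_proj A) (Dom T \<psi>)" "Cod C g = Fo (disp_proj A) (Dom T s)"
      "Cmp C (Fa (disp_proj A) s) g = Fa (disp_proj A) \<psi>" for \<psi> g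
  proof -
    obtain d e u v where s: "s = Square d e u v" by (cases s)
    obtain c e' w z where p: "\<psi> = Square c e' w z" by (cases \<psi>)
    have [simp]: "e' = e" using eq(1) assms(2) \<psi> by (simp add: s p)
    have sq: "Square d e u v \<in> squares C" "Square c e w z \<in> squares C" "d \<in> D" "e \<in> D" "c \<in> D"
      using assms(2) \<psi> by (simp_all add: s p)
    have g': "Dom C g = Cod C c" "Cod C g = Cod C d" "Cmp C v g = z"
      using eq assms(2) \<psi> sq by (simp_all add: s p)
    note [simp] = sq(1,2)[simplified]
    have "Cmp C e w = Cmp C v (Cmp C g c)" using g g' Cmp_assoc[of c g v] by simp
    then have ex1: "\<exists>!k. k \<in> Arr C \<and> Dom C k = Dom C w \<and> Cod C k = Dom C d \<and> Cmp C u k = w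
        \<and> Cmp C d k = Cmp C g c"
      using assms(1)[unfolded pullback_square_def, THEN conjunct2, rule_format, of w "Cmp C g c"] g g'
      by (simp add: s)
    then obtain k where k: "k \<in> Arr C" "Dom C k = Dom C w" "Cod C k = Dom C d" "Cmp C u k = w"
      "Cmp C d k = Cmp C g c" by blast
    let ?h = "Square c d k g"
    have h: "?h \<in> Arr T" using k g g' sq(3-) by simp
    show ?thesis
    proof (rule ex1I)
      show "?h \<in> Arr T \<and> Dom T ?h = Dom T \<psi> \<and> Cod T ?h = Dom T s \<and> Cmp T s ?h = \<psi>
          \<and> Fa (disp_proj A) ?h = g"
        using h assms(2) \<psi> k g' by (simp add: s p)
      fix m assume m: "m \<in> Arr T \<and> Dom T m = Dom T \<psi> \<and> Cod T m = Dom T s \<and> Cmp T s m = \<psi>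
          \<and> Fa (disp_proj A) m = g"
      obtain c' d' k' g'' where m': "m = Square c' d' k' g''" by (cases m)
      from m have mT: "m \<in> Arr T" and m1: "Dom T m = Dom T \<psi>" "Cod T m = Dom T s"
        "Cmp T s m = \<psi>" "Fa (disp_proj A) m = g" by blast+
      have src: "sq_src m = sq_src \<psi>" "sq_tgt m = sq_src s" "sq_bot m = g"
        using m1 disp_total_simps(3,4)[OF mT] disp_total_simps(3)[OF \<psi>]
          disp_total_simps(3)[OF assms(2)] disp_proj_simps(2)[OF mT] by simp_all
      then have [simp]: "c' = c" "d' = d" "g'' = g" by (simp_all add: m' s p)
      have "Cmp (arrow_cat C) s m = \<psi>"
        using m1(3) disp_total_simps(6)[OF mT assms(2)] src(2) by simp
      then have "Cmp C u k' = w" using mT assms(2) by (simp add: m' s p)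
      moreover have "k' \<in> Arr C" "Dom C k' = Dom C w" "Cod C k' = Dom C d" "Cmp C d k' = Cmp C g c"
        using mT by (simp_all add: m')
      ultimately have "k' = k" using ex1 k by blast
      then show "m = ?h" by (simp add: m')
    qed
  qed
  then show ?thesis using assms(2) unfolding cartesian_def by blast
qed

lemma cartesian_iff: "cartesian T C (disp_proj A) s \<longleftrightarrow> pullback_square C s \<and> s \<in> Arr T"
proof
  assume s: "cartesian T C (disp_proj A) s"
  then have sT: "s \<in> Arr T" by (simp add: cartesian_def)
  then obtain q where q: "pullback_square C q" "q \<in> Arr T" "sq_tgt q = sq_tgt s" "sq_bot q = sq_bot s"
    using display_pullback[of "sq_tgt s" "sq_bot s"] by (auto simp: squares_iff)
  obtain h where h: "is_iso T h" "Dom T h = Dom T s" "Cod T h = Dom T q" "Cmp T q h = s"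
    using cartesian_unique[OF T.category_axioms category_axioms T_proj.is_functor_axioms s
        pullback_cartesian[OF q(1,2)]] sT q by auto
  have hT: "h \<in> Arr T" using h(1) by (simp add: is_iso_def)
  \<comment> \<open>The comparison is an isomorphism of the total category; the inclusion functor
    makes it one of the arrow category, hence a pullback square that can be pasted with
    \<open>q\<close>.\<close>
  then have iso: "is_iso (arrow_cat C) h"
    using is_functor_iso[OF T.category_axioms T_incl.is_functor_axioms h(1)] by simp
  have "sq_src q = sq_tgt h" using h(3) hT q(2) by simp
  with pullback_paste[OF pullback_iso[OF iso] q(1)]
  have "pullback_square C (Cmp (arrow_cat C) q h)" .
  moreover have "Cmp (arrow_cat C) q h = s"
    using h(3,4) hT q(2) disp_total_simps(6)[of h A q] by simp
  ultimately show "pullback_square C s \<and> s \<in> Arr T" using sT by simp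
qed (auto intro: pullback_cartesian)

text \<open>The pullbacks granted by the display structure are the cartesian lifts that a fibration
  needs.\<close>

lemma comprehension_category_disp: "comprehension_category (disp_ccat A)"
proof -
  have "fibration T C (disp_proj A)"
    unfolding fibration_def
  proof (intro conjI ballI impI)
    fix d f assume d: "d \<in> Obj T" and f: "f \<in> Arr C" "Cod C f = Fo (disp_proj A) d"
    then obtain q where "pullback_square C q" "q \<in> Arr T" "sq_tgt q = d" "sq_bot q = f"
      using display_pullback[of d f] by auto
    then show "\<exists>\<phi>. cartesian T C (disp_proj A) \<phi> \<and> Cod T \<phi> = d \<and> Fa (disp_proj A) \<phi> = f"
      using pullback_cartesian[of q] by (intro exI[of _ q]) simp
  qed (rule T_proj.is_functor_axioms)
  moreover have "pullback_square C (Fa (incl_ftor T) \<phi>)" if "cartesian T C (disp_proj A) \<phi>" for \<phi>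
    using that unfolding cartesian_iff by auto
  moreover have "comp_ftor T (cod_ftor C) (incl_ftor T) = disp_proj A"
    by (simp add: disp_ccat_def)
  ultimately show ?thesis
    using category_axioms T.category_axioms T_incl.is_functor_axioms
    by (simp add: comprehension_category_def)
qed

lemma subcategorical_disp: "subcategorical (disp_ccat A)"
  unfolding subcategorical_def full_subcategory_def disp_ccat_simps disp_total_def
  by (auto intro!: exI[of _ D])

text \<open>The total category is full, so an isomorphism with both ends in \<open>D\<close> already
  belongs to it and repleteness becomes a condition on objects.\<close>

lemma replete_disp_iff: "replete_in T (arrow_cat C) \<longleftrightarrow> replete_maps C D"
proof
  assume r: "replete_in T (arrow_cat C)"
  have "e \<in> D" if d: "d \<in> D" and "isomorphic (arrow_cat C) d e" for d e
  proof -
    from that(2) obtain f where f: "is_iso (arrow_cat C) f" "Dom (arrow_cat C) f = d"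
      "Cod (arrow_cat C) f = e"
      unfolding isomorphic_def by blast
    then have "Cod (arrow_cat C) f \<in> Obj T"
      using r d Obj_T unfolding replete_in_def by blast
    then show ?thesis using f(3) by simp
  qed
  then show "replete_maps C D" unfolding replete_maps_def by blast
next
  assume r: "replete_maps C D"
  show "replete_in T (arrow_cat C)"
    unfolding replete_in_def
  proof (intro allI impI)
    fix s assume s: "is_iso (arrow_cat C) s \<and> Dom (arrow_cat C) s \<in> Obj T"
    then have sq: "s \<in> squares C" "sq_tgt s \<in> Arr C" by (auto simp: is_iso_def squares_iff)
    then have src: "sq_src s \<in> D" using s by simp
    have "isomorphic (arrow_cat C) (sq_src s) (sq_tgt s)"
      unfolding isomorphic_def using s sq by (intro exI[of _ s]) simp
    then have "sq_tgt s \<in> D" using r src unfolding replete_maps_def by blast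
    then show "Cod (arrow_cat C) s \<in> Obj T \<and> s \<in> Arr T" using src sq by simp
  qed
qed

end

section \<open>Display functors as strict maps, natural transformations as transformations\<close>

abbreviation disp_lift ::
    "('o, 'a) sdmcat \<Rightarrow> ('o, 'a, 'o, 'a) ftor \<Rightarrow> ('a, 'a square, 'a, 'a square) ftor" where
  "disp_lift A F \<equiv> snd (disp_map A F)"

lemma fst_disp_map [simp]: "fst (disp_map A F) = F"
  by (simp add: disp_map_def)

lemma disp_lift_simps [simp]:
  "d \<in> Obj (disp_total A) \<Longrightarrow> Fo (disp_lift A F) d = Fa F d"
  "s \<in> Arr (disp_total A) \<Longrightarrow> Fa (disp_lift A F) s = map_square (Fa F) s"
  by (auto simp: disp_map_def arr_ftor_def)

lemma disp_lift_def: "disp_lift A F = comp_ftor (disp_total A) (arr_ftor (fst A) F) (incl_ftor (disp_total A))"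
  by (simp add: disp_map_def)

lemma fst_disp_trans [simp]: "fst (disp_trans A \<alpha>) = \<alpha>"
  by (simp add: disp_trans_def)

lemma disp_trans_simps [simp]:
  "nsrc (snd (disp_trans A \<alpha>)) = disp_lift A (nsrc \<alpha>)"
  "ntgt (snd (disp_trans A \<alpha>)) = disp_lift A (ntgt \<alpha>)"
  "d \<in> Obj (disp_total A) \<Longrightarrow> cmpt (snd (disp_trans A \<alpha>)) d =
     Square (Fa (nsrc \<alpha>) d) (Fa (ntgt \<alpha>) d) (cmpt \<alpha> (Dom (fst A) d)) (cmpt \<alpha> (Cod (fst A) d))"
  by (simp_all add: disp_trans_def)

lemma strict_hom_simps:
  "Obj (strict_hom A B) = {M. strict_map A B M}"
  "Arr (strict_hom A B) = {\<tau>. transformation A B \<tau>}"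
  "transformation A B \<tau> \<Longrightarrow> Dom (strict_hom A B) \<tau> = (nsrc (fst \<tau>), nsrc (snd \<tau>))"
  "transformation A B \<tau> \<Longrightarrow> Cod (strict_hom A B) \<tau> = (ntgt (fst \<tau>), ntgt (snd \<tau>))"
  "strict_map A B M \<Longrightarrow> Idt (strict_hom A B) M =
     (id_nt (base A) (base B) (fst M), id_nt (total A) (total B) (snd M))"
  "transformation A B \<sigma> \<Longrightarrow> transformation A B \<tau> \<Longrightarrow> nsrc (fst \<tau>) = ntgt (fst \<sigma>) \<Longrightarrow>
     nsrc (snd \<tau>) = ntgt (snd \<sigma>) \<Longrightarrow> Cmp (strict_hom A B) \<tau> \<sigma> =
     (vcomp_nt (base A) (base B) (fst \<tau>) (fst \<sigma>), vcomp_nt (total A) (total B) (snd \<tau>) (snd \<sigma>))"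
  by (auto simp: strict_hom_def split: prod.splits)

text \<open>These are the conditions on default values under which \<open>category_transport\<close>
  applies to the hom-categories.\<close>

lemma strict_hom_ext:
  "Dom (strict_hom A B) \<in> extensional (Arr (strict_hom A B))"
  "Cod (strict_hom A B) \<in> extensional (Arr (strict_hom A B))"
  "Idt (strict_hom A B) \<in> extensional (Obj (strict_hom A B))"
  "\<not> (\<sigma> \<in> Arr (strict_hom A B) \<and> \<tau> \<in> Arr (strict_hom A B) \<and>
      Dom (strict_hom A B) \<tau> = Cod (strict_hom A B) \<sigma>) \<Longrightarrow> Cmp (strict_hom A B) \<tau> \<sigma> = undefined"
  by (auto simp: strict_hom_def split: prod.splits)

locale disp_pair = A: disp_category A + B: disp_category B
  for A B :: "('o, 'a) sdmcat"
begin

text \<open>By \<open>cartesian_iff\<close> on both sides, preservation of cartesian maps is a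
  special case of preservation of pullbacks of display maps.\<close>

lemma strict_map_disp:
  assumes "display_functor A B F"
  shows "strict_map (disp_ccat A) (disp_ccat B) (disp_map A F)"
proof -
  have F: "is_functor A.C B.C F" using assms by (simp add: display_functor_def)
  have FD: "Fa F d \<in> B.D" if "d \<in> A.D" for d
    using assms that by (auto simp: display_functor_def)
  interpret F: is_functor A.C B.C F by (rule F)
  have "is_functor A.T (arrow_cat B.C) (disp_lift A F)"
    unfolding disp_lift_def
    by (rule is_functor_comp[OF A.T.category_axioms A.T_incl.is_functor_axioms
          is_functor_arr_ftor[OF A.category_axioms F]])
  then have lift: "is_functor A.T B.T (disp_lift A F)"
    unfolding disp_total_def[of B]
    by (rule is_functor_into_full_subcat[OF A.T.category_axioms]) (simp add: FD)
  then interpret L: is_functor A.T B.T "disp_lift A F" .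
  have "comp_ftor A.T (disp_proj B) (disp_lift A F) = comp_ftor A.T F (disp_proj A)"
  proof (rule comp_ftor_eqI)
    fix d assume d: "d \<in> Obj A.T"
    then show "Fo (disp_proj B) (Fo (disp_lift A F) d) = Fo F (Fo (disp_proj A) d)"
      using L.Fo_Obj[OF d] by simp
  next
    fix s assume s: "s \<in> Arr A.T"
    then show "Fa (disp_proj B) (Fa (disp_lift A F) s) = Fa F (Fa (disp_proj A) s)"
      using L.Fa_Arr[OF s] by (simp add: square.map_sel)
  qed
  moreover have "cartesian B.T B.C (disp_proj B) (Fa (disp_lift A F) s)"
    if "cartesian A.T A.C (disp_proj A) s" for s
  proof -
    from that have "pullback_square A.C s" "s \<in> Arr A.T" by (simp_all add: A.cartesian_iff)
    then have "pullback_square B.C (map_square (Fa F) s)"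
      using assms by (simp add: display_functor_def)
    then show ?thesis
      using L.Fa_Arr[OF \<open>s \<in> Arr A.T\<close>] \<open>s \<in> Arr A.T\<close> by (simp add: B.cartesian_iff)
  qed
  moreover have "comp_ftor A.T (incl_ftor B.T) (disp_lift A F) = disp_lift A F"
    by (rule comp_ftor_id_left[OF lift])
  ultimately show ?thesis
    using F lift unfolding strict_map_def disp_ccat_simps
    by (simp add: case_prod_unfold disp_lift_def[symmetric])
qed

lemma strict_mapD:
  assumes "strict_map (disp_ccat A) (disp_ccat B) M"
  shows "M = disp_map A (fst M)" "display_functor A B (fst M)"
proof -
  obtain F L where M: "M = (F, L)" by (cases M)
  have F: "is_functor A.C B.C F" and L: "is_functor A.T B.T L"
    and cart: "\<And>s. cartesian A.T A.C (disp_proj A) s \<Longrightarrow> cartesian B.T B.C (disp_proj B) (Fa L s)"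
    and eq: "comp_ftor A.T (incl_ftor B.T) L = disp_lift A F"
    using assms by (simp_all add: M strict_map_def disp_lift_def)
  have LF: "L = disp_lift A F"
    using comp_ftor_id_left[OF L] eq by simp
  then show "M = disp_map A (fst M)" by (simp add: M disp_map_def)
  interpret L: is_functor A.T B.T L by (rule L)
  interpret F: is_functor "arrow_cat A.C" "arrow_cat B.C" "arr_ftor A.C F"
    by (rule is_functor_arr_ftor[OF A.category_axioms F])
  have "Fa F d \<in> B.D" if "d \<in> A.D" for d
    using L.Fo_Obj[of d] that by (simp add: LF)
  moreover have "pullback_square B.C (map_square (Fa F) s)"
    if s: "pullback_square A.C s" "sq_tgt s \<in> A.D" for s
  proof -
    have sq: "s \<in> squares A.C" using s(1) by (rule pullback_square_in_squares)
    then have "sq_bot s \<in> Arr A.C" "Cod A.C (sq_bot s) = Cod A.C (sq_tgt s)"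
      by (simp_all add: squares_iff)
    then obtain q where q: "pullback_square A.C q" "q \<in> Arr A.T" "sq_tgt q = sq_tgt s" "sq_bot q = sq_bot s"
      using A.display_pullback[OF s(2)] by blast
    \<comment> \<open>The source of \<open>s\<close> need not be a display map, so
      \<open>cart\<close> says nothing about \<open>s\<close>. It does apply to \<open>q\<close>,
      and \<open>s\<close> is \<open>q\<close> pasted with the isomorphism \<open>h\<close>, whose
      image is again a pullback square.\<close>
    obtain h where h: "is_iso (arrow_cat A.C) h" "sq_src h = sq_src s" "sq_tgt h = sq_src q"
      "s = Cmp (arrow_cat A.C) q h"
      by (rule A.pullback_unique[OF s(1) q(1)]) (use q in auto)
    have hq: "h \<in> Arr (arrow_cat A.C)" "q \<in> Arr (arrow_cat A.C)"
      using h(1) q(2) by (simp_all add: is_iso_def)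
    have "pullback_square B.C (map_square (Fa F) q)"
      using cart[of q] q(1,2) by (simp add: A.cartesian_iff B.cartesian_iff LF)
    moreover have "pullback_square B.C (map_square (Fa F) h)"
      by (rule B.pullback_iso[OF map_square_iso[OF A.category_axioms F h(1)]])
    ultimately have "pullback_square B.C (Cmp (arrow_cat B.C) (map_square (Fa F) q) (map_square (Fa F) h))"
      using B.pullback_paste h(3) by (simp add: square.map_sel)
    moreover have "Cmp (arrow_cat B.C) (map_square (Fa F) q) (map_square (Fa F) h) = map_square (Fa F) s"
    proof -
      have "Fa (arr_ftor A.C F) (Cmp (arrow_cat A.C) q h) =
          Cmp (arrow_cat B.C) (Fa (arr_ftor A.C F) q) (Fa (arr_ftor A.C F) h)"
        using hq h(3) by (intro F.Fa_Cmp) simp_all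
      then show ?thesis using hq sq unfolding h(4)[symmetric] by (simp add: arr_ftor_def)
    qed
    ultimately show ?thesis by simp
  qed
  ultimately show "display_functor A B (fst M)"
    using F by (auto simp: M display_functor_def)
qed

text \<open>Naturality of \<alpha> at a display map is the commutation of the square serving as
  component there. Naturality of the lift at a square is naturality of \<alpha> at its top and at
  its bottom.\<close>

lemma transformation_disp:
  assumes "is_nt A.C B.C \<alpha>" "display_functor A B (nsrc \<alpha>)" "display_functor A B (ntgt \<alpha>)"
  shows "transformation (disp_ccat A) (disp_ccat B) (disp_trans A \<alpha>)"
proof -
  interpret a: is_nt A.C B.C \<alpha> by fact
  interpret F: is_functor A.C B.C "nsrc \<alpha>" by (rule a.nsrc_functor)
  interpret G: is_functor A.C B.C "ntgt \<alpha>" by (rule a.ntgt_functor)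
  note strict = strict_map_disp[OF assms(2)] strict_map_disp[OF assms(3)]
  have LG: "is_functor A.T B.T (disp_lift A (nsrc \<alpha>))" "is_functor A.T B.T (disp_lift A (ntgt \<alpha>))"
    using strict by (auto simp: strict_map_def split: prod.splits)
  interpret L: is_functor A.T B.T "disp_lift A (nsrc \<alpha>)" by (rule LG)
  interpret M: is_functor A.T B.T "disp_lift A (ntgt \<alpha>)" by (rule LG)
  let ?b = "snd (disp_trans A \<alpha>)"
  have b: "cmpt ?b d \<in> Arr B.T" if d: "d \<in> Obj A.T" for d
    using d L.Fo_Obj[OF d] M.Fo_Obj[OF d] a.naturality[of d] by simp
  have bD: "Dom B.T (cmpt ?b d) = Fa (nsrc \<alpha>) d" "Cod B.T (cmpt ?b d) = Fa (ntgt \<alpha>) d"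
    if d: "d \<in> Obj A.T" for d
    using disp_total_simps(3,4)[OF b[OF d]] d by simp_all
  have nt: "is_nt A.T B.T ?b"
  proof (rule is_nt.intro)
    show "cmpt ?b \<in> Obj A.T \<rightarrow>\<^sub>E Arr B.T"
      using b by (auto simp: disp_trans_def)
    fix s assume s: "s \<in> Arr A.T"
    then have st: "sq_src s \<in> Obj A.T" "sq_tgt s \<in> Obj A.T" and sq: "s \<in> squares A.C"
      by (auto simp: squares_iff)
    have "Cmp B.T (cmpt ?b (sq_tgt s)) (map_square (Fa (nsrc \<alpha>)) s) =
        Cmp (arrow_cat B.C) (cmpt ?b (sq_tgt s)) (map_square (Fa (nsrc \<alpha>)) s)"
      using b[OF st(2)] L.Fa_Arr[OF s] s st by (intro disp_total_simps(6)) (simp_all add: square.map_sel)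
    also have "\<dots> = Cmp (arrow_cat B.C) (map_square (Fa (ntgt \<alpha>)) s) (cmpt ?b (sq_src s))"
      using b[OF st(1)] b[OF st(2)] L.Fa_Arr[OF s] M.Fa_Arr[OF s] s st sq
        a.naturality[of "sq_top s"] a.naturality[of "sq_bot s"]
      by (simp add: square.map_sel del: Square_in_squares) (simp add: squares_iff)
    also have "\<dots> = Cmp B.T (map_square (Fa (ntgt \<alpha>)) s) (cmpt ?b (sq_src s))"
      using b[OF st(1)] M.Fa_Arr[OF s] s st
      by (intro disp_total_simps(6)[symmetric]) (simp_all add: square.map_sel)
    finally show "Cmp B.T (cmpt ?b (Cod A.T s)) (Fa (nsrc ?b) s) =
        Cmp B.T (Fa (ntgt ?b) s) (cmpt ?b (Dom A.T s))"
      using s st by simp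
  qed (use LG bD in \<open>simp_all del: disp_total_simps disp_trans_simps(3)
      add: disp_trans_simps(1,2) disp_lift_simps\<close>)
  have "Fa (disp_proj B) (cmpt ?b d) = cmpt \<alpha> (Fo (disp_proj A) d)" if "d \<in> Obj A.T" for d
    using disp_proj_simps(2)[OF b[OF that]] that by simp
  moreover have "sq_top (Fa (incl_ftor B.T) (cmpt ?b d)) = cmpt \<alpha> (Dom A.C (Fo (incl_ftor A.T) d))"
    if "d \<in> Obj A.T" for d
    using incl_ftor_simps(2)[OF b[OF that]] incl_ftor_simps(1)[OF that] that by simp
  moreover have "(F, disp_lift A F) = disp_map A F" for F by (simp add: disp_map_def)
  ultimately show ?thesis
    using nt assms strict unfolding transformation_def case_prod_unfold
    by (simp del: disp_total_simps disp_trans_simps(3) incl_ftor_simps)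
qed

text \<open>A component is a square with four entries: source and target are given by the two
  functors, the bottom by lying over \<alpha>, and the top by the condition on domain
  components.\<close>

lemma transformationD:
  assumes "transformation (disp_ccat A) (disp_ccat B) \<tau>"
  shows "\<tau> = disp_trans A (fst \<tau>)" "is_nt A.C B.C (fst \<tau>)"
    "display_functor A B (nsrc (fst \<tau>))" "display_functor A B (ntgt (fst \<tau>))"
proof -
  obtain \<alpha> \<beta> where t: "\<tau> = (\<alpha>, \<beta>)" by (cases \<tau>)
  have nt: "is_nt A.C B.C \<alpha>" "is_nt A.T B.T \<beta>"
    and sm: "strict_map (disp_ccat A) (disp_ccat B) (nsrc \<alpha>, nsrc \<beta>)"
      "strict_map (disp_ccat A) (disp_ccat B) (ntgt \<alpha>, ntgt \<beta>)"
    and bot: "\<And>d. d \<in> Obj A.T \<Longrightarrow> Fa (disp_proj B) (cmpt \<beta> d) = cmpt \<alpha> (Fo (disp_proj A) d)"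
    and top: "\<And>d. d \<in> Obj A.T \<Longrightarrow> sq_top (Fa (incl_ftor B.T) (cmpt \<beta> d)) =
      cmpt \<alpha> (Dom A.C (Fo (incl_ftor A.T) d))"
    using assms by (auto simp: t transformation_def simp del: disp_total_simps incl_ftor_simps disp_proj_simps)
  show nt': "is_nt A.C B.C (fst \<tau>)" using nt by (simp add: t)
  show df: "display_functor A B (nsrc (fst \<tau>))" "display_functor A B (ntgt (fst \<tau>))"
    using strict_mapD(2)[OF sm(1)] strict_mapD(2)[OF sm(2)] by (simp_all add: t)
  have eq: "nsrc \<beta> = disp_lift A (nsrc \<alpha>)" "ntgt \<beta> = disp_lift A (ntgt \<alpha>)"
    using strict_mapD(1)[OF sm(1)] strict_mapD(1)[OF sm(2)] by (simp_all add: prod_eq_iff)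
  interpret b: is_nt A.T B.T \<beta> by (rule nt)
  have "transformation (disp_ccat A) (disp_ccat B) (disp_trans A \<alpha>)"
    using transformation_disp nt' df by (simp add: t)
  then have nt2: "is_nt A.T B.T (snd (disp_trans A \<alpha>))"
    by (simp add: transformation_def case_prod_unfold)
  have "\<beta> = snd (disp_trans A \<alpha>)"
  proof (rule nt_eqI[OF nt(2) nt2])
    fix d assume d: "d \<in> Obj A.T"
    note b = b.cmpt_Arr[OF d]
    have "sq_src (cmpt \<beta> d) = Fa (nsrc \<alpha>) d" "sq_tgt (cmpt \<beta> d) = Fa (ntgt \<alpha>) d"
      using disp_total_simps(3,4)[OF b] b.cmpt_Dom[OF d] b.cmpt_Cod[OF d] disp_lift_simps(1)[OF d] eq
      by simp_all
    moreover have "sq_bot (cmpt \<beta> d) = cmpt \<alpha> (Cod A.C d)"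
      using bot[OF d] disp_proj_simps(2)[OF b] disp_proj_simps(1)[OF d] by simp
    moreover have "sq_top (cmpt \<beta> d) = cmpt \<alpha> (Dom A.C d)"
      using top[OF d] incl_ftor_simps(2)[OF b] incl_ftor_simps(1)[OF d] by simp
    ultimately show "cmpt \<beta> d = cmpt (snd (disp_trans A \<alpha>)) d"
      using disp_trans_simps(3)[OF d] by (intro square.expand) simp_all
  qed (simp_all add: eq)
  then show "\<tau> = disp_trans A (fst \<tau>)" by (simp add: t prod_eq_iff)
qed

end

text \<open>The inverse maps are restricted so that the inverse functor is extensional. It respects
  composition because injectivity on objects makes preimages of composable arrows
  composable.\<close>

lemma cat_iso_bij:
  assumes "category C" "is_functor C D F" "bij_betw (Fo F) (Obj C) (Obj D)" "bij_betw (Fa F) (Arr C) (Arr D)"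
  shows "cat_iso C D F"
proof -
  interpret C: category C by fact
  interpret F: is_functor C D F by fact
  define G where "G = \<lparr> Fo = restrict (inv_into (Obj C) (Fo F)) (Obj D),
    Fa = restrict (inv_into (Arr C) (Fa F)) (Arr D) \<rparr>"
  have Go [simp]: "Fo G (Fo F x) = x" if "x \<in> Obj C" for x
    using assms(3) that by (simp add: G_def bij_betw_def)
  have Ga [simp]: "Fa G (Fa F f) = f" if "f \<in> Arr C" for f
    using assms(4) that by (simp add: G_def bij_betw_def)
  have obj: "\<exists>x0\<in>Obj C. x = Fo F x0" if "x \<in> Obj D" for x
    using assms(3) that by (auto simp: bij_betw_def)
  have arr: "\<exists>f0\<in>Arr C. f = Fa F f0" if "f \<in> Arr D" for f
    using assms(4) that by (auto simp: bij_betw_def)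
  have eq: "x = y" if "Fo F x = Fo F y" "x \<in> Obj C" "y \<in> Obj C" for x y
    using that Go by metis
  have G: "is_functor D C G"
  proof (rule is_functor.intro)
    show "Fo G \<in> Obj D \<rightarrow>\<^sub>E Obj C" "Fa G \<in> Arr D \<rightarrow>\<^sub>E Arr C"
      using obj arr by (auto simp: PiE_iff G_def image_iff intro!: inv_into_into)
    show "Fa G (Idt D x) = Idt C (Fo G x)" if "x \<in> Obj D" for x
      using obj[OF that] by (auto simp flip: F.Fa_Idt)
    show "Dom C (Fa G f) = Fo G (Dom D f)" "Cod C (Fa G f) = Fo G (Cod D f)" if "f \<in> Arr D" for f
      using arr[OF that] by auto
    show "Fa G (Cmp D g f) = Cmp C (Fa G g) (Fa G f)"
      if fg: "f \<in> Arr D" "g \<in> Arr D" "Dom D g = Cod D f" for f g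
    proof -
      from arr[OF fg(1)] arr[OF fg(2)] obtain f0 g0
        where [simp]: "f0 \<in> Arr C" "f = Fa F f0" "g0 \<in> Arr C" "g = Fa F g0" by blast
      have "Dom C g0 = Cod C f0" using fg(3) by (intro eq) simp_all
      then show ?thesis by (simp flip: F.Fa_Cmp)
    qed
  qed
  moreover have "comp_ftor C G F = id_ftor C"
    by (simp add: comp_ftor_def incl_ftor_def cong: restrict_cong)
  moreover have "comp_ftor D F G = id_ftor D"
    by (auto simp: comp_ftor_def incl_ftor_def intro!: restrict_ext dest!: obj arr)
  ultimately show ?thesis using assms(2) by (auto simp: cat_iso_def)
qed

section \<open>Compatibility of the lift with identities and compositions\<close>

lemma disp_categoryI: "A \<in> Cells0 sDMC \<Longrightarrow> disp_category A"
  by (simp add: disp_category_def disp_category_axioms_def)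

lemma disp_map_id:
  assumes "A \<in> Cells0 sDMC"
  shows "disp_map A (id_ftor (fst A)) = (id_ftor (fst A), id_ftor (disp_total A))"
proof -
  have "disp_lift A (id_ftor (fst A)) = comp_ftor (disp_total A) (id_ftor (disp_total A)) (id_ftor (disp_total A))"
    unfolding disp_lift_def
    by (rule comp_ftor_eqI) (auto simp: arr_ftor_def map_square_id_ftor)
  also have "\<dots> = id_ftor (disp_total A)"
    using disp_categoryI[OF assms]
    by (intro comp_ftor_id_left is_functor_id) (simp add: disp_category.axioms disp_total_def
        category_full_subcat category_arrow_cat)
  finally show ?thesis by (simp add: prod_eq_iff)
qed

context disp_pair
begin

lemma disp_lift_functor: "display_functor A B F \<Longrightarrow> is_functor A.T B.T (disp_lift A F)"
  using strict_map_disp[of F] by (simp add: strict_map_def case_prod_unfold)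

lemma disp_trans_nt: "\<alpha> \<in> Arr (Hom sDMC A B) \<Longrightarrow> is_nt A.T B.T (snd (disp_trans A \<alpha>))"
  using transformation_disp[of \<alpha>] by (simp add: transformation_def case_prod_unfold)

lemma disp_map_comp:
  assumes "display_functor A B F"
  shows "disp_map A (comp_ftor A.C G F) =
    (comp_ftor A.C G F, comp_ftor A.T (disp_lift B G) (disp_lift A F))"
proof -
  interpret L: is_functor A.T B.T "disp_lift A F" by (rule disp_lift_functor) fact
  have "disp_lift A (comp_ftor A.C G F) = comp_ftor A.T (disp_lift B G) (disp_lift A F)"
    unfolding disp_lift_def[of A "comp_ftor A.C G F"]
  proof (rule comp_ftor_eqI)
    fix d assume d: "d \<in> Obj A.T"
    then show "Fo (arr_ftor A.C (comp_ftor A.C G F)) (Fo (incl_ftor A.T) d) =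
        Fo (disp_lift B G) (Fo (disp_lift A F) d)"
      using disp_lift_simps(1)[OF L.Fo_Obj[OF d]] by (simp add: arr_ftor_def)
  next
    fix s assume s: "s \<in> Arr A.T"
    then show "Fa (arr_ftor A.C (comp_ftor A.C G F)) (Fa (incl_ftor A.T) s) =
        Fa (disp_lift B G) (Fa (disp_lift A F) s)"
      using disp_lift_simps(2)[OF L.Fa_Arr[OF s]] by (simp add: arr_ftor_def map_square_comp_ftor)
  qed
  then show ?thesis by (simp add: prod_eq_iff)
qed

text \<open>Squares compose entrywise, so the top and bottom of the composite component at
  \<open>d\<close> are the components of the horizontal composite at the domain and codomain of
  \<open>d\<close>.\<close>

lemma disp_trans_hcomp:
  assumes "\<alpha> \<in> Arr (Hom sDMC A B)" "\<beta> \<in> Arr (Hom sDMC B E)" "E \<in> Cells0 sDMC"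
  shows "disp_trans A (hcomp_nt A.C (fst E) \<beta> \<alpha>) =
    (hcomp_nt A.C (fst E) \<beta> \<alpha>, hcomp_nt A.T (disp_total E) (snd (disp_trans B \<beta>)) (snd (disp_trans A \<alpha>)))"
proof -
  interpret E: disp_category E by (rule disp_categoryI) fact
  interpret BE: disp_pair B E ..
  interpret AE: disp_pair A E ..
  interpret S: two_category sDMC by (rule two_category_sDMC)
  let ?a = "snd (disp_trans A \<alpha>)" and ?b = "snd (disp_trans B \<beta>)"
  have \<alpha>: "is_nt A.C B.C \<alpha>" "display_functor A B (nsrc \<alpha>)" "display_functor A B (ntgt \<alpha>)"
    and \<beta>: "is_nt B.C E.C \<beta>" "display_functor B E (nsrc \<beta>)" "display_functor B E (ntgt \<beta>)"
    using assms(1,2) by simp_all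
  have cell: "A \<in> Cells0 sDMC" "B \<in> Cells0 sDMC"
    using A.disp B.disp A.category_axioms B.category_axioms by simp_all
  have "hcomp_nt A.C E.C \<beta> \<alpha> \<in> Arr (Hom sDMC A E)"
    using S.Cmp2_cell[OF cell assms(3,1,2)] by simp
  then have nt: "is_nt A.T E.T (snd (disp_trans A (hcomp_nt A.C E.C \<beta> \<alpha>)))"
    by (rule AE.disp_trans_nt)
  interpret a: is_nt A.T B.T ?a by (rule disp_trans_nt) fact
  interpret b: is_nt B.T E.T ?b by (rule BE.disp_trans_nt) fact
  interpret L: is_functor A.T B.T "disp_lift A (nsrc \<alpha>)" by (rule disp_lift_functor) fact
  interpret L': is_functor A.T B.T "disp_lift A (ntgt \<alpha>)" by (rule disp_lift_functor) fact
  interpret K: is_functor B.T E.T "disp_lift B (nsrc \<beta>)" by (rule BE.disp_lift_functor) fact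
  interpret F: is_functor A.C B.C "nsrc \<alpha>" by (rule is_nt.nsrc_functor[OF \<alpha>(1)])
  interpret F': is_functor A.C B.C "ntgt \<alpha>" by (rule is_nt.ntgt_functor[OF \<alpha>(1)])
  interpret G: is_functor B.C E.C "nsrc \<beta>" by (rule is_nt.nsrc_functor[OF \<beta>(1)])
  have "snd (disp_trans A (hcomp_nt A.C E.C \<beta> \<alpha>)) = hcomp_nt A.T E.T ?b ?a"
  proof (rule nt_eqI[OF nt is_nt_hcomp[OF A.T.category_axioms B.T.category_axioms
          E.T.category_axioms a.is_nt_axioms b.is_nt_axioms]])
    show "nsrc (snd (disp_trans A (hcomp_nt A.C E.C \<beta> \<alpha>))) = nsrc (hcomp_nt A.T E.T ?b ?a)"
      "ntgt (snd (disp_trans A (hcomp_nt A.C E.C \<beta> \<alpha>))) = ntgt (hcomp_nt A.T E.T ?b ?a)"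
      using disp_map_comp[OF \<alpha>(2), of "nsrc \<beta>"] disp_map_comp[OF \<alpha>(3), of "ntgt \<beta>"] by simp_all
    fix d assume d: "d \<in> Obj A.T"
    let ?t = "cmpt ?b (Fa (ntgt \<alpha>) d)" and ?s = "cmpt ?a d"
    have F'd: "Fa (ntgt \<alpha>) d \<in> Obj B.T" using L'.Fo_Obj[OF d] disp_lift_simps(1)[OF d] by simp
    have s: "?s \<in> Arr B.T" by (rule a.cmpt_Arr[OF d])
    have t: "?t \<in> Arr E.T" by (rule b.cmpt_Arr[OF F'd])
    have Ks: "map_square (Fa (nsrc \<beta>)) ?s \<in> Arr E.T"
      using K.Fa_Arr[OF s] disp_lift_simps(2)[OF s] by simp
    have dA: "d \<in> Arr A.C" using d by simp
    have "cmpt (hcomp_nt A.T E.T ?b ?a) d = Cmp E.T ?t (Fa (disp_lift B (nsrc \<beta>)) ?s)"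
      using d disp_lift_simps(1)[OF d] unfolding hcomp_nt_def by simp
    also have "\<dots> = Cmp E.T ?t (map_square (Fa (nsrc \<beta>)) ?s)"
      by (simp only: disp_lift_simps(2)[OF s])
    also have "\<dots> = Cmp (arrow_cat E.C) ?t (map_square (Fa (nsrc \<beta>)) ?s)"
      by (rule disp_total_simps(6)[OF Ks t])
        (simp add: disp_trans_simps(3)[OF d] disp_trans_simps(3)[OF F'd])
    also have "\<dots> = Square (sq_src (map_square (Fa (nsrc \<beta>)) ?s)) (sq_tgt ?t)
        (Cmp E.C (sq_top ?t) (sq_top (map_square (Fa (nsrc \<beta>)) ?s)))
        (Cmp E.C (sq_bot ?t) (sq_bot (map_square (Fa (nsrc \<beta>)) ?s)))"
      using Ks t disp_trans_simps(3)[OF d] disp_trans_simps(3)[OF F'd]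
      by (intro arrow_cat_simps(6)) (simp_all add: square.map_sel del: Square_in_squares)
    also have "\<dots> = cmpt (snd (disp_trans A (hcomp_nt A.C E.C \<beta> \<alpha>))) d"
      using dA disp_trans_simps(3)[OF d] disp_trans_simps(3)[OF F'd]
      unfolding disp_trans_simps(3)[OF d] by (simp add: hcomp_nt_def)
    finally show "cmpt (snd (disp_trans A (hcomp_nt A.C E.C \<beta> \<alpha>))) d = cmpt (hcomp_nt A.T E.T ?b ?a) d"
      by simp
  qed
  then show ?thesis by (simp add: prod_eq_iff)
qed

lemma disp_trans_id:
  assumes "display_functor A B F"
  shows "disp_trans A (id_nt A.C B.C F) = (id_nt A.C B.C F, id_nt A.T B.T (disp_lift A F))"
proof -
  have F: "is_functor A.C B.C F" using assms by (simp add: display_functor_def)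
  interpret F: is_functor A.C B.C F by (rule F)
  interpret L: is_functor A.T B.T "disp_lift A F" by (rule disp_lift_functor) fact
  have "id_nt A.C B.C F \<in> Arr (Hom sDMC A B)"
    using assms is_nt_id[OF A.category_axioms B.category_axioms F] by simp
  then have "is_nt A.T B.T (snd (disp_trans A (id_nt A.C B.C F)))" by (rule disp_trans_nt)
  then have "snd (disp_trans A (id_nt A.C B.C F)) = id_nt A.T B.T (disp_lift A F)"
  proof (rule nt_eqI[OF _ is_nt_id[OF A.T.category_axioms B.T.category_axioms L.is_functor_axioms]])
    fix d assume d: "d \<in> Obj A.T"
    have "cmpt (id_nt A.T B.T (disp_lift A F)) d = Idt (arrow_cat B.C) (Fa F d)"
      using d disp_lift_simps(1)[OF d] disp_total_simps(5)[OF L.Fo_Obj[OF d]]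
      unfolding id_nt_def by simp
    then show "cmpt (snd (disp_trans A (id_nt A.C B.C F))) d = cmpt (id_nt A.T B.T (disp_lift A F)) d"
      using d by (simp add: id_nt_def)
  qed simp_all
  then show ?thesis by (simp add: prod_eq_iff)
qed

lemma disp_trans_vcomp:
  assumes "\<alpha> \<in> Arr (Hom sDMC A B)" "\<beta> \<in> Arr (Hom sDMC A B)" "nsrc \<beta> = ntgt \<alpha>"
  shows "disp_trans A (vcomp_nt A.C B.C \<beta> \<alpha>) =
    (vcomp_nt A.C B.C \<beta> \<alpha>, vcomp_nt A.T B.T (snd (disp_trans A \<beta>)) (snd (disp_trans A \<alpha>)))"
proof -
  let ?a = "snd (disp_trans A \<alpha>)" and ?b = "snd (disp_trans A \<beta>)"
  have "vcomp_nt A.C B.C \<beta> \<alpha> \<in> Arr (Hom sDMC A B)"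
    using assms is_nt_vcomp[OF A.category_axioms B.category_axioms] by simp
  then have nt: "is_nt A.T B.T (snd (disp_trans A (vcomp_nt A.C B.C \<beta> \<alpha>)))" by (rule disp_trans_nt)
  have a: "is_nt A.T B.T ?a" and b: "is_nt A.T B.T ?b" using assms disp_trans_nt by blast+
  interpret a: is_nt A.T B.T ?a by (rule a)
  interpret b: is_nt A.T B.T ?b by (rule b)
  have "snd (disp_trans A (vcomp_nt A.C B.C \<beta> \<alpha>)) = vcomp_nt A.T B.T ?b ?a"
  proof (rule nt_eqI[OF nt is_nt_vcomp[OF A.T.category_axioms B.T.category_axioms a b]])
    fix d assume d: "d \<in> Obj A.T"
    have s: "cmpt ?a d \<in> Arr B.T" and t: "cmpt ?b d \<in> Arr B.T"
      using a.cmpt_Arr[OF d] b.cmpt_Arr[OF d] by blast+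
    have st: "sq_src (cmpt ?b d) = sq_tgt (cmpt ?a d)" using d assms(3) by simp
    have "cmpt (vcomp_nt A.T B.T ?b ?a) d = Cmp B.T (cmpt ?b d) (cmpt ?a d)"
      using d unfolding vcomp_nt_def by simp
    also have "\<dots> = Cmp (arrow_cat B.C) (cmpt ?b d) (cmpt ?a d)"
      by (rule disp_total_simps(6)[OF s t st])
    also have "\<dots> = Square (sq_src (cmpt ?a d)) (sq_tgt (cmpt ?b d))
        (Cmp B.C (sq_top (cmpt ?b d)) (sq_top (cmpt ?a d)))
        (Cmp B.C (sq_bot (cmpt ?b d)) (sq_bot (cmpt ?a d)))"
      using s t st by (intro arrow_cat_simps(6)) (simp_all del: disp_trans_simps)
    also have "\<dots> = cmpt (snd (disp_trans A (vcomp_nt A.C B.C \<beta> \<alpha>))) d"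
      using d by (simp add: vcomp_nt_def)
    finally show "cmpt (snd (disp_trans A (vcomp_nt A.C B.C \<beta> \<alpha>))) d = cmpt (vcomp_nt A.T B.T ?b ?a) d"
      by simp
  qed (simp_all add: assms(3))
  then show ?thesis by (simp add: prod_eq_iff)
qed

lemma disp_hom_functor:
  "is_functor (Hom sDMC A B) (strict_hom (disp_ccat A) (disp_ccat B)) (onHom disp_to_ccat A B)"
proof -
  interpret H: category "Hom sDMC A B"
    by (rule category_Hom_sDMC) (rule A.category_axioms B.category_axioms)+
  have map: "strict_map (disp_ccat A) (disp_ccat B) (disp_map A F)" if "F \<in> Obj (Hom sDMC A B)" for F
    using that strict_map_disp by simp
  have trans: "transformation (disp_ccat A) (disp_ccat B) (disp_trans A \<alpha>)"
    if "\<alpha> \<in> Arr (Hom sDMC A B)" for \<alpha>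
    using that transformation_disp by simp
  note [simp del] = Hom_sDMC_simps(1,2)
  note h = Hom_sDMC_simps(3-6)
  show ?thesis
  proof (rule is_functor.intro)
    fix \<alpha> assume a: "\<alpha> \<in> Arr (Hom sDMC A B)"
    show "Dom (strict_hom (disp_ccat A) (disp_ccat B)) (Fa (onHom disp_to_ccat A B) \<alpha>) =
        Fo (onHom disp_to_ccat A B) (Dom (Hom sDMC A B) \<alpha>)"
      using a H.Dom_Obj[OF a] trans[OF a]
      by (simp add: disp_to_ccat_def strict_hom_simps prod_eq_iff)
    show "Cod (strict_hom (disp_ccat A) (disp_ccat B)) (Fa (onHom disp_to_ccat A B) \<alpha>) =
        Fo (onHom disp_to_ccat A B) (Cod (Hom sDMC A B) \<alpha>)"
      using a H.Cod_Obj[OF a] trans[OF a]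
      by (simp add: disp_to_ccat_def strict_hom_simps prod_eq_iff)
    fix \<beta> assume b: "\<beta> \<in> Arr (Hom sDMC A B)" "Dom (Hom sDMC A B) \<beta> = Cod (Hom sDMC A B) \<alpha>"
    then have eq: "nsrc \<beta> = ntgt \<alpha>" using a by simp
    have "vcomp_nt A.C B.C \<beta> \<alpha> \<in> Arr (Hom sDMC A B)"
      using H.Cmp_Arr[OF a b] a b(1) eq by simp
    then show "Fa (onHom disp_to_ccat A B) (Cmp (Hom sDMC A B) \<beta> \<alpha>) =
        Cmp (strict_hom (disp_ccat A) (disp_ccat B)) (Fa (onHom disp_to_ccat A B) \<beta>)
          (Fa (onHom disp_to_ccat A B) \<alpha>)"
      using a b(1) eq trans[OF a] trans[OF b(1)] disp_trans_vcomp[OF a b(1) eq]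
      by (simp add: disp_to_ccat_def strict_hom_simps)
  next
    fix F assume F: "F \<in> Obj (Hom sDMC A B)"
    then show "Fa (onHom disp_to_ccat A B) (Idt (Hom sDMC A B) F) =
        Idt (strict_hom (disp_ccat A) (disp_ccat B)) (Fo (onHom disp_to_ccat A B) F)"
      using H.Idt_Arr[OF F] map[OF F] disp_trans_id[of F]
      by (simp add: disp_to_ccat_def strict_hom_simps Hom_sDMC_simps(1))
  qed (use map trans in \<open>auto simp: disp_to_ccat_def strict_hom_simps(1,2)\<close>)
qed

lemma disp_hom_iso:
  "cat_iso (Hom sDMC A B) (strict_hom (disp_ccat A) (disp_ccat B)) (onHom disp_to_ccat A B)"
proof (rule cat_iso_bij)
  show "category (Hom sDMC A B)"
    by (rule category_Hom_sDMC) (rule A.category_axioms B.category_axioms)+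
  show "is_functor (Hom sDMC A B) (strict_hom (disp_ccat A) (disp_ccat B)) (onHom disp_to_ccat A B)"
    by (rule disp_hom_functor)
  have "bij_betw (disp_map A) (Obj (Hom sDMC A B)) (Obj (strict_hom (disp_ccat A) (disp_ccat B)))"
    \<comment> \<open>Forgetting the lift is inverse to lifting, because a strict map is determined
      by its first component.\<close>
    by (rule bij_betw_byWitness[where f' = fst])
      (use strict_map_disp strict_mapD in \<open>auto simp: strict_hom_simps\<close>)
  then show "bij_betw (Fo (onHom disp_to_ccat A B)) (Obj (Hom sDMC A B))
      (Obj (strict_hom (disp_ccat A) (disp_ccat B)))"
    by (subst bij_betw_cong[where g = "disp_map A"]) (auto simp: disp_to_ccat_def)
  have "bij_betw (disp_trans A) (Arr (Hom sDMC A B)) (Arr (strict_hom (disp_ccat A) (disp_ccat B)))"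
    by (rule bij_betw_byWitness[where f' = fst])
      (use transformation_disp transformationD in \<open>auto simp: strict_hom_simps\<close>)
  then show "bij_betw (Fa (onHom disp_to_ccat A B)) (Arr (Hom sDMC A B))
      (Arr (strict_hom (disp_ccat A) (disp_ccat B)))"
    by (subst bij_betw_cong[where g = "disp_trans A"]) (auto simp: disp_to_ccat_def)
qed

end

section \<open>The isomorphism of 2-categories and the transported adjunction\<close>

lemma disp_pairI: "A \<in> Cells0 sDMC \<Longrightarrow> B \<in> Cells0 sDMC \<Longrightarrow> disp_pair A B"
  by (simp add: disp_pair_def disp_categoryI)

lemma CompCat_sub_simps [simp]:
  "A \<in> Cells0 CompCat_sub_str2 \<longleftrightarrow> comprehension_category A \<and> subcategorical A"
  "Hom CompCat_sub_str2 = strict_hom"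
  "Unit CompCat_sub_str2 A = (id_ftor (base A), id_ftor (total A))"
  "Cmp1 CompCat_sub_str2 A B E M N =
     (comp_ftor (base A) (fst M) (fst N), comp_ftor (total A) (snd M) (snd N))"
  "Cmp2 CompCat_sub_str2 A B E \<tau> \<sigma> =
     (hcomp_nt (base A) (base E) (fst \<tau>) (fst \<sigma>), hcomp_nt (total A) (total E) (snd \<tau>) (snd \<sigma>))"
  by (auto simp: CompCat_sub_str2_def CompCat_str2_def split: prod.splits)

text \<open>The display class is the set of objects of the total category. The projection is forced
  by its factorization through the codomain functor, and cartesian lifts of arrows, read as squares
  via the comprehension, are the required pullbacks.\<close>

lemma subcategorical_is_disp:
  fixes E :: "('o, 'a, 'a, 'a square) ccat"
  assumes "E \<in> Cells0 CompCat_sub_str2"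
  shows "\<exists>A\<in>Cells0 sDMC. E = disp_ccat A"
proof -
  have cc: "comprehension_category E" and sub: "subcategorical E" using assms by simp_all
  from sub obtain X where X: "X \<subseteq> Arr (base E)" "total E = full_subcat (arrow_cat (base E)) X"
    and compr: "compr E = incl_ftor (total E)"
    by (auto simp: subcategorical_def full_subcategory_def)
  let ?A = "(base E, X)"
  have total: "total E = disp_total ?A" using X by (simp add: disp_total_def)
  have cat: "category (base E)" and fib: "fibration (total E) (base E) (proj E)"
    and proj: "comp_ftor (total E) (cod_ftor (base E)) (compr E) = proj E"
    and pb: "\<And>\<phi>. cartesian (total E) (base E) (proj E) \<phi> \<Longrightarrow> pullback_square (base E) (Fa (compr E) \<phi>)"
    using cc by (simp_all add: comprehension_category_def)
  have eq: "E = disp_ccat ?A"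
    using total compr proj by (simp add: disp_ccat_def)
  then have proj': "proj E = disp_proj ?A" by simp
  have "\<exists>d'\<in>X. \<exists>u. pullback_square (base E) (Square d' d u f)"
    if d: "d \<in> X" and f: "f \<in> Arr (base E)" "Cod (base E) f = Cod (base E) d" for d f
  proof -
    have dT: "d \<in> Obj (disp_total ?A)" using d X by auto
    have "Fo (proj E) d = Cod (base E) d"
      using disp_proj_simps(1)[OF dT] proj' by simp
    then obtain \<phi> where \<phi>: "cartesian (total E) (base E) (proj E) \<phi>" "Cod (total E) \<phi> = d"
      "Fa (proj E) \<phi> = f"
      using fib dT f unfolding fibration_def total by metis
    then have \<phi>T: "\<phi> \<in> Arr (disp_total ?A)" by (simp add: cartesian_def total)
    have "sq_tgt \<phi> = d" "sq_bot \<phi> = f" "sq_src \<phi> \<in> X"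
      using \<phi>(2,3) \<phi>T disp_total_simps(4)[OF \<phi>T] disp_proj_simps(2)[OF \<phi>T] by (simp_all add: total proj')
    moreover have "pullback_square (base E) \<phi>"
      using pb[OF \<phi>(1)] incl_ftor_simps(2)[OF \<phi>T] by (simp add: compr total)
    ultimately show ?thesis by (cases \<phi>) auto
  qed
  then have "?A \<in> Cells0 sDMC" using cat X(1) by (auto simp: display_structure_def)
  then show ?thesis using eq by blast
qed

theorem twocat_iso_sDMC: "twocat_iso (sDMC :: ('o, 'a) dm_twocat) CompCat_sub_str2 disp_to_ccat"
proof -
  have two_functor: "is_two_functor (sDMC :: ('o, 'a) dm_twocat) CompCat_sub_str2 disp_to_ccat"
  proof (rule is_two_functor.intro)
    fix A B E :: "('o, 'a) sdmcat"
    assume cells: "A \<in> Cells0 sDMC" "B \<in> Cells0 sDMC" "E \<in> Cells0 sDMC"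
    interpret AB: disp_pair A B using cells by (intro disp_pairI)
    interpret BE: disp_pair B E using cells by (intro disp_pairI)
    interpret S: two_category sDMC by (rule two_category_sDMC)
    have on0: "on0 disp_to_ccat X = disp_ccat X" for X :: "('o, 'a) sdmcat"
      by (simp add: disp_to_ccat_def)
    have onFo: "Fo (onHom disp_to_ccat X Y) F = disp_map X F" if "F \<in> Obj (Hom sDMC X Y)"
      for X Y :: "('o, 'a) sdmcat" and F
      using that by (simp add: disp_to_ccat_def)
    have onFa: "Fa (onHom disp_to_ccat X Y) \<alpha> = disp_trans X \<alpha>" if "\<alpha> \<in> Arr (Hom sDMC X Y)"
      for X Y :: "('o, 'a) sdmcat" and \<alpha>
      using that by (simp add: disp_to_ccat_def)
    show "on0 disp_to_ccat A \<in> Cells0 CompCat_sub_str2"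
      by (simp add: on0 AB.A.comprehension_category_disp AB.A.subcategorical_disp)
    show "is_functor (Hom sDMC A B) (Hom CompCat_sub_str2 (on0 disp_to_ccat A) (on0 disp_to_ccat B))
        (onHom disp_to_ccat A B)"
      using AB.disp_hom_functor by (simp add: on0)
    show "Fo (onHom disp_to_ccat A A) (Unit sDMC A) = Unit CompCat_sub_str2 (on0 disp_to_ccat A)"
      using onFo[OF S.Unit_cell[OF cells(1)]] disp_map_id[OF cells(1)] by (simp add: on0)
    show "Fo (onHom disp_to_ccat A E) (Cmp1 sDMC A B E G F) =
        Cmp1 CompCat_sub_str2 (on0 disp_to_ccat A) (on0 disp_to_ccat B) (on0 disp_to_ccat E)
          (Fo (onHom disp_to_ccat B E) G) (Fo (onHom disp_to_ccat A B) F)"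
      if "F \<in> Obj (Hom sDMC A B)" "G \<in> Obj (Hom sDMC B E)" for F G
      using onFo[OF S.Cmp1_cell[OF cells that]] AB.disp_map_comp[of F G] that
        onFo[OF that(1)] onFo[OF that(2)] by (simp add: on0)
    show "Fa (onHom disp_to_ccat A E) (Cmp2 sDMC A B E \<beta> \<alpha>) =
        Cmp2 CompCat_sub_str2 (on0 disp_to_ccat A) (on0 disp_to_ccat B) (on0 disp_to_ccat E)
          (Fa (onHom disp_to_ccat B E) \<beta>) (Fa (onHom disp_to_ccat A B) \<alpha>)"
      if "\<alpha> \<in> Arr (Hom sDMC A B)" "\<beta> \<in> Arr (Hom sDMC B E)" for \<alpha> \<beta>
      using onFa[OF S.Cmp2_cell[OF cells that]] AB.disp_trans_hcomp[OF that cells(3)]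
        onFa[OF that(1)] onFa[OF that(2)] by (simp add: on0)
  qed
  have "bij_betw (on0 disp_to_ccat) (Cells0 (sDMC :: ('o, 'a) dm_twocat)) (Cells0 CompCat_sub_str2)"
  \<comment> \<open>The inverse recovers the display class as the object set of the total category;
    on \<open>sDMC\<close> this loses nothing, since display maps are arrows of the base.\<close>
  proof (rule bij_betw_byWitness[where f' = "\<lambda>E. (base E, Obj (total E))"])
    show inv: "\<forall>A\<in>Cells0 (sDMC :: ('o, 'a) dm_twocat).
        (base (on0 disp_to_ccat A), Obj (total (on0 disp_to_ccat A))) = A"
      by (auto simp: disp_to_ccat_def display_structure_def)
    have *: "on0 disp_to_ccat (base E, Obj (total E)) = E \<and> (base E, Obj (total E)) \<in> Cells0 sDMC"
      if E: "E \<in> Cells0 CompCat_sub_str2" for E :: "('o, 'a, 'a, 'a square) ccat"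
    proof -
      obtain A where A: "A \<in> Cells0 sDMC" "E = on0 disp_to_ccat A"
        using subcategorical_is_disp[OF E] by (auto simp: disp_to_ccat_def)
      then have "(base E, Obj (total E)) = A" using inv by blast
      then show ?thesis using A by simp
    qed
    show "\<forall>E\<in>Cells0 (CompCat_sub_str2 :: ('o, 'a) sub_ccat_twocat). on0 disp_to_ccat (base E, Obj (total E)) = E"
      using * by blast
    show "(\<lambda>E. (base E, Obj (total E))) ` Cells0 CompCat_sub_str2 \<subseteq> Cells0 (sDMC :: ('o, 'a) dm_twocat)"
      using * by blast
    show "on0 disp_to_ccat ` Cells0 (sDMC :: ('o, 'a) dm_twocat) \<subseteq> Cells0 CompCat_sub_str2"
      by (rule image_subsetI) (rule is_two_functor.on0_cell[OF two_functor])
  qed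
  moreover have "cat_iso (Hom sDMC A B) (Hom CompCat_sub_str2 (on0 disp_to_ccat A) (on0 disp_to_ccat B))
      (onHom disp_to_ccat A B)"
    if "A \<in> Cells0 sDMC" "B \<in> Cells0 sDMC" for A B :: "('o, 'a) sdmcat"
    using disp_pair.disp_hom_iso[OF disp_pairI[OF that]] by (simp add: disp_to_ccat_def)
  ultimately show ?thesis using two_functor unfolding twocat_iso_def by blast
qed

lemma twocat_iso_DMC: "twocat_iso (DMC :: ('o, 'a) dm_twocat) CompCat_repl_str2 disp_to_ccat"
  unfolding DMC_def CompCat_repl_str2_def
proof (rule twocat_iso_full_sub[OF twocat_iso_sDMC])
  fix A :: "('o, 'a) sdmcat"
  assume "A \<in> Cells0 sDMC"
  then interpret disp_category A by (rule disp_categoryI)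
  show "(case A of (X, Y) \<Rightarrow> replete_maps X Y) \<longleftrightarrow>
      replete_in (total (on0 disp_to_ccat A)) (arrow_cat (base (on0 disp_to_ccat A)))"
    using replete_disp_iff by (simp add: disp_to_ccat_def case_prod_unfold)
qed

text \<open>The hom-categories come from \<open>category_transport\<close>, the remaining axioms
  from \<open>two_category_target\<close>.\<close>

lemma two_category_CompCat_sub: "two_category (CompCat_sub_str2 :: ('o, 'a) sub_ccat_twocat)"
proof -
  interpret two_isomorphism "sDMC :: ('o, 'a) dm_twocat" CompCat_sub_str2 disp_to_ccat
    using twocat_iso_sDMC two_category_sDMC
    by (auto intro!: two_isomorphism.intro simp: twocat_iso_def two_isomorphism_axioms_def)
  show ?thesis
  proof (rule two_category_target)
    fix E H :: "('o, 'a, 'a, 'a square) ccat"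
    assume "E \<in> Cells0 CompCat_sub_str2" "H \<in> Cells0 CompCat_sub_str2"
    then obtain A B where AB: "A \<in> Cells0 sDMC" "E = on0 disp_to_ccat A" "B \<in> Cells0 sDMC"
      "H = on0 disp_to_ccat B"
      using cell by blast
    show "category (Hom CompCat_sub_str2 E H)"
      using category_transport[OF X.Hom_category[OF AB(1,3)] hom_iso[OF AB(1,3)]]
      by (simp add: AB(2,4) strict_hom_ext)
  qed
qed

text \<open>The two isomorphisms express the sense in which the inclusions are equivalent: one and
  the same \<open>disp_to_ccat\<close> identifies both the sources and the targets.\<close>

theorem theorem25:
  shows "has_left_two_adjoint (DMC :: ('o, 'a) dm_twocat) (sDMC :: ('o, 'a) dm_twocat)
           (incl_twoftor DMC)
       \<and> has_left_two_adjoint (CompCat_repl_str2 :: ('o, 'a) sub_ccat_twocat)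
           (CompCat_sub_str2 :: ('o, 'a) sub_ccat_twocat) (incl_twoftor CompCat_repl_str2)
       \<and> twocat_iso (sDMC :: ('o, 'a) dm_twocat) (CompCat_sub_str2 :: ('o, 'a) sub_ccat_twocat)
           disp_to_ccat
       \<and> twocat_iso (DMC :: ('o, 'a) dm_twocat) (CompCat_repl_str2 :: ('o, 'a) sub_ccat_twocat)
           disp_to_ccat"
proof (intro conjI)
  show "has_left_two_adjoint (DMC :: ('o, 'a) dm_twocat) sDMC (incl_twoftor DMC)"
    using left_two_adjoint_DMC unfolding has_left_two_adjoint_def by blast
  show "has_left_two_adjoint (CompCat_repl_str2 :: ('o, 'a) sub_ccat_twocat) CompCat_sub_str2
      (incl_twoftor CompCat_repl_str2)"
  proof (rule has_left_two_adjoint_transport[OF left_two_adjoint_DMC twocat_iso_DMC twocat_iso_sDMC])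
    show "two_category (CompCat_repl_str2 :: ('o, 'a) sub_ccat_twocat)"
      unfolding CompCat_repl_str2_def by (rule two_category_full_sub[OF two_category_CompCat_sub])
    show "two_category (CompCat_sub_str2 :: ('o, 'a) sub_ccat_twocat)"
      by (rule two_category_CompCat_sub)
    show "is_two_functor (CompCat_repl_str2 :: ('o, 'a) sub_ccat_twocat) CompCat_sub_str2
        (incl_twoftor CompCat_repl_str2)"
      unfolding CompCat_repl_str2_def
      by (rule two_functor_incl[OF two_category_CompCat_sub])
    fix A B :: "('o, 'a) sdmcat"
    show "on0 (incl_twoftor CompCat_repl_str2) (on0 disp_to_ccat A) =
        on0 disp_to_ccat (on0 (incl_twoftor DMC) A)"
      by (simp add: incl_twoftor_def)
    assume cells: "A \<in> Cells0 DMC" "B \<in> Cells0 DMC"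
    have "cat_iso (Hom DMC A B) (Hom CompCat_repl_str2 (on0 disp_to_ccat A) (on0 disp_to_ccat B))
        (onHom disp_to_ccat A B)"
      using twocat_iso_DMC cells unfolding twocat_iso_def by blast
    then have "is_functor (Hom DMC A B) (Hom CompCat_repl_str2 (on0 disp_to_ccat A) (on0 disp_to_ccat B))
        (onHom disp_to_ccat A B)"
      by (simp add: cat_iso_def)
    \<comment> \<open>Both inclusions are identities on the cells of their hom-categories, so the
      comparison with \<open>disp_to_ccat\<close> needs only that its values are such cells.\<close>
    note cell = is_functor.Fo_Obj[OF this] is_functor.Fa_Arr[OF this]
    show "Fo (onHom (incl_twoftor CompCat_repl_str2) (on0 disp_to_ccat A) (on0 disp_to_ccat B))
          (Fo (onHom disp_to_ccat A B) F) =
        Fo (onHom disp_to_ccat (on0 (incl_twoftor DMC) A) (on0 (incl_twoftor DMC) B))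
          (Fo (onHom (incl_twoftor DMC) A B) F)" if "F \<in> Obj (Hom DMC A B)" for F
      unfolding incl_twoftor_def twoftor.simps incl_ftor_simps(1)[OF that] incl_ftor_simps(1)[OF cell(1)[OF that]] ..
    show "Fa (onHom (incl_twoftor CompCat_repl_str2) (on0 disp_to_ccat A) (on0 disp_to_ccat B))
          (Fa (onHom disp_to_ccat A B) \<alpha>) =
        Fa (onHom disp_to_ccat (on0 (incl_twoftor DMC) A) (on0 (incl_twoftor DMC) B))
          (Fa (onHom (incl_twoftor DMC) A B) \<alpha>)" if "\<alpha> \<in> Arr (Hom DMC A B)" for \<alpha>
      unfolding incl_twoftor_def twoftor.simps incl_ftor_simps(2)[OF that] incl_ftor_simps(2)[OF cell(2)[OF that]] ..
  qed
qed (rule twocat_iso_sDMC twocat_iso_DMC)+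

end
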